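(* Let $s\ge0$ and let $\{\mathcal{P}_{s,t}\}_{t\ge s}$ be the transfer operators of the (generally non-homogeneous) SDE $dx_t=v(t,x_t)\,dt+\varepsilon\,dw_t$ on $X$. Given $f\in L^1\cap L^\infty$ with $\int f\,dm=0$, define the families of sets $\{A_r^{\pm}\}_{r\ge s}$ by $A_r^\pm=\{\pm\mathcal{P}_{s,r}f\ge0\}$. Suppose that $\{A_r^\pm\}_{r\ge s}$ is a sufficiently nice family. Then $$E(\{A_r^\pm\}_{r\ge s})\le-\Lambda_s(f).$$
   Context: Standing assumptions: $X$ is a bounded domain in $\mathbb{R}^d$, uniformly regular of class $C^4$; $v:[0,\infty)\times\overline X\to\mathbb{R}^d$ is a continuously differentiable time-dependent vector field (not necessarily periodic in time), divergence-free for all times and tangential to $\partial X$ on $\partial X$ for all times; $\{w_t\}$ is a standard $d$-dimensional Wiener process; $\varepsilon>0$; the process has reflecting boundary conditions at $\partial X$. $m$ is Lebesgue measure, $L^r=L^r(X,m)$, and $f$ is real-valued. Transfer operator: with $q_{s,t}(y,z)$ the transition density of the process ($\mathbb{P}(x_t\in A\mid x_s=y)=\int_Aq_{s,t}(y,z)\,dm(z)$), $\mathcal{P}_{s,t}f=\int_Xq_{s,t}(y,\cdot)f(y)\,dm(y)$ for $t\geq s$. Lyapunov exponent: $\Lambda_s(f):=\limsup_{t\to\infty}\frac1{t-s}\log\|\mathcal{P}_{s,t}f\|_{L^1}$. Sufficiently nice: a family of sets $\{A_r\}_{r\in\mathcal I}$, $\mathcal I\subset\mathbb{R}$ an interval,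 is sufficiently nice if (i) $A_r$ is closed for every $r\in\mathcal I$; and (ii) the function $\sigma\mapsto h(A_r,A_{r+\sigma})$ is either left- or right-continuous at $\sigma=0$ for every $r\in\mathcal I$, where $h$ is the Hausdorff distance. Escape rate: $E(\{A_r\}_{r\ge s})=-\limsup_{t\to\infty}\frac1{t-s}\log\mathbb{P}_{x_s\sim m}\big(x_r\in A_r\ \forall r\in[s,t]\big)$, where $x_s\sim m$ means $x_s$ has distribution $m$ (which may be normalized to a probability measure), and $\log 0=-\infty$. *)

theory Defs
  imports "HOL-Probability.Probability"
begin

primrec Ck_on :: "nat \<Rightarrow> ('a::euclidean_space \<Rightarrow> 'b::real_normed_vector) \<Rightarrow> 'a set \<Rightarrow> bool" where
  "Ck_on 0 f U \<longleftrightarrow> continuous_on U f"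
| "Ck_on (Suc k) f U \<longleftrightarrow> (\<forall>x\<in>U. f differentiable (at x)) \<and>
     (\<forall>b\<in>Basis. Ck_on k (\<lambda>x. frechet_derivative f (at x) b) U)"

text \<open>All partial derivatives of order at most \<open>k\<close> are bounded by \<open>C\<close> on \<open>U\<close>.\<close>

primrec partials_bounded ::
    "nat \<Rightarrow> real \<Rightarrow> ('a::euclidean_space \<Rightarrow> 'b::real_normed_vector) \<Rightarrow> 'a set \<Rightarrow> bool" where
  "partials_bounded 0 C f U \<longleftrightarrow> (\<forall>x\<in>U. norm (f x) \<le> C)"
| "partials_bounded (Suc k) C f U \<longleftrightarrow> (\<forall>x\<in>U. norm (f x) \<le> C) \<and>
     (\<forall>b\<in>Basis. partials_bounded k C (\<lambda>x. frechet_derivative f (at x) b) U)"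

text \<open>Uniform regularity in the sense of Browder: charts flattening the boundary with uniformly
  bounded derivatives, of bounded overlap, and such that the preimages of the balls of radius
  \<open>1/2\<close> cover a uniform neighbourhood of the boundary.\<close>

definition uniformly_regular :: "nat \<Rightarrow> (real^'d) set \<Rightarrow> bool" where
  "uniformly_regular k X \<longleftrightarrow>
    (\<exists>(I :: nat set) (U :: nat \<Rightarrow> (real^'d) set) (\<phi> :: nat \<Rightarrow> real^'d \<Rightarrow> real^'d)
      (\<psi> :: nat \<Rightarrow> real^'d \<Rightarrow> real^'d) (j :: 'd) (N :: nat) (\<delta> :: real) (C :: real).
      \<delta> > 0 \<and>
      (\<forall>i\<in>I. open (U i) \<and> homeomorphism (U i) (ball 0 1) (\<phi> i) (\<psi> i) \<and>
        Ck_on k (\<phi> i) (U i) \<and> Ck_on k (\<psi> i) (ball 0 1) \<and>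
        partials_bounded k C (\<phi> i) (U i) \<and> partials_bounded k C (\<psi> i) (ball 0 1) \<and>
        \<phi> i ` (U i \<inter> X) = {y \<in> ball 0 1. y $ j > 0}) \<and>
      (\<forall>J\<subseteq>I. finite J \<and> card J = N + 1 \<longrightarrow> (\<Inter>i\<in>J. U i) = {}) \<and>
      (\<Union>x\<in>frontier X. ball x \<delta>) \<subseteq> (\<Union>i\<in>I. \<psi> i ` ball 0 (1/2)))"

text \<open>The inward unit normal: the normalized gradient of a local \<open>C\<^sup>1\<close> defining function. Only
  meaningful at points of the boundary of a \<open>C\<^sup>1\<close> domain, where it does not depend on the
  defining function.\<close>

definition inward_normal :: "(real^'d) set \<Rightarrow> real^'d \<Rightarrow> real^'d" where
  "inward_normal X x = (THE n. norm n = 1 \<and>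
     (\<exists>U (\<rho> :: real^'d \<Rightarrow> real) c. open U \<and> x \<in> U \<and> Ck_on 1 \<rho> U \<and>
        X \<inter> U = {y \<in> U. \<rho> y > 0} \<and> \<rho> x = 0 \<and> c > 0 \<and>
        (\<rho> has_derivative (\<lambda>h. c * (n \<bullet> h))) (at x)))"

definition C1_field :: "(real^'d) set \<Rightarrow> (real \<Rightarrow> real^'d \<Rightarrow> real^'d) \<Rightarrow> bool" where
  "C1_field X v \<longleftrightarrow>
    (\<exists>v' :: real \<times> (real^'d) \<Rightarrow> (real \<times> (real^'d)) \<Rightarrow>\<^sub>L (real^'d).
      (\<forall>p \<in> {0..} \<times> closure X.
        ((\<lambda>(t, x). v t x) has_derivative blinfun_apply (v' p)) (at p within {0..} \<times> closure X)) \<and>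
      continuous_on ({0..} \<times> closure X) v')"

definition divergence_free :: "(real^'d) set \<Rightarrow> (real \<Rightarrow> real^'d \<Rightarrow> real^'d) \<Rightarrow> bool" where
  "divergence_free X v \<longleftrightarrow>
    (\<forall>t\<ge>0. \<forall>x\<in>X. (\<Sum>i\<in>UNIV. frechet_derivative (v t) (at x) (axis i 1) $ i) = 0)"

definition tangential :: "(real^'d) set \<Rightarrow> (real \<Rightarrow> real^'d \<Rightarrow> real^'d) \<Rightarrow> bool" where
  "tangential X v \<longleftrightarrow> (\<forall>t\<ge>0. \<forall>x\<in>frontier X. v t x \<bullet> inward_normal X x = 0)"

definition wiener_process :: "'w measure \<Rightarrow> (real \<Rightarrow> 'w \<Rightarrow> real^'d) \<Rightarrow> bool" where
  "wiener_process M w \<longleftrightarrow> prob_space M \<and>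
    (\<forall>\<omega>\<in>space M. w 0 \<omega> = 0 \<and> continuous_on {0..} (\<lambda>t. w t \<omega>)) \<and>
    (\<forall>t\<ge>0. w t \<in> borel_measurable M) \<and>
    (\<forall>s t. 0 \<le> s \<and> s < t \<longrightarrow>
      distributed M lborel (\<lambda>\<omega>. w t \<omega> - w s \<omega>)
        (\<lambda>h. ennreal (\<Prod>i\<in>UNIV. normal_density 0 (sqrt (t - s)) (h $ i)))) \<and>
    (\<forall>(\<tau> :: nat \<Rightarrow> real) n. 0 \<le> \<tau> 0 \<and> mono \<tau> \<longrightarrow>
      prob_space.indep_vars M (\<lambda>_. borel) (\<lambda>i \<omega>. w (\<tau> (Suc i)) \<omega> - w (\<tau> i) \<omega>) {..<n})"

text \<open>Since the noise is additive, \<open>dx\<^sub>t = v(t,x\<^sub>t) dt + \<epsilon> dw\<^sub>t\<close> with reflection at the boundary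
  (the Skorokhod problem with normal reflection) is an equation for individual paths. The
  nondecreasing function \<open>L\<close> is the boundary local time: it increases only while the path is on
  the boundary, and pushes the path in the direction of the inward normal.\<close>

definition reflected_path ::
    "(real^'d) set \<Rightarrow> (real \<Rightarrow> real^'d \<Rightarrow> real^'d) \<Rightarrow> real \<Rightarrow> real \<Rightarrow>
     (real \<Rightarrow> real^'d) \<Rightarrow> (real \<Rightarrow> real^'d) \<Rightarrow> bool" where
  "reflected_path X v \<epsilon> s w x \<longleftrightarrow>
    continuous_on {s..} x \<and> (\<forall>t\<ge>s. x t \<in> closure X) \<and>
    (\<exists>L :: real \<Rightarrow> real. mono L \<and> continuous_on UNIV L \<and>
      {r. s \<le> r \<and> x r \<notin> frontier X} \<in> null_sets (interval_measure L) \<and>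
      (\<forall>t\<ge>s. x t = x s + integral {s..t} (\<lambda>r. v r (x r)) + \<epsilon> *\<^sub>R (w t - w s) +
        (LINT r : {r\<in>{s..t}. x r \<in> frontier X} | interval_measure L. inward_normal X (x r))))"

definition increment_algebra ::
    "'w measure \<Rightarrow> (real \<Rightarrow> 'w \<Rightarrow> real^'d) \<Rightarrow> real \<Rightarrow> real \<Rightarrow> 'w measure" where
  "increment_algebra M w s t =
    sigma (space M) {(\<lambda>\<omega>. w u \<omega> - w s \<omega>) -` B \<inter> space M | u B. s \<le> u \<and> u \<le> t \<and> B \<in> sets borel}"

text \<open>Strong solutions in the sense of Ikeda and Watanabe: \<open>x s y t \<omega>\<close> is the position at time \<open>t\<close>
  of the process started at time \<open>s\<close> in \<open>y\<close>; it depends measurably on the initial point and on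
  the increments of the Wiener process between the times \<open>s\<close> and \<open>t\<close>.\<close>

definition reflected_sde_solution ::
    "(real^'d) set \<Rightarrow> (real \<Rightarrow> real^'d \<Rightarrow> real^'d) \<Rightarrow> real \<Rightarrow> 'w measure \<Rightarrow>
     (real \<Rightarrow> 'w \<Rightarrow> real^'d) \<Rightarrow> (real \<Rightarrow> real^'d \<Rightarrow> real \<Rightarrow> 'w \<Rightarrow> real^'d) \<Rightarrow> bool" where
  "reflected_sde_solution X v \<epsilon> M w x \<longleftrightarrow>
    (\<forall>s\<ge>0. \<forall>y\<in>closure X. \<forall>\<omega>\<in>space M.
      x s y s \<omega> = y \<and> reflected_path X v \<epsilon> s (\<lambda>t. w t \<omega>) (\<lambda>t. x s y t \<omega>)) \<and>
    (\<forall>s t. 0 \<le> s \<and> s \<le> t \<longrightarrow>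
      (\<lambda>(y, \<omega>). x s y t \<omega>) \<in>
        borel_measurable (restrict_space borel (closure X) \<Otimes>\<^sub>M increment_algebra M w s t))"

definition transition_density ::
    "(real^'d) set \<Rightarrow> 'w measure \<Rightarrow> (real \<Rightarrow> real^'d \<Rightarrow> real \<Rightarrow> 'w \<Rightarrow> real^'d) \<Rightarrow>
     (real \<Rightarrow> real \<Rightarrow> real^'d \<Rightarrow> real^'d \<Rightarrow> real) \<Rightarrow> bool" where
  "transition_density X M x q \<longleftrightarrow> (\<forall>s t. 0 \<le> s \<and> s < t \<longrightarrow>
    (\<lambda>(y, z). q s t y z) \<in>
      borel_measurable (restrict_space borel (closure X) \<Otimes>\<^sub>M restrict_space borel (closure X)) \<and>
    (\<forall>y\<in>closure X. \<forall>z\<in>closure X. q s t y z \<ge> 0) \<and>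
    (\<forall>y\<in>closure X. \<forall>A\<in>sets borel.
      emeasure M {\<omega>\<in>space M. x s y t \<omega> \<in> A} = (\<integral>\<^sup>+z \<in> A \<inter> X. ennreal (q s t y z) \<partial>lborel)))"

text \<open>At \<open>t = s\<close> the transition kernel is a Dirac measure and the transfer operator the identity.\<close>

definition transfer_op ::
    "(real^'d) set \<Rightarrow> (real \<Rightarrow> real \<Rightarrow> real^'d \<Rightarrow> real^'d \<Rightarrow> real) \<Rightarrow> real \<Rightarrow> real \<Rightarrow>
     (real^'d \<Rightarrow> real) \<Rightarrow> real^'d \<Rightarrow> real" where
  "transfer_op X q s t f z =
    (if t = s then f z else (LINT y | lebesgue_on X. q s t y z * f y))"

definition ext_ln :: "real \<Rightarrow> ereal" where
  "ext_ln a = (if a = 0 then -\<infinity> else ereal (ln a))"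

definition lyapunov_exponent ::
    "(real^'d) set \<Rightarrow> (real \<Rightarrow> real \<Rightarrow> real^'d \<Rightarrow> real^'d \<Rightarrow> real) \<Rightarrow> real \<Rightarrow>
     (real^'d \<Rightarrow> real) \<Rightarrow> ereal" where
  "lyapunov_exponent X q s f =
    Limsup at_top (\<lambda>t. ereal (1 / (t - s)) *
      ext_ln (LINT z | lebesgue_on X. \<bar>transfer_op X q s t f z\<bar>))"

text \<open>The values are in \<open>[0,\<infinity>]\<close>, so that a nonempty set has distance \<open>\<infinity>\<close> from the empty set.\<close>

definition hausdorff_dist :: "'a::metric_space set \<Rightarrow> 'a set \<Rightarrow> ennreal" where
  "hausdorff_dist A B =
    max (SUP a\<in>A. INF b\<in>B. ennreal (dist a b)) (SUP b\<in>B. INF a\<in>A. ennreal (dist a b))"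

text \<open>The function \<open>\<sigma> \<mapsto> h(A\<^sub>r, A\<^bsub>r+\<sigma>\<^esub>)\<close> has the domain \<open>{\<sigma>. r + \<sigma> \<in> I}\<close>. At an end point of \<open>I\<close> that
  belongs to \<open>I\<close>, continuity from the outer side is void.\<close>

definition sufficiently_nice :: "real set \<Rightarrow> (real \<Rightarrow> 'a::metric_space set) \<Rightarrow> bool" where
  "sufficiently_nice I A \<longleftrightarrow> is_interval I \<and> (\<forall>r\<in>I. closed (A r)) \<and>
    (\<forall>r\<in>I.
      continuous (at 0 within {\<sigma>. \<sigma> \<le> 0 \<and> r + \<sigma> \<in> I}) (\<lambda>\<sigma>. hausdorff_dist (A r) (A (r + \<sigma>))) \<or>
      continuous (at 0 within {\<sigma>. \<sigma> \<ge> 0 \<and> r + \<sigma> \<in> I}) (\<lambda>\<sigma>. hausdorff_dist (A r) (A (r + \<sigma>))))"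

text \<open>The process with \<open>x\<^sub>s\<close> distributed according to normalized Lebesgue measure on \<open>X\<close> (and
  independent of the noise) is realized on the product of \<open>X\<close> and the probability space.\<close>

definition escape_rate ::
    "(real^'d) set \<Rightarrow> 'w measure \<Rightarrow> (real \<Rightarrow> real^'d \<Rightarrow> real \<Rightarrow> 'w \<Rightarrow> real^'d) \<Rightarrow> real \<Rightarrow>
     (real \<Rightarrow> (real^'d) set) \<Rightarrow> ereal" where
  "escape_rate X M x s A =
    - Limsup at_top (\<lambda>t. ereal (1 / (t - s)) *
      ext_ln (measure (uniform_measure lborel X \<Otimes>\<^sub>M M)
        {(y, \<omega>). y \<in> X \<and> \<omega> \<in> space M \<and> (\<forall>r\<in>{s..t}. x s y r \<omega> \<in> A r)}))"

text \<open>The sets \<open>{\<plusminus> P\<^sub>s\<^sub>,\<^sub>r f \<ge> 0}\<close>, with the sign passed as \<open>\<eta>\<close>. They are subsets of the state space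
  of the reflected process, which is the closure of \<open>X\<close>.\<close>

definition sign_set ::
    "(real^'d) set \<Rightarrow> (real \<Rightarrow> real \<Rightarrow> real^'d \<Rightarrow> real^'d \<Rightarrow> real) \<Rightarrow> real \<Rightarrow>
     (real^'d \<Rightarrow> real) \<Rightarrow> real \<Rightarrow> real \<Rightarrow> (real^'d) set" where
  "sign_set X q s f \<eta> r = {z \<in> closure X. \<eta> * transfer_op X q s r f z \<ge> 0}"

end

theory Submission
  imports Defs
begin

text \<open>Let \<open>h\<^sub>r\<close> be the transferred density at time \<open>r\<close>. Since the transition kernels are positive, killing the
  mass outside \<open>{h\<^sub>r \<ge> 0}\<close> at finitely many times keeps the transported positive part of \<open>f\<close> above the
  positive part of \<open>h\<^sub>r\<close>. As \<open>f\<close> is bounded and has mean zero, the probability of staying in these sets at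
  finitely many times up to \<open>t\<close> is therefore at least a constant multiple of the \<open>L\<^sup>1\<close> norm of \<open>h\<^sub>t\<close>. This
  passes to a countable dense set of times, and then to all times by continuity of the paths and
  one-sided Hausdorff continuity of the sets. The constant disappears in the exponential rate.

  The Markov property behind this comes from the flow property of the strong solutions and the
  independence of the increments. The flow property is pathwise uniqueness of the Skorokhod problem: the
  additive noise cancels in the difference of two solutions, whose square obeys a Gronwall inequality
  with respect to time and the two local times, because a uniformly regular domain has exterior balls.\<close>

section \<open>The boundary in local charts\<close>

text \<open>The lower bound is proved by testing against nonnegative functions. Composing transfer
  operators would call for a Chapman-Kolmogorov identity for the densities; instead, a test function
  at the last time is carried back by the expectation along the flow, and duality turns this into a
  statement about the transferred density. Mean zero enters through conservation of mass: the
  positive part of the density carries half of its norm at every time. Two features of the geometry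
  shape the uniqueness proof. The bounds on the normal and on the field are local, so two solutions
  are compared on a short interval after the first time at which they separate. The field is given
  only on the closure of \<open>X\<close>, which may fail to be convex, so its Lipschitz bound near
  the boundary is obtained in charts. The event of staying in the sets at all times imposes
  uncountably many conditions; it is measurable because it coincides with the event along the
  rational times.\<close>

lemma linear_norm_le_Basis:
  fixes D :: "'a::euclidean_space \<Rightarrow> 'b::real_normed_vector"
  assumes lin: "linear D" and C: "\<And>b. b \<in> Basis \<Longrightarrow> norm (D b) \<le> C"
  shows "norm (D h) \<le> C * DIM('a) * norm h"
proof -
  have "D h = D (\<Sum>b\<in>Basis. (h \<bullet> b) *\<^sub>R b)"
    by (simp add: euclidean_representation)
  also have "\<dots> = (\<Sum>b\<in>Basis. (h \<bullet> b) *\<^sub>R D b)"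
    by (simp add: linear_sum[OF lin] linear_scale[OF lin])
  also have "norm \<dots> \<le> (\<Sum>b\<in>(Basis::'a set). C * norm h)"
  proof (rule sum_norm_le)
    fix b :: 'a assume b: "b \<in> Basis"
    have "norm ((h \<bullet> b) *\<^sub>R D b) = \<bar>h \<bullet> b\<bar> * norm (D b)" by simp
    also have "\<dots> \<le> norm h * C"
      by (rule mult_mono) (use b C[OF b] Basis_le_norm in auto)
    finally show "norm ((h \<bullet> b) *\<^sub>R D b) \<le> C * norm h" by (simp add: mult.commute)
  qed
  finally show ?thesis by (simp add: mult_ac)
qed

lemma partials_lipschitz:
  fixes f :: "'a::euclidean_space \<Rightarrow> 'b::real_normed_vector"
  assumes S: "convex S"
    and d: "\<And>x. x \<in> S \<Longrightarrow> f differentiable (at x)"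
    and C: "\<And>x b. x \<in> S \<Longrightarrow> b \<in> Basis \<Longrightarrow> norm (frechet_derivative f (at x) b) \<le> C"
    and "x \<in> S" "y \<in> S"
  shows "norm (f x - f y) \<le> C * DIM('a) * norm (x - y)"
proof (rule differentiable_bound[OF S _ _ \<open>x \<in> S\<close> \<open>y \<in> S\<close>])
  fix z assume z: "z \<in> S"
  have der: "(f has_derivative frechet_derivative f (at z)) (at z)"
    using d[OF z] frechet_derivative_works by blast
  then show "(f has_derivative frechet_derivative f (at z)) (at z within S)"
    by (rule has_derivative_at_withinI)
  show "onorm (frechet_derivative f (at z)) \<le> C * DIM('a)"
    by (intro onorm_le linear_norm_le_Basis has_derivative_linear[OF der] C z)
qed

text \<open>Two distinct unit candidates \<open>n\<close> and \<open>m\<close> give a direction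
  \<open>n - m\<close> along which one defining function increases from 0 and the other decreases,
  so points close to \<open>x\<close> on this ray would lie both in \<open>X\<close> and outside it.
  Hence any single defining function settles the definite description.\<close>

lemma inward_normal_eq:
  fixes X :: "(real^'d) set"
  assumes "open U" "x \<in> U" "Ck_on 1 \<rho> U" "X \<inter> U = {y \<in> U. \<rho> y > 0}" "\<rho> x = 0" "c > 0"
    and "norm n = 1" "(\<rho> has_derivative (\<lambda>h. c * (n \<bullet> h))) (at x)"
  shows "inward_normal X x = n"
  unfolding inward_normal_def
proof (rule the_equality)
  show "norm n = 1 \<and>
     (\<exists>U (\<rho> :: real^'d \<Rightarrow> real) c. open U \<and> x \<in> U \<and> Ck_on 1 \<rho> U \<and>
        X \<inter> U = {y \<in> U. \<rho> y > 0} \<and> \<rho> x = 0 \<and> c > 0 \<and>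
        (\<rho> has_derivative (\<lambda>h. c * (n \<bullet> h))) (at x))"
    using assms by blast
next
  \<comment> \<open>Stated for an arbitrary function, not one that defines \<open>X\<close>, since
    along the same \<open>h\<close> it is applied to \<rho> and to the negative of \<rho>'.\<close>
  have ray: "\<exists>e>0. \<forall>t. 0 < t \<and> t < e \<longrightarrow> x + t *\<^sub>R h \<in> U \<and> \<rho> (x + t *\<^sub>R h) > 0"
    if U: "open U" "x \<in> U" and rx: "\<rho> x = 0" and D: "(\<rho> has_derivative (\<lambda>h. c * (n \<bullet> h))) (at x)"
      and c: "c > 0" "n \<bullet> h > 0" for U and \<rho> :: "real^'d \<Rightarrow> real" and c n h
  proof -
    have D': "((\<lambda>t::real. x + t *\<^sub>R h) has_derivative (\<lambda>t. t *\<^sub>R h)) (at 0)"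
      by (auto intro!: derivative_eq_intros)
    have "((\<lambda>t. \<rho> (x + t *\<^sub>R h)) has_derivative (\<lambda>t. c * (n \<bullet> (t *\<^sub>R h)))) (at 0)"
      by (rule has_derivative_compose[OF D', of \<rho>]) (use D in simp)
    then have "((\<lambda>t. \<rho> (x + t *\<^sub>R h)) has_real_derivative (c * (n \<bullet> h))) (at 0)"
      by (simp add: has_field_derivative_def mult_ac mult_commute_abs)
    then have "\<exists>d>0. \<forall>t>0. t < d \<longrightarrow> \<rho> (x + 0 *\<^sub>R h) < \<rho> (x + (0 + t) *\<^sub>R h)"
      by (rule DERIV_pos_inc_right) (use c in simp)
    then obtain d where d: "d > 0" "\<And>t. t > 0 \<Longrightarrow> t < d \<Longrightarrow> \<rho> (x + t *\<^sub>R h) > 0"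
      using rx by auto
    have "\<forall>\<^sub>F t in at_right 0. x + t *\<^sub>R h \<in> U"
    proof (rule topological_tendstoD[OF _ \<open>open U\<close>])
      have "((\<lambda>t. x + t *\<^sub>R h) \<longlongrightarrow> x + 0 *\<^sub>R h) (at_right 0)" by (intro tendsto_intros)
      then show "((\<lambda>t. x + t *\<^sub>R h) \<longlongrightarrow> x) (at_right 0)" by simp
    qed fact
    then obtain d' where "d' > 0" "\<And>t. t > 0 \<Longrightarrow> t < d' \<Longrightarrow> x + t *\<^sub>R h \<in> U"
      unfolding eventually_at_right_field by auto
    with d show ?thesis by (intro exI[of _ "min d d'"]) auto
  qed
  fix m :: "real^'d"
  assume "norm m = 1 \<and>
     (\<exists>U (\<rho> :: real^'d \<Rightarrow> real) c. open U \<and> x \<in> U \<and> Ck_on 1 \<rho> U \<and>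
        X \<inter> U = {y \<in> U. \<rho> y > 0} \<and> \<rho> x = 0 \<and> c > 0 \<and>
        (\<rho> has_derivative (\<lambda>h. c * (m \<bullet> h))) (at x))"
  then obtain U' \<rho>' c' where m: "norm m = 1" "open U'" "x \<in> U'"
    "X \<inter> U' = {y \<in> U'. \<rho>' y > 0}" "\<rho>' x = 0" "c' > 0"
    "(\<rho>' has_derivative (\<lambda>h. c' * (m \<bullet> h))) (at x)" by blast
  show "m = n"
  proof (rule ccontr)
    assume "m \<noteq> n"
    then have "(norm (n - m))\<^sup>2 > 0" by simp
    then have *: "n \<bullet> m < 1"
      using assms(7) m(1) by (simp add: power2_norm_eq_inner inner_diff inner_commute norm_eq_1)
    define h where "h = n - m"
    have n1: "n \<bullet> h > 0" "m \<bullet> (- h) > 0"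
      using * assms(7) m(1) by (auto simp: h_def inner_diff inner_commute norm_eq_1)
    from ray[OF assms(1,2,5,8,6) n1(1)] obtain e where e: "e > 0"
      "\<And>t. 0 < t \<Longrightarrow> t < e \<Longrightarrow> x + t *\<^sub>R h \<in> U \<and> \<rho> (x + t *\<^sub>R h) > 0" by auto
    have "((\<lambda>y. - \<rho>' y) has_derivative (\<lambda>h. c' * ((-m) \<bullet> h))) (at x)"
      using has_derivative_minus[OF m(7)] by simp
    from ray[OF m(2,3) _ this m(6), of h] n1(2) m(5) obtain e' where e': "e' > 0"
      "\<And>t. 0 < t \<Longrightarrow> t < e' \<Longrightarrow> x + t *\<^sub>R h \<in> U' \<and> - \<rho>' (x + t *\<^sub>R h) > 0" by auto
    define t where "t = min e e' / 2"
    have t: "0 < t" "t < e" "t < e'" using e(1) e'(1) by (auto simp: t_def)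
    have "x + t *\<^sub>R h \<in> X" using e(2)[OF t(1,2)] assms(4) by blast
    then have "\<rho>' (x + t *\<^sub>R h) > 0" using e'(2)[OF t(1,3)] m(4) by blast
    then show False using e'(2)[OF t(1,3)] by simp
  qed
qed

text \<open>The second partials of \<phi> are recorded because the normal comes from the first ones
  and exterior balls ask for a Lipschitz normal. The bound on the first partials of \<psi> serves
  the chain rule in the Lipschitz estimate for the field.\<close>

definition boundary_chart ::
  "(real^'d) set \<Rightarrow> (real^'d) set \<Rightarrow> (real^'d \<Rightarrow> real^'d) \<Rightarrow> (real^'d \<Rightarrow> real^'d) \<Rightarrow> 'd \<Rightarrow> real \<Rightarrow> bool" where
  "boundary_chart X U \<phi> \<psi> j C \<longleftrightarrow> open U \<and> homeomorphism U (ball 0 1) \<phi> \<psi> \<and>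
     (\<forall>x\<in>U. \<phi> differentiable (at x)) \<and> (\<forall>y\<in>ball 0 1. \<psi> differentiable (at y)) \<and>
     (\<forall>x\<in>U. \<forall>b\<in>Basis. norm (frechet_derivative \<phi> (at x) b) \<le> C \<and>
        (\<lambda>x. frechet_derivative \<phi> (at x) b) differentiable (at x) \<and>
        (\<forall>b'\<in>Basis. norm (frechet_derivative (\<lambda>x. frechet_derivative \<phi> (at x) b) (at x) b') \<le> C)) \<and>
     (\<forall>y\<in>ball 0 1. \<forall>b\<in>Basis. norm (frechet_derivative \<psi> (at y) b) \<le> C) \<and>
     \<phi> ` (U \<inter> X) = {y \<in> ball 0 1. y $ j > 0}"

lemma uniformly_regular_chart:
  fixes X :: "(real^'d) set"
  assumes "uniformly_regular 4 X" "p \<in> frontier X"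
  obtains U \<phi> \<psi> j C where "boundary_chart X U \<phi> \<psi> j C" "p \<in> U"
proof -
  obtain I :: "nat set" and U and \<phi> \<psi> :: "nat \<Rightarrow> real^'d \<Rightarrow> real^'d" and j \<delta> C where \<delta>: "\<delta> > 0" and
    ch: "\<forall>i\<in>I. open (U i) \<and> homeomorphism (U i) (ball 0 1) (\<phi> i) (\<psi> i) \<and>
        Ck_on 4 (\<phi> i) (U i) \<and> Ck_on 4 (\<psi> i) (ball 0 1) \<and>
        partials_bounded 4 C (\<phi> i) (U i) \<and> partials_bounded 4 C (\<psi> i) (ball 0 1) \<and>
        \<phi> i ` (U i \<inter> X) = {y \<in> ball 0 1. y $ j > 0}" and
    cov: "(\<Union>x\<in>frontier X. ball x \<delta>) \<subseteq> (\<Union>i\<in>I. \<psi> i ` ball 0 (1/2))"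
    using assms(1) unfolding uniformly_regular_def by (elim exE conjE) (rule that; assumption)
  have "p \<in> (\<Union>x\<in>frontier X. ball x \<delta>)"
    by (rule UN_I[OF assms(2)]) (simp add: \<delta>)
  then have "p \<in> (\<Union>i\<in>I. \<psi> i ` ball 0 (1/2))" by (rule subsetD[OF cov])
  then obtain i where i: "i \<in> I" "p \<in> \<psi> i ` ball 0 (1/2)" by (elim UN_E)
  have "ball (0::real^'d) (1/2) \<subseteq> ball 0 1" by auto
  with i bspec[OF ch i(1)] have "p \<in> U i" by (auto simp: homeomorphism_def)
  \<comment> \<open>Writing 4 as iterated successors unfolds \<open>Ck_on\<close> and
    \<open>partials_bounded\<close> down to the orders that \<open>boundary_chart\<close>
    mentions.\<close>
  moreover have "boundary_chart X (U i) (\<phi> i) (\<psi> i) j C"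
    using bspec[OF ch i(1)] unfolding boundary_chart_def by (simp add: eval_nat_numeral)
  ultimately show thesis using that by blast
qed

text \<open>The gradient of component \<open>j\<close> of \<phi>, which is the local defining
  function of \<open>X\<close>. It is assembled from partial derivatives because the chart bounds
  are stated for those.\<close>

definition chart_grad :: "(real^'d \<Rightarrow> real^'d) \<Rightarrow> 'd \<Rightarrow> real^'d \<Rightarrow> real^'d" where
  "chart_grad \<phi> j x = (\<Sum>b\<in>Basis. (frechet_derivative \<phi> (at x) b $ j) *\<^sub>R b)"

context
  fixes X :: "(real^'d) set" and U \<phi> \<psi> j C
  assumes ch: "boundary_chart X U \<phi> \<psi> j C"
begin

lemma chart_basic:
  shows "open U" "homeomorphism U (ball 0 1) \<phi> \<psi>" "\<And>x. x \<in> U \<Longrightarrow> \<phi> differentiable (at x)"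
    "\<And>y. y \<in> ball 0 1 \<Longrightarrow> \<psi> differentiable (at y)"
    "\<And>x b. x \<in> U \<Longrightarrow> b \<in> Basis \<Longrightarrow> norm (frechet_derivative \<phi> (at x) b) \<le> C"
    "\<And>x b. x \<in> U \<Longrightarrow> b \<in> Basis \<Longrightarrow> (\<lambda>x. frechet_derivative \<phi> (at x) b) differentiable (at x)"
    "\<And>x b b'. x \<in> U \<Longrightarrow> b \<in> Basis \<Longrightarrow> b' \<in> Basis \<Longrightarrow>
      norm (frechet_derivative (\<lambda>x. frechet_derivative \<phi> (at x) b) (at x) b') \<le> C"
    "\<And>y b. y \<in> ball 0 1 \<Longrightarrow> b \<in> Basis \<Longrightarrow> norm (frechet_derivative \<psi> (at y) b) \<le> C"
    "\<phi> ` (U \<inter> X) = {y \<in> ball 0 1. y $ j > 0}"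
  using ch by (simp_all add: boundary_chart_def)

lemma chart_inv:
  shows "\<And>x. x \<in> U \<Longrightarrow> \<phi> x \<in> ball 0 1" "\<And>y. y \<in> ball 0 1 \<Longrightarrow> \<psi> y \<in> U"
    "\<And>x. x \<in> U \<Longrightarrow> \<psi> (\<phi> x) = x" "\<And>y. y \<in> ball 0 1 \<Longrightarrow> \<phi> (\<psi> y) = y"
  using chart_basic(2) unfolding homeomorphism_def by auto

lemma chart_derivative:
  assumes "x \<in> U" shows "((\<lambda>x. \<phi> x $ j) has_derivative (\<lambda>h. chart_grad \<phi> j x \<bullet> h)) (at x)"
proof -
  let ?D = "frechet_derivative \<phi> (at x)"
  have D: "(\<phi> has_derivative ?D) (at x)"
    using chart_basic(3)[OF assms] frechet_derivative_works by blast
  then have lin: "linear ?D" using has_derivative_linear by blast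
  have "?D h $ j = chart_grad \<phi> j x \<bullet> h" for h
  proof -
    have "?D h = ?D (\<Sum>b\<in>Basis. (h \<bullet> b) *\<^sub>R b)"
      by (simp add: euclidean_representation)
    also have "\<dots> = (\<Sum>b\<in>Basis. (h \<bullet> b) *\<^sub>R ?D b)"
      by (simp add: linear_sum[OF lin] linear_scale[OF lin])
    finally show ?thesis
      by (simp add: chart_grad_def inner_sum_left inner_sum_right mult.commute inner_commute)
  qed
  moreover have "((\<lambda>x. \<phi> x $ j) has_derivative (\<lambda>h. ?D h $ j)) (at x)"
    by (rule bounded_linear.has_derivative[OF bounded_linear_vec_nth D])
  ultimately show ?thesis by simp
qed

text \<open>Since \<phi> composed with \<psi> is the identity, the derivative of \<psi> is a right
  inverse of the derivative of \<phi>; a derivative with right inverse has no vanishing row, as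
  applying it to the preimage of \<open>axis j 1\<close> shows.\<close>

lemma chart_grad_nonzero:
  assumes "x \<in> U" shows "chart_grad \<phi> j x \<noteq> 0"
proof
  assume 0: "chart_grad \<phi> j x = 0"
  let ?D = "frechet_derivative \<phi> (at x)" and ?E = "frechet_derivative \<psi> (at (\<phi> x))"
  have D: "(\<phi> has_derivative ?D) (at (\<psi> (\<phi> x)))"
    using chart_basic(3)[OF assms] frechet_derivative_works chart_inv(3)[OF assms] by metis
  have E: "(\<psi> has_derivative ?E) (at (\<phi> x))"
    using chart_basic(4)[OF chart_inv(1)[OF assms]] frechet_derivative_works by blast
  have c: "((\<lambda>y. \<phi> (\<psi> y)) has_derivative (\<lambda>h. ?D (?E h))) (at (\<phi> x))"
    by (rule has_derivative_compose[OF E D])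
  have "((\<lambda>y. y) has_derivative (\<lambda>h. ?D (?E h))) (at (\<phi> x))"
    by (rule has_derivative_transform_within_open[OF c open_ball[of 0 1]])
      (use chart_inv assms in auto)
  then have "(\<lambda>h. ?D (?E h)) = (\<lambda>h. h)"
    using has_derivative_unique has_derivative_ident by blast
  then have "?D (?E (axis j 1)) = axis j 1" by metis
  moreover have "((\<lambda>x. \<phi> x $ j) has_derivative (\<lambda>h. ?D h $ j)) (at x)"
    using D chart_inv(3)[OF assms] by (auto intro: bounded_linear.has_derivative[OF bounded_linear_vec_nth])
  then have "(\<lambda>h. ?D h $ j) = (\<lambda>h. chart_grad \<phi> j x \<bullet> h)"
    using has_derivative_unique chart_derivative[OF assms] by blast
  then have "?D (?E (axis j 1)) $ j = 0" using 0 by (metis inner_zero_left)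
  ultimately show False by simp
qed

lemma chart_partial_continuous:
  assumes "b \<in> Basis" shows "continuous_on U (\<lambda>x. frechet_derivative \<phi> (at x) b)"
  unfolding continuous_on_eq_continuous_at[OF chart_basic(1)]
  using chart_basic(6)[OF _ assms] differentiable_imp_continuous_within by blast

lemma chart_Ck: "Ck_on 1 (\<lambda>x. \<phi> x $ j) U"
proof -
  have "continuous_on U (\<lambda>x. frechet_derivative (\<lambda>x. \<phi> x $ j) (at x) b)" if b: "b \<in> Basis" for b
  proof -
    have "continuous_on U (\<lambda>x. frechet_derivative \<phi> (at x) b $ j)"
      by (intro continuous_on_component chart_partial_continuous b)
    moreover have "frechet_derivative (\<lambda>x. \<phi> x $ j) (at x) b = frechet_derivative \<phi> (at x) b $ j"
      if "x \<in> U" for x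
    proof -
      have "(\<phi> has_derivative frechet_derivative \<phi> (at x)) (at x)"
        using chart_basic(3)[OF that] frechet_derivative_works by blast
      from bounded_linear.has_derivative[OF bounded_linear_vec_nth this]
      show ?thesis using frechet_derivative_at by metis
    qed
    ultimately show ?thesis by (simp cong: continuous_on_cong)
  qed
  moreover have "\<forall>x\<in>U. (\<lambda>x. \<phi> x $ j) differentiable (at x)"
    using chart_derivative differentiable_def by blast
  ultimately show ?thesis by simp
qed

text \<open>The second partials are at most \<open>C\<close>. One factor of the dimension comes from
  passing from partials to the operator norm, the other from summing over the basis. The convex set
  \<open>S\<close> is there for the mean value inequality, as \<open>U\<close> itself may fail to be
  convex.\<close>

lemma chart_grad_lipschitz:
  assumes "convex S" "S \<subseteq> U" "a \<in> S" "b \<in> S"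
  shows "norm (chart_grad \<phi> j a - chart_grad \<phi> j b) \<le> DIM(real^'d) * (C * DIM(real^'d)) * norm (a - b)"
proof -
  have "norm (chart_grad \<phi> j a - chart_grad \<phi> j b)
     = norm (\<Sum>e\<in>Basis. ((frechet_derivative \<phi> (at a) e - frechet_derivative \<phi> (at b) e) $ j) *\<^sub>R e)"
    by (simp add: chart_grad_def sum_subtractf scaleR_diff_left)
  also have "\<dots> \<le> (\<Sum>e\<in>(Basis::(real^'d) set). C * DIM(real^'d) * norm (a - b))"
  proof (rule sum_norm_le)
    fix e :: "real^'d" assume e: "e \<in> Basis"
    have "norm (((frechet_derivative \<phi> (at a) e - frechet_derivative \<phi> (at b) e) $ j) *\<^sub>R e)
      \<le> norm (frechet_derivative \<phi> (at a) e - frechet_derivative \<phi> (at b) e)"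
      using e component_le_norm_cart[of "frechet_derivative \<phi> (at a) e - frechet_derivative \<phi> (at b) e" j]
      by (simp add: norm_Basis)
    also have "\<dots> \<le> C * DIM(real^'d) * norm (a - b)"
      by (rule partials_lipschitz[OF assms(1) _ _ assms(3,4)])
        (use assms(2) chart_basic(6,7) e in blast)+
    finally show "norm (((frechet_derivative \<phi> (at a) e - frechet_derivative \<phi> (at b) e) $ j) *\<^sub>R e)
      \<le> C * DIM(real^'d) * norm (a - b)" .
  qed
  finally show ?thesis by (simp add: mult_ac)
qed

text \<open>The chart speaks of the image of \<open>X\<close>; injectivity of \<phi> on
  \<open>U\<close> pulls this back to a sign condition that describes \<open>X\<close> inside
  \<open>U\<close>.\<close>

lemma chart_X: "X \<inter> U = {y \<in> U. \<phi> y $ j > 0}"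
proof (intro equalityI subsetI)
  fix y assume y: "y \<in> {y \<in> U. \<phi> y $ j > 0}"
  then have "\<phi> y \<in> \<phi> ` (U \<inter> X)" using chart_basic(9) chart_inv by auto
  then obtain y' where "y' \<in> U \<inter> X" "\<phi> y' = \<phi> y" by auto
  then show "y \<in> X \<inter> U" using y chart_inv(3) by (metis (mono_tags, lifting) IntD1 IntD2 IntI mem_Collect_eq)
qed (use chart_basic(9) in auto)

lemma chart_closure:
  assumes "y \<in> closure X" "y \<in> U" shows "\<phi> y $ j \<ge> 0"
proof (rule ccontr)
  assume "\<not> ?thesis"
  then have "\<phi> y $ j < 0" by simp
  define V where "V = U \<inter> (\<lambda>x. \<phi> x $ j) -` {..<0}"
  have "continuous_on U (\<lambda>x. \<phi> x $ j)" using chart_basic(2) by (intro continuous_intros) (auto simp: homeomorphism_def)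
  then have "open V" unfolding V_def by (intro continuous_open_preimage chart_basic(1)) auto
  moreover have "y \<in> V" using \<open>\<phi> y $ j < 0\<close> assms by (simp add: V_def)
  ultimately obtain z where "z \<in> X" "z \<in> V" using assms(1) by (meson closure_iff_nhds_not_empty disjoint_iff subset_refl)
  then show False using chart_X by (force simp: V_def)
qed

lemma chart_frontier:
  assumes "open X" "y \<in> frontier X" "y \<in> U" shows "\<phi> y $ j = 0"
proof -
  have "y \<notin> X" "y \<in> closure X" using assms by (auto simp: frontier_def interior_open)
  then show ?thesis using chart_X chart_closure assms(3) by fastforce
qed

text \<open>Component \<open>j\<close> of \<phi> serves as defining function, with the length of its
  gradient as the factor \<open>c\<close>. This replaces the definite description by an explicit
  expression whose regularity can be read off.\<close>

lemma chart_inward_normal: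
  assumes "open X" "y \<in> frontier X" "y \<in> U"
  shows "inward_normal X y = chart_grad \<phi> j y /\<^sub>R norm (chart_grad \<phi> j y)"
  by (rule inward_normal_eq[OF chart_basic(1) assms(3) chart_Ck chart_X chart_frontier[OF assms],
      of "norm (chart_grad \<phi> j y)"])
    (use chart_grad_nonzero[OF assms(3)] chart_derivative[OF assms(3)] in \<open>auto simp: field_simps\<close>)

lemma chart_grad_continuous: "continuous_on U (chart_grad \<phi> j)"
  unfolding chart_grad_def
  by (intro continuous_on_sum continuous_on_scaleR continuous_on_component continuous_on_const chart_partial_continuous)

text \<open>Shifting \<open>y\<close> slightly along axis \<open>j\<close> puts it into the open
  half ball, which \<psi> maps into \<open>X\<close>; then the shift tends to 0. The half ball is
  convex, so segments in it are mapped by \<psi> to curves along which the field is defined.\<close>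

lemma chart_half_ball:
  assumes "y \<in> ball 0 1" "y $ j \<ge> 0" shows "\<psi> y \<in> closure X"
proof -
  have "((\<lambda>e. \<psi> (y + e *\<^sub>R axis j 1)) \<longlongrightarrow> \<psi> (y + 0 *\<^sub>R axis j 1)) (at_right 0)"
  proof (rule isCont_tendsto_compose[where g = \<psi>])
    show "isCont \<psi> (y + 0 *\<^sub>R axis j 1)"
      using chart_basic(4)[OF assms(1)] differentiable_imp_continuous_within by auto
  qed (intro tendsto_intros)
  moreover have "\<forall>\<^sub>F e in at_right 0. \<psi> (y + e *\<^sub>R axis j 1) \<in> closure X"
  proof -
    have "\<forall>\<^sub>F e in at_right 0. y + e *\<^sub>R axis j 1 \<in> ball 0 1"
    proof (rule topological_tendstoD)
      have "((\<lambda>e. y + e *\<^sub>R axis j 1) \<longlongrightarrow> y + 0 *\<^sub>R axis j 1) (at_right 0)"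
        by (intro tendsto_intros)
      then show "((\<lambda>e. y + e *\<^sub>R axis j 1) \<longlongrightarrow> y) (at_right 0)" by simp
    qed (use assms in auto)
    moreover have "\<forall>\<^sub>F e::real in at_right 0. e > 0" by (simp add: eventually_at_right_less)
    ultimately show ?thesis
    proof eventually_elim
      case (elim e)
      then have "y + e *\<^sub>R axis j 1 \<in> \<phi> ` (U \<inter> X)" unfolding chart_basic(9) using assms by simp
      then obtain z where z: "z \<in> U" "z \<in> X" "y + e *\<^sub>R axis j 1 = \<phi> z" by auto
      then show ?case using chart_inv(3) closure_subset by auto
    qed
  qed
  ultimately show ?thesis
    using Lim_in_closed_set[OF closed_closure _ trivial_limit_at_right_real] by auto
qed

end

section \<open>Regularity of the normal, exterior balls and local Lipschitz bounds for the
  field\<close>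

lemma inward_normal_norm:
  assumes "open X" "uniformly_regular 4 X" "y \<in> frontier X"
  shows "norm (inward_normal X y) = 1"
proof -
  obtain U \<phi> \<psi> j C where ch: "boundary_chart X U \<phi> \<psi> j C" "y \<in> U"
    using uniformly_regular_chart[OF assms(2,3)] by blast
  show ?thesis using chart_inward_normal[OF ch(1) assms(1,3) ch(2)] chart_grad_nonzero[OF ch] by simp
qed

text \<open>Near each boundary point the normal is the normalized gradient of one fixed chart.
  Continuity is what makes the boundary integrands Borel measurable.\<close>

lemma inward_normal_continuous:
  assumes "open X" "uniformly_regular 4 X"
  shows "continuous_on (frontier X) (inward_normal X)"
  unfolding continuous_on_eq_continuous_within
proof
  fix p assume p: "p \<in> frontier X"
  obtain U \<phi> \<psi> j C where ch: "boundary_chart X U \<phi> \<psi> j C" "p \<in> U"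
    using uniformly_regular_chart[OF assms(2) p] by blast
  have "isCont (chart_grad \<phi> j) p"
    using chart_grad_continuous[OF ch(1)] chart_basic(1)[OF ch(1)] ch(2)
    by (simp add: continuous_on_eq_continuous_at)
  then have G: "continuous (at p within frontier X) (chart_grad \<phi> j)"
    by (rule continuous_at_imp_continuous_at_within)
  have c: "continuous (at p within frontier X) (\<lambda>y. chart_grad \<phi> j y /\<^sub>R norm (chart_grad \<phi> j y))"
    using G chart_grad_nonzero[OF ch]
    by (intro continuous_scaleR continuous_at_within_inverse continuous_norm) auto
  obtain d where d: "d > 0" "ball p d \<subseteq> U" using chart_basic(1)[OF ch(1)] ch(2) openE by blast
  show "continuous (at p within frontier X) (inward_normal X)"
  proof (rule continuous_transform_within[OF c d(1) p])
    fix y assume "y \<in> frontier X" "dist y p < d"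
    then show "chart_grad \<phi> j y /\<^sub>R norm (chart_grad \<phi> j y) = inward_normal X y"
      using chart_inward_normal[OF ch(1) assms(1), of y] d(2) by (auto simp: subset_iff dist_commute)
  qed
qed

text \<open>An exterior ball of radius \<open>1 / (2 * c)\<close> touches the boundary at \<open>a\<close>.\<close>

lemma exterior_ball_local:
  fixes X :: "(real^'d) set"
  assumes X: "open X" "uniformly_regular 4 X" and p: "p \<in> closure X"
  shows "\<exists>\<delta>>0. \<exists>c\<ge>0. \<forall>a\<in>frontier X \<inter> ball p \<delta>. \<forall>b\<in>closure X \<inter> ball p \<delta>.
           inward_normal X a \<bullet> (a - b) \<le> c * (norm (a - b))\<^sup>2"
proof (cases "p \<in> X")
  case True
  then obtain \<delta> where "\<delta> > 0" "ball p \<delta> \<subseteq> X" using openE[OF X(1)] by metis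
  moreover from this have "frontier X \<inter> ball p \<delta> = {}"
    using X by (auto simp: frontier_def interior_open)
  ultimately show ?thesis by (intro exI[of _ \<delta>] conjI exI[of _ 0]) simp_all
next
  case False
  then have p: "p \<in> frontier X" using p X by (simp add: frontier_def interior_open)
  obtain U \<phi> \<psi> j C where ch: "boundary_chart X U \<phi> \<psi> j C" "p \<in> U"
    using uniformly_regular_chart[OF X(2) p] by blast
  let ?G = "chart_grad \<phi> j"
  \<comment> \<open>Half of the gradient length at \<open>p\<close>: by continuity the gradient
    stays longer than \<open>g\<close> on a small ball, so normalizing it costs at most a factor
    \<open>1 / g\<close>.\<close>
  define g where "g = norm (?G p) / 2"
  have g: "g > 0" using chart_grad_nonzero[OF ch] by (simp add: g_def)
  have "isCont ?G p" using chart_grad_continuous[OF ch(1)] chart_basic(1)[OF ch(1)] ch(2)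
    by (simp add: continuous_on_eq_continuous_at)
  then have "\<forall>\<^sub>F a in nhds p. norm (?G a) > g"
    using g by (intro order_tendstoD(1)[OF tendsto_norm[of ?G "?G p" "nhds p"]]) (auto simp: g_def isCont_def tendsto_at_iff_tendsto_nhds)
  moreover have "\<forall>\<^sub>F a in nhds p. a \<in> U" using chart_basic(1)[OF ch(1)] ch(2) by (simp add: eventually_nhds_in_open)
  ultimately have "\<forall>\<^sub>F a in nhds p. norm (?G a) > g \<and> a \<in> U" by eventually_elim simp
  then obtain \<delta> where \<delta>: "\<delta> > 0" "\<And>a. a \<in> ball p \<delta> \<Longrightarrow> norm (?G a) > g" "ball p \<delta> \<subseteq> U"
    unfolding eventually_nhds_metric by (metis dist_commute mem_ball subsetI)
  define K where "K = DIM(real^'d) * (C * DIM(real^'d))"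
  have lip: "norm (?G a - ?G b) \<le> K * norm (a - b)" if "a \<in> ball p \<delta>" "b \<in> ball p \<delta>" for a b
    unfolding K_def by (rule chart_grad_lipschitz[OF ch(1) convex_ball \<delta>(3) that])
  have "norm (frechet_derivative \<phi> (at p) (axis j 1)) \<le> C"
    by (rule chart_basic(5)[OF ch]) (auto simp: axis_in_Basis_iff)
  then have "C \<ge> 0" using norm_ge_zero[of "frechet_derivative \<phi> (at p) (axis j 1)"] by linarith
  then have K: "K \<ge> 0" by (simp add: K_def)
  show ?thesis
  proof (rule exI[of _ \<delta>], intro conjI exI[of _ "K / g"] ballI)
    fix a b assume a: "a \<in> frontier X \<inter> ball p \<delta>" and b: "b \<in> closure X \<inter> ball p \<delta>"
    have aU: "a \<in> U" and bU: "b \<in> U" using a b \<delta>(3) by auto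
    have seg: "closed_segment a b \<subseteq> ball p \<delta>" using a b closed_segment_subset[OF _ _ convex_ball] by blast
    \<comment> \<open>Component \<open>j\<close> of \<phi> vanishes at \<open>a\<close> and is
      nonnegative at \<open>b\<close>, so the gradient at some point of the segment has a
      nonnegative product with \<open>b - a\<close>. Replacing it by the gradient at
      \<open>a\<close> costs a quadratic error. The segment may leave the closure of
      \<open>X\<close> but stays in the ball inside \<open>U\<close>.\<close>
    have "\<exists>t\<in>{0..1}. (\<phi> (a + 1 *\<^sub>R (b - a)) $ j) - (\<phi> (a + 0 *\<^sub>R (b - a)) $ j)
        = (\<lambda>h. ?G (a + t *\<^sub>R (b - a)) \<bullet> (h *\<^sub>R (b - a))) (1 - 0)"
    proof (rule mvt_very_simple[of 0 1 "\<lambda>t. \<phi> (a + t *\<^sub>R (b - a)) $ j"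
          "\<lambda>t h. ?G (a + t *\<^sub>R (b - a)) \<bullet> (h *\<^sub>R (b - a))"])
      fix t :: real assume t: "0 \<le> t" "t \<le> 1"
      have "a + t *\<^sub>R (b - a) = (1 - t) *\<^sub>R a + t *\<^sub>R b" by (simp add: algebra_simps)
      then have "a + t *\<^sub>R (b - a) \<in> closed_segment a b" using t unfolding in_segment by blast
      then have D: "((\<lambda>x. \<phi> x $ j) has_derivative (\<lambda>h. ?G (a + t *\<^sub>R (b - a)) \<bullet> h)) (at (a + t *\<^sub>R (b - a)))"
        using seg \<delta>(3) by (intro chart_derivative[OF ch(1)]) auto
      have D': "((\<lambda>t. a + t *\<^sub>R (b - a)) has_derivative (\<lambda>h. h *\<^sub>R (b - a))) (at t within {0..1})"
        by (auto intro!: derivative_eq_intros)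
      show "((\<lambda>t. \<phi> (a + t *\<^sub>R (b - a)) $ j) has_derivative
          (\<lambda>h. ?G (a + t *\<^sub>R (b - a)) \<bullet> (h *\<^sub>R (b - a)))) (at t within {0..1})"
        by (rule has_derivative_compose[OF D' D])
    qed auto
    then obtain t where t: "0 \<le> t" "t \<le> 1"
      "\<phi> b $ j - \<phi> a $ j = ?G (a + t *\<^sub>R (b - a)) \<bullet> (b - a)" by auto
    let ?\<xi> = "a + t *\<^sub>R (b - a)"
    have "?\<xi> = (1 - t) *\<^sub>R a + t *\<^sub>R b" by (simp add: algebra_simps)
    then have "?\<xi> \<in> closed_segment a b" using t unfolding in_segment by blast
    then have \<xi>: "?\<xi> \<in> ball p \<delta>" using seg by blast
    have "\<phi> a $ j = 0" using chart_frontier[OF ch(1) X(1) _ aU] a by simp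
    moreover have "\<phi> b $ j \<ge> 0" using chart_closure[OF ch(1) _ bU] b by simp
    ultimately have "0 \<le> ?G ?\<xi> \<bullet> (b - a)" using t by simp
    then have "?G a \<bullet> (a - b) \<le> (?G ?\<xi> - ?G a) \<bullet> (b - a)" by (simp add: inner_diff)
    also have "\<dots> \<le> norm (?G ?\<xi> - ?G a) * norm (b - a)" by (rule norm_cauchy_schwarz)
    also have "\<dots> \<le> (K * norm (?\<xi> - a)) * norm (b - a)"
      using lip[OF \<xi>, of a] a by (intro mult_right_mono) auto
    also have "\<dots> \<le> (K * norm (b - a)) * norm (b - a)"
    proof -
      have "norm (?\<xi> - a) \<le> norm (b - a)" using t by (simp add: mult_left_le_one_le)
      then show ?thesis using K by (intro mult_right_mono mult_left_mono) simp_all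
    qed
    finally have *: "?G a \<bullet> (a - b) \<le> K * (norm (a - b))\<^sup>2"
      by (simp add: power2_eq_square norm_minus_commute)
    have ga: "norm (?G a) > g" using \<delta>(2) a by blast
    then have ga0: "norm (?G a) > 0" using g by linarith
    have "inward_normal X a \<bullet> (a - b) = (?G a \<bullet> (a - b)) / norm (?G a)"
      using chart_inward_normal[OF ch(1) X(1) _ aU] a by (simp add: divide_inverse mult.commute)
    also have "\<dots> \<le> K * (norm (a - b))\<^sup>2 / norm (?G a)"
      using * by (intro divide_right_mono) simp_all
    also have "\<dots> \<le> K * (norm (a - b))\<^sup>2 / g"
      by (rule divide_left_mono[OF _ _ mult_pos_pos[OF ga0 g]]) (use ga g K in simp_all)
    finally show "inward_normal X a \<bullet> (a - b) \<le> K / g * (norm (a - b))\<^sup>2" by simp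
  qed (use \<delta> K g in auto)
qed

text \<open>The field is differentiable only within the closure of \<open>X\<close>, where the
  segment between two points may be missing. Near a boundary point the points are therefore joined
  by a segment in the half ball of a chart, and the mean value inequality is applied to the field
  composed with \<psi>.\<close>

lemma C1_field_lipschitz_local:
  fixes X :: "(real^'d) set"
  assumes X: "open X" "uniformly_regular 4 X" and v: "C1_field X v"
    and \<tau>: "\<tau> \<ge> 0" and p: "p \<in> closure X"
  shows "\<exists>\<delta>>0. \<exists>K\<ge>0. \<forall>t\<ge>0. \<bar>t - \<tau>\<bar> < \<delta> \<longrightarrow>
    (\<forall>a\<in>closure X \<inter> ball p \<delta>. \<forall>b\<in>closure X \<inter> ball p \<delta>. norm (v t a - v t b) \<le> K * norm (a - b))"
proof -
  obtain v' where v': "\<And>q. q \<in> {0..} \<times> closure X \<Longrightarrow>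
      ((\<lambda>(t, x). v t x) has_derivative blinfun_apply (v' q)) (at q within {0..} \<times> closure X)"
    and cont: "continuous_on ({0..} \<times> closure X) v'"
    using v unfolding C1_field_def by blast
  \<comment> \<open>The added 1 is the amount by which the derivative may vary near (\<tau>,
    \<open>p\<close>).\<close>
  define B where "B = norm (v' (\<tau>, p)) + 1"
  have \<tau>p: "(\<tau>, p) \<in> {0..} \<times> closure X" using \<tau> p by simp
  obtain d where d: "d > 0"
    "\<And>q. q \<in> {0..} \<times> closure X \<Longrightarrow> dist q (\<tau>, p) < d \<Longrightarrow> dist (v' q) (v' (\<tau>, p)) < 1"
    using cont[unfolded continuous_on_iff, rule_format, OF \<tau>p, of 1] by auto
  \<comment> \<open>Half of \<open>d\<close>, because the distance in the product is estimated by
    the sum of the distances in time and in space.\<close>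
  define e where "e = d / 2"
  have e: "e > 0" using d by (simp add: e_def)
  have B: "norm (v' (t, x)) \<le> B" if "t \<ge> 0" "\<bar>t - \<tau>\<bar> < e" "x \<in> closure X" "x \<in> ball p e" for t x
  proof -
    have "dist (t, x) (\<tau>, p) \<le> dist t \<tau> + dist x p"
      unfolding dist_Pair_Pair by (rule sqrt_sum_squares_le_sum) auto
    also have "\<dots> < d" using that by (simp add: e_def dist_real_def dist_commute)
    finally have "dist (v' (t, x)) (v' (\<tau>, p)) < 1" using that d(2)[of "(t, x)"] by simp
    then show ?thesis unfolding B_def dist_norm using norm_triangle_ineq2[of "v' (t, x)" "v' (\<tau>, p)"] by linarith
  qed
  have B0: "B \<ge> 0" by (simp add: B_def)
  \<comment> \<open>One estimate for both cases: at an interior point \<psi> will be the identity on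
    a ball, at a boundary point the inverse chart on a half ball.\<close>
  have comp: "norm (v t (\<psi> \<alpha>) - v t (\<psi> \<beta>)) \<le> (B * L) * norm (\<alpha> - \<beta>)"
    if t: "t \<ge> 0" "\<bar>t - \<tau>\<bar> < e" and H: "convex H" "\<alpha> \<in> H" "\<beta> \<in> H"
      and \<psi>: "\<And>y. y \<in> H \<Longrightarrow> \<psi> y \<in> closure X \<inter> ball p e"
      and D: "\<And>y. y \<in> H \<Longrightarrow> (\<psi> has_derivative D y) (at y within H)"
      and L: "\<And>y h. y \<in> H \<Longrightarrow> norm (D y h) \<le> L * norm h" and L0: "L \<ge> 0"
    for t H \<alpha> \<beta> L and \<psi> :: "real^'d \<Rightarrow> real^'d" and D
  proof (rule differentiable_bound[OF H(1) _ _ H(2,3), where f = "\<lambda>y. v t (\<psi> y)" and f' = "\<lambda>y h. v' (t, \<psi> y) (0, D y h)"])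
    fix y assume y: "y \<in> H"
    have 1: "((\<lambda>y. (t, \<psi> y)) has_derivative (\<lambda>h. (0, D y h))) (at y within H)"
      by (intro has_derivative_Pair has_derivative_const D y)
    have 2: "((\<lambda>(t, x). v t x) has_derivative blinfun_apply (v' (t, \<psi> y))) (at (t, \<psi> y) within (\<lambda>y. (t, \<psi> y)) ` H)"
      by (rule has_derivative_subset[OF v']) (use t \<psi> y in auto)
    show "((\<lambda>y. v t (\<psi> y)) has_derivative (\<lambda>h. v' (t, \<psi> y) (0, D y h))) (at y within H)"
      using has_derivative_in_compose[OF 1 2] by simp
    show "onorm (\<lambda>h. v' (t, \<psi> y) (0, D y h)) \<le> B * L"
    proof (rule onorm_le)
      fix h
      have "norm (v' (t, \<psi> y) (0, D y h)) \<le> norm (v' (t, \<psi> y)) * norm (0::real, D y h)"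
        by (rule norm_blinfun)
      also have "\<dots> \<le> B * (L * norm h)"
        by (rule mult_mono) (use B[OF t, of "\<psi> y"] \<psi>[OF y] L[OF y] B0 in \<open>auto simp: norm_Pair\<close>)
      finally show "norm (v' (t, \<psi> y) (0, D y h)) \<le> B * L * norm h" by (simp add: mult_ac)
    qed
  qed
  show ?thesis
  proof (cases "p \<in> X")
    case True
    then obtain r where r: "r > 0" "ball p r \<subseteq> X" using openE[OF X(1)] by metis
    define \<delta> where "\<delta> = min r e"
    have \<delta>: "\<delta> > 0" "\<delta> \<le> e" using r e by (auto simp: \<delta>_def)
    have sub: "ball p \<delta> \<subseteq> closure X \<inter> ball p e"
      using r(2) closure_subset[of X] by (auto simp: \<delta>_def)
    have "norm (v t a - v t b) \<le> (B * 1) * norm (a - b)"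
      if "t \<ge> 0" "\<bar>t - \<tau>\<bar> < \<delta>" "a \<in> ball p \<delta>" "b \<in> ball p \<delta>" for t a b
      by (rule comp[where \<psi> = "\<lambda>x. x" and H = "ball p \<delta>" and D = "\<lambda>_ h. h"])
        (use that \<delta> sub in \<open>auto intro: has_derivative_ident\<close>)
    then show ?thesis using \<delta> B0 by (intro exI[of _ \<delta>] conjI exI[of _ "B * 1"]) auto
  next
    case False
    then have pf: "p \<in> frontier X" using p X by (simp add: frontier_def interior_open)
    obtain U \<phi> \<psi> j C where ch: "boundary_chart X U \<phi> \<psi> j C" "p \<in> U"
      using uniformly_regular_chart[OF X(2) pf] by blast
    have "norm (frechet_derivative \<phi> (at p) (axis j 1)) \<le> C"
      by (rule chart_basic(5)[OF ch]) simp
    then have C0: "C \<ge> 0" using norm_ge_zero[of "frechet_derivative \<phi> (at p) (axis j 1)"] by linarith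
    define L where "L = C * DIM(real^'d)"
    have L0: "L \<ge> 0" using C0 by (simp add: L_def)
    have hom: "homeomorphism U (ball 0 1) \<phi> \<psi>" by (rule chart_basic(2)[OF ch(1)])
    have pB: "\<phi> p \<in> ball 0 1" by (rule chart_inv(1)[OF ch])
    have "continuous_on (ball 0 1) \<psi>" using hom by (simp add: homeomorphism_def)
    then have "open (ball 0 1 \<inter> \<psi> -` ball p e)" by (intro continuous_open_preimage open_ball)
    moreover have "\<phi> p \<in> ball 0 1 \<inter> \<psi> -` ball p e" using pB chart_inv(3)[OF ch] e by simp
    ultimately obtain r where r: "r > 0" "ball (\<phi> p) r \<subseteq> ball 0 1 \<inter> \<psi> -` ball p e"
      by (metis openE)
    have "continuous_on U \<phi>" using hom by (simp add: homeomorphism_def)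
    then have "open (U \<inter> \<phi> -` ball (\<phi> p) r)"
      by (intro continuous_open_preimage open_ball chart_basic(1)[OF ch(1)])
    moreover have "p \<in> U \<inter> \<phi> -` ball (\<phi> p) r" using ch(2) r by simp
    ultimately obtain r' where r': "r' > 0" "ball p r' \<subseteq> U \<inter> \<phi> -` ball (\<phi> p) r"
      by (metis openE)
    define \<delta> where "\<delta> = min r' e"
    have \<delta>: "\<delta> > 0" "\<delta> \<le> e" "\<delta> \<le> r'" using r' e by (auto simp: \<delta>_def)
    \<comment> \<open>The flat side passes through the origin and not through the centre of this
      ball; what matters is that the intersection is convex and that \<psi> maps it into the closure
      of \<open>X\<close>.\<close>
    define H where "H = ball (\<phi> p) r \<inter> {y. y $ j \<ge> 0}"
    have "{y::real^'d. y $ j \<ge> 0} = {y. axis j 1 \<bullet> y \<ge> 0}" by (simp add: inner_axis')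
    then have H: "convex H" unfolding H_def by (auto intro!: convex_Int convex_halfspace_ge)
    have HB: "y \<in> ball 0 1" "\<psi> y \<in> ball p e" if "y \<in> H" for y using that r(2) by (auto simp: H_def)
    have "norm (v t a - v t b) \<le> (B * L * L) * norm (a - b)"
      if t: "t \<ge> 0" "\<bar>t - \<tau>\<bar> < \<delta>" and a: "a \<in> closure X \<inter> ball p \<delta>" and b: "b \<in> closure X \<inter> ball p \<delta>"
      for t a b
    proof -
      have ab: "a \<in> ball p r'" "b \<in> ball p r'" using a b \<delta>(3) by auto
      then have U: "a \<in> U" "b \<in> U" "\<phi> a \<in> ball (\<phi> p) r" "\<phi> b \<in> ball (\<phi> p) r" using r'(2) by auto
      have ahb: "\<phi> a \<in> H" "\<phi> b \<in> H" using U chart_closure[OF ch(1)] a b by (auto simp: H_def)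
      have "norm (v t (\<psi> (\<phi> a)) - v t (\<psi> (\<phi> b))) \<le> (B * L) * norm (\<phi> a - \<phi> b)"
      proof (rule comp[where D = "\<lambda>y. frechet_derivative \<psi> (at y)", OF t(1) _ H ahb])
        show "\<bar>t - \<tau>\<bar> < e" using t \<delta> by simp
        show "\<psi> y \<in> closure X \<inter> ball p e" if "y \<in> H" for y
          using chart_half_ball[OF ch(1) HB(1)[OF that]] HB(2)[OF that] that by (simp add: H_def)
        have der: "(\<psi> has_derivative frechet_derivative \<psi> (at y)) (at y)" if "y \<in> H" for y
          using chart_basic(4)[OF ch(1) HB(1)[OF that]] frechet_derivative_works by blast
        then show "(\<psi> has_derivative frechet_derivative \<psi> (at y)) (at y within H)" if "y \<in> H" for y
          using that has_derivative_at_withinI by blast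
        show "norm (frechet_derivative \<psi> (at y) h) \<le> L * norm h" if "y \<in> H" for y h
          unfolding L_def
          by (rule linear_norm_le_Basis[OF has_derivative_linear[OF der[OF that]]])
            (rule chart_basic(8)[OF ch(1) HB(1)[OF that]])
      qed (rule L0)
      also have "\<dots> \<le> (B * L) * (L * norm (a - b))"
      proof (rule mult_left_mono)
        show "norm (\<phi> a - \<phi> b) \<le> L * norm (a - b)"
          unfolding L_def
        proof (rule partials_lipschitz[OF convex_ball _ _ ab])
          fix x assume "x \<in> ball p r'"
          then have x: "x \<in> U" using r'(2) by blast
          show "\<phi> differentiable at x" by (rule chart_basic(3)[OF ch(1) x])
          show "norm (frechet_derivative \<phi> (at x) b) \<le> C" if "b \<in> Basis" for b
            by (rule chart_basic(5)[OF ch(1) x that])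
        qed
      qed (use B0 L0 in simp)
      finally show ?thesis using chart_inv(3)[OF ch(1)] U by (simp add: mult_ac)
    qed
    then show ?thesis using \<delta> B0 L0 by (intro exI[of _ \<delta>] conjI exI[of _ "B * L * L"]) auto
  qed
qed

section \<open>Integration by parts for Stieltjes measures\<close>

text \<open>The square is split along the diagonal, which is a null set because the measures have no atoms.\<close>

lemma integral_inner_by_parts:
  fixes g h :: "real \<Rightarrow> 'a::euclidean_space"
  assumes N: "finite_measure N" "sets N = sets borel" and N': "finite_measure N'" "sets N' = sets borel"
    and atom: "\<And>u. emeasure N {u} = 0"
    and g: "g \<in> borel_measurable borel" "\<And>u. norm (g u) \<le> B"
    and h: "h \<in> borel_measurable borel" "\<And>u. norm (h u) \<le> B'"
  shows "(\<integral>u. g u \<partial>N) \<bullet> (\<integral>u. h u \<partial>N') =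
    (\<integral>u. g u \<bullet> (\<integral>r. indicator {..u} r *\<^sub>R h r \<partial>N') \<partial>N) +
    (\<integral>u. h u \<bullet> (\<integral>r. indicator {..u} r *\<^sub>R g r \<partial>N) \<partial>N')"
proof -
  interpret N: finite_measure N by fact
  interpret N': finite_measure N' by fact
  interpret P: pair_sigma_finite N N' ..
  interpret P: finite_measure "N \<Otimes>\<^sub>M N'" by (rule finite_measure_pair_measure) fact+
  have [measurable_cong]: "sets N = sets borel" "sets N' = sets borel" by fact+
  note [measurable] = g(1) h(1)
  have B: "0 \<le> B" "0 \<le> B'" using g(2)[of 0] h(2)[of 0] norm_ge_zero order_trans by metis+
  have ih: "integrable N' (\<lambda>r. indicator A r *\<^sub>R h r)" if "A \<in> sets borel" for A
    by (rule N'.integrable_const_bound[of _ B'])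
      (use h that B in \<open>auto simp: indicator_def\<close>)
  have ig: "integrable N (\<lambda>r. indicator A r *\<^sub>R g r)" if "A \<in> sets borel" for A
    by (rule N.integrable_const_bound[of _ B])
      (use g that B in \<open>auto simp: indicator_def\<close>)
  have gh: "norm (g u \<bullet> h r) \<le> B * B'" for u r
  proof -
    have "norm (g u \<bullet> h r) \<le> norm (g u) * norm (h r)" by (simp add: Cauchy_Schwarz_ineq2)
    also have "\<dots> \<le> B * B'" by (rule mult_mono) (use g h B in auto)
    finally show ?thesis .
  qed
  define F where "F = (\<lambda>(u, r). g u \<bullet> h r)"
  \<comment> \<open>The diagonal belongs to \<open>F1\<close>. The other half thus comes out with a
    strict inequality, and passing to the closed half-line uses that \<open>N\<close> has no
    atoms.\<close>
  define F1 where "F1 = (\<lambda>(u, r). indicator {..u} r * (g u \<bullet> h r))"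
  define F2 where "F2 = (\<lambda>(u, r). indicator {..<r} u * (g u \<bullet> h r))"
  have ind: "indicator {..u} r = (if r \<le> u then 1 else (0::real))" "indicator {..<r} u = (if u < r then 1 else (0::real))" for u r :: real
    by (auto simp: indicator_def)
  have m1: "F1 \<in> borel_measurable (N \<Otimes>\<^sub>M N')" "F2 \<in> borel_measurable (N \<Otimes>\<^sub>M N')"
    unfolding F1_def F2_def ind by measurable
  have i1: "integrable (N \<Otimes>\<^sub>M N') F1" "integrable (N \<Otimes>\<^sub>M N') F2"
    by (rule P.integrable_const_bound[of _ "B * B'"], use gh B m1 in
      \<open>auto simp: F1_def F2_def indicator_def\<close>)+
  have "(\<integral>u. g u \<partial>N) \<bullet> (\<integral>u. h u \<partial>N') = (\<integral>u. \<integral>r. g u \<bullet> h r \<partial>N' \<partial>N)"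
    using ig[of UNIV] ih[of UNIV] by simp
  also have "\<dots> = (\<integral>u. \<integral>r. F1 (u, r) + F2 (u, r) \<partial>N' \<partial>N)"
    by (auto simp: F1_def F2_def indicator_def intro!: Bochner_Integration.integral_cong)
  also have "\<dots> = (\<integral>p. F1 p + F2 p \<partial>(N \<Otimes>\<^sub>M N'))"
    using P.integral_fst'[of "\<lambda>p. F1 p + F2 p"] i1 by simp
  also have "\<dots> = (\<integral>p. F1 p \<partial>(N \<Otimes>\<^sub>M N')) + (\<integral>p. F2 p \<partial>(N \<Otimes>\<^sub>M N'))"
    using i1 by simp
  also have "(\<integral>p. F1 p \<partial>(N \<Otimes>\<^sub>M N')) = (\<integral>u. \<integral>r. F1 (u, r) \<partial>N' \<partial>N)"
    using P.integral_fst'[OF i1(1)] by simp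
  also have "\<dots> = (\<integral>u. g u \<bullet> (\<integral>r. indicator {..u} r *\<^sub>R h r \<partial>N') \<partial>N)"
    by (rule Bochner_Integration.integral_cong[OF refl])
      (simp add: F1_def ih flip: integral_inner_right)
  also have "(\<integral>p. F2 p \<partial>(N \<Otimes>\<^sub>M N')) = (\<integral>r. \<integral>u. F2 (u, r) \<partial>N \<partial>N')"
    using P.integral_snd[of "\<lambda>u r. F2 (u, r)"] i1(2) by simp
  also have "\<dots> = (\<integral>u. h u \<bullet> (\<integral>r. indicator {..u} r *\<^sub>R g r \<partial>N) \<partial>N')"
  proof (rule Bochner_Integration.integral_cong[OF refl])
    fix r
    have "(\<integral>u. F2 (u, r) \<partial>N) = (\<integral>u. h r \<bullet> (indicator {..<r} u *\<^sub>R g u) \<partial>N)"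
      by (simp add: F2_def inner_commute)
    also have "\<dots> = (\<integral>u. h r \<bullet> (indicator {..r} u *\<^sub>R g u) \<partial>N)"
    proof (rule integral_cong_AE)
      have "{r} \<in> null_sets N" using atom by (auto intro!: null_setsI simp: N(2))
      then have "AE u in N. u \<noteq> r" using AE_not_in by fastforce
      then show "AE u in N. h r \<bullet> (indicator {..<r} u *\<^sub>R g u) = h r \<bullet> (indicator {..r} u *\<^sub>R g u)"
        by eventually_elim (auto simp: indicator_def)
    qed measurable
    also have "\<dots> = h r \<bullet> (\<integral>u. indicator {..r} u *\<^sub>R g u \<partial>N)"
      by (simp add: ig flip: integral_inner_right)
    finally show "(\<integral>u. F2 (u, r) \<partial>N) = h r \<bullet> (\<integral>u. indicator {..r} u *\<^sub>R g u \<partial>N)" .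
  qed
  finally show ?thesis .
qed

text \<open>The integrated form of the chain rule for the squared norm of \<open>Z\<close>, with one
  driving measure for each \<open>k\<close>. Expanding the square gives all pairs of indices;
  integration by parts splits each pair into two terms that agree after exchanging the indices,
  hence the factor 2.\<close>

lemma norm_sum_integral_squared:
  fixes g :: "'k \<Rightarrow> real \<Rightarrow> 'a::euclidean_space"
  assumes K: "finite K"
    and N: "\<And>k. k \<in> K \<Longrightarrow> finite_measure (N k)" "\<And>k. k \<in> K \<Longrightarrow> sets (N k) = sets borel"
    and atom: "\<And>k u. k \<in> K \<Longrightarrow> emeasure (N k) {u} = 0"
    and g: "\<And>k. k \<in> K \<Longrightarrow> g k \<in> borel_measurable borel" "\<And>k u. k \<in> K \<Longrightarrow> norm (g k u) \<le> B"
  defines "Z \<equiv> \<lambda>u. \<Sum>k\<in>K. \<integral>r. indicator {..u} r *\<^sub>R g k r \<partial>N k"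
  shows "(norm (\<Sum>k\<in>K. \<integral>u. g k u \<partial>N k))\<^sup>2 = 2 * (\<Sum>k\<in>K. \<integral>u. g k u \<bullet> Z u \<partial>N k)"
proof -
  define H where "H k u = (\<integral>r. indicator {..u} r *\<^sub>R g k r \<partial>N k)" for k u
  have Hb: "norm (H k u) \<le> B * measure (N k) UNIV" and Hm: "H k \<in> borel_measurable borel" if k: "k \<in> K" for k u
  proof -
    interpret finite_measure "N k" by (rule N(1)[OF k])
    note [measurable] = g(1)[OF k]
    have [measurable_cong]: "sets (N k) = sets borel" by (rule N(2)[OF k])
    have sp: "space (N k) = UNIV" using N(2)[OF k] sets_eq_imp_space_eq by force
    have B0: "B \<ge> 0" using g(2)[OF k, of 0] norm_ge_zero order_trans by metis
    have "norm (H k u) \<le> (\<integral>r. norm (indicator {..u} r *\<^sub>R g k r) \<partial>N k)"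
      unfolding H_def by (rule integral_norm_bound)
    also have "\<dots> \<le> (\<integral>r. B \<partial>N k)"
      by (rule integral_mono_AE')
        (use g(2)[OF k] B0 in \<open>auto simp: indicator_def\<close>)
    finally show "norm (H k u) \<le> B * measure (N k) UNIV" by (simp add: sp mult.commute)
    have "indicator {..u} r = (if r \<le> u then 1 else (0::real))" for u r :: real by (simp add: indicator_def)
    then have "(\<lambda>(u, r). indicator {..u} r *\<^sub>R g k r) \<in> borel_measurable (borel \<Otimes>\<^sub>M N k)"
      by simp measurable
    then show "H k \<in> borel_measurable borel"
      unfolding H_def by (rule borel_measurable_lebesgue_integral)
  qed
  have int: "integrable (N k) (\<lambda>u. g k u \<bullet> H l u)" if k: "k \<in> K" and l: "l \<in> K" for k l
  proof -
    interpret finite_measure "N k" by (rule N(1)[OF k])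
    note [measurable] = g(1)[OF k] Hm[OF l]
    have [measurable_cong]: "sets (N k) = sets borel" by (rule N(2)[OF k])
    show ?thesis
    proof (rule integrable_const_bound)
      show "AE u in N k. norm (g k u \<bullet> H l u) \<le> B * (B * measure (N l) UNIV)"
      proof (rule AE_I2)
        fix u
        have "norm (g k u \<bullet> H l u) \<le> norm (g k u) * norm (H l u)" by (simp add: Cauchy_Schwarz_ineq2)
        also have "\<dots> \<le> B * (B * measure (N l) UNIV)"
          by (rule mult_mono) (use g(2)[OF k] Hb[OF l] order_trans[OF norm_ge_zero g(2)[OF k, of 0]] in auto)
        finally show "norm (g k u \<bullet> H l u) \<le> B * (B * measure (N l) UNIV)" .
      qed
    qed measurable
  qed
  have "(norm (\<Sum>k\<in>K. \<integral>u. g k u \<partial>N k))\<^sup>2 = (\<Sum>k\<in>K. \<Sum>l\<in>K. (\<integral>u. g k u \<partial>N k) \<bullet> (\<integral>u. g l u \<partial>N l))"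
    by (simp add: power2_norm_eq_inner inner_sum_left inner_sum_right) (rule sum.swap)
  also have "\<dots> = (\<Sum>k\<in>K. \<Sum>l\<in>K. (\<integral>u. g k u \<bullet> H l u \<partial>N k) + (\<integral>u. g l u \<bullet> H k u \<partial>N l))"
    unfolding H_def
  proof (intro sum.cong refl)
    fix k l assume k: "k \<in> K" and l: "l \<in> K"
    show "(\<integral>u. g k u \<partial>N k) \<bullet> (\<integral>u. g l u \<partial>N l) =
      (\<integral>u. g k u \<bullet> (\<integral>r. indicator {..u} r *\<^sub>R g l r \<partial>N l) \<partial>N k) +
      (\<integral>u. g l u \<bullet> (\<integral>r. indicator {..u} r *\<^sub>R g k r \<partial>N k) \<partial>N l)"
      by (rule integral_inner_by_parts[OF N(1)[OF k] N(2)[OF k] N(1)[OF l] N(2)[OF l] atom[OF k]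
        g(1)[OF k] g(2)[OF k] g(1)[OF l] g(2)[OF l]])
  qed
  also have "\<dots> = (\<Sum>k\<in>K. \<Sum>l\<in>K. \<integral>u. g k u \<bullet> H l u \<partial>N k) + (\<Sum>l\<in>K. \<Sum>k\<in>K. \<integral>u. g l u \<bullet> H k u \<partial>N l)"
    by (simp add: sum.distrib) (rule sum.swap)
  also have "\<dots> = 2 * (\<Sum>k\<in>K. \<Sum>l\<in>K. \<integral>u. g k u \<bullet> H l u \<partial>N k)" by simp
  also have "(\<Sum>k\<in>K. \<Sum>l\<in>K. \<integral>u. g k u \<bullet> H l u \<partial>N k) = (\<Sum>k\<in>K. \<integral>u. g k u \<bullet> Z u \<partial>N k)"
    unfolding Z_def H_def[symmetric] inner_sum_right
    by (intro sum.cong refl Bochner_Integration.integral_sum[symmetric] int)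
  finally show ?thesis .
qed

text \<open>A Gronwall argument on an interval so short that the constant becomes smaller than \<open>1\<close>.\<close>

lemma stieltjes_system_zero:
  fixes g :: "'k \<Rightarrow> real \<Rightarrow> 'a::euclidean_space" and Z :: "real \<Rightarrow> 'a"
  assumes K: "finite K" and ab: "\<tau> \<le> b"
    and sets: "\<And>k. k \<in> K \<Longrightarrow> sets (\<mu> k) = sets borel"
    and fin: "\<And>k. k \<in> K \<Longrightarrow> emeasure (\<mu> k) {\<tau><..b} < \<infinity>"
    and atom: "\<And>k u. k \<in> K \<Longrightarrow> emeasure (\<mu> k) {u} = 0"
    and g: "\<And>k. k \<in> K \<Longrightarrow> g k \<in> borel_measurable borel" "\<And>k u. k \<in> K \<Longrightarrow> norm (g k u) \<le> B"
    and Z: "continuous_on {\<tau>..b} Z"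
      "\<And>t. t \<in> {\<tau>..b} \<Longrightarrow> Z t = (\<Sum>k\<in>K. \<integral>u. indicator {\<tau><..t} u *\<^sub>R g k u \<partial>\<mu> k)"
    and c: "c \<ge> 0" "\<And>k u. k \<in> K \<Longrightarrow> u \<in> {\<tau><..b} \<Longrightarrow> g k u \<bullet> Z u \<le> c * (norm (Z u))\<^sup>2"
    and small: "2 * c * (\<Sum>k\<in>K. measure (\<mu> k) {\<tau><..b}) \<le> 1 / 2"
    and t: "t \<in> {\<tau>..b}"
  shows "Z t = 0"
proof -
  have "compact {\<tau>..b}" "{\<tau>..b} \<noteq> {}" using ab by auto
  moreover have "continuous_on {\<tau>..b} (\<lambda>t. (norm (Z t))\<^sup>2)" using Z(1) by (intro continuous_intros)
  \<comment> \<open>The estimate is made at a maximum of the norm of \<open>Z\<close>, so that every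
    earlier value can be replaced by the value there.\<close>
  ultimately obtain m where m: "m \<in> {\<tau>..b}" "\<And>t. t \<in> {\<tau>..b} \<Longrightarrow> (norm (Z t))\<^sup>2 \<le> (norm (Z m))\<^sup>2"
    using continuous_attains_sup by metis
  let ?S = "(norm (Z m))\<^sup>2"
  \<comment> \<open>Restricting to times up to \<open>m\<close> turns the truncated integral at
    \<open>m\<close> into an integral over the whole line, the form in which the square is
    computed.\<close>
  define N where "N k = density (\<mu> k) (indicator {\<tau><..m})" for k
  have sN: "sets (N k) = sets borel" and spN: "space (N k) = UNIV" if "k \<in> K" for k
    using sets[OF that] sets_eq_imp_space_eq[OF sets[OF that]] by (auto simp: N_def)
  have eN: "emeasure (N k) A = emeasure (\<mu> k) ({\<tau><..m} \<inter> A)" if "k \<in> K" "A \<in> sets borel" for k A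
    using that sets[OF that(1)] by (simp add: N_def emeasure_restricted)
  have fN: "finite_measure (N k)" if k: "k \<in> K" for k
  proof
    have "emeasure (N k) UNIV = emeasure (\<mu> k) {\<tau><..m}" using eN[OF k, of UNIV] by simp
    also have "\<dots> \<le> emeasure (\<mu> k) {\<tau><..b}"
      by (rule emeasure_mono) (use m(1) sets[OF k] in auto)
    finally have "emeasure (N k) UNIV \<le> emeasure (\<mu> k) {\<tau><..b}" .
    then show "emeasure (N k) (space (N k)) \<noteq> \<infinity>" using fin[OF k] spN[OF k] by auto
  qed
  have aN: "emeasure (N k) {u} = 0" if k: "k \<in> K" for k u
  proof -
    have "emeasure (N k) {u} \<le> emeasure (\<mu> k) {u}"
      by (subst eN[OF k]) (use sets[OF k] in \<open>simp_all add: emeasure_mono\<close>)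
    then show ?thesis using atom[OF k] by simp
  qed
  have iN: "(\<integral>u. f u \<partial>N k) = (\<integral>u. indicator {\<tau><..m} u *\<^sub>R f u \<partial>\<mu> k)"
    if k: "k \<in> K" and f: "f \<in> borel_measurable borel" for k and f :: "real \<Rightarrow> 'b::euclidean_space"
  proof -
    note [measurable] = f
    have [measurable_cong]: "sets (\<mu> k) = sets borel" by (rule sets[OF k])
    have "N k = density (\<mu> k) (\<lambda>u. ennreal (indicator {\<tau><..m} u))"
      by (simp add: N_def ennreal_indicator)
    then show ?thesis by (simp add: integral_density)
  qed
  have ZN: "(\<Sum>k\<in>K. \<integral>r. indicator {..u} r *\<^sub>R g k r \<partial>N k) = Z u" if u: "u \<in> {\<tau><..m}" for u
  proof -
    have "Z u = (\<Sum>k\<in>K. \<integral>r. indicator {\<tau><..u} r *\<^sub>R g k r \<partial>\<mu> k)" using Z(2)[of u] u m(1) by simp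
    also have "\<dots> = (\<Sum>k\<in>K. \<integral>r. indicator {..u} r *\<^sub>R g k r \<partial>N k)"
    proof (rule sum.cong[OF refl])
      fix k assume k: "k \<in> K"
      note [measurable] = g(1)[OF k]
      have "(\<integral>r. indicator {..u} r *\<^sub>R g k r \<partial>N k) = (\<integral>r. indicator {\<tau><..m} r *\<^sub>R indicator {..u} r *\<^sub>R g k r \<partial>\<mu> k)"
        by (rule iN[OF k]) measurable
      also have "\<dots> = (\<integral>r. indicator {\<tau><..u} r *\<^sub>R g k r \<partial>\<mu> k)"
        using u by (intro Bochner_Integration.integral_cong refl) (auto simp: indicator_def)
      finally show "(\<integral>r. indicator {\<tau><..u} r *\<^sub>R g k r \<partial>\<mu> k) = (\<integral>r. indicator {..u} r *\<^sub>R g k r \<partial>N k)" ..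
    qed
    finally show ?thesis ..
  qed
  \<comment> \<open>It agrees with \<open>Z\<close> on the interval from \<tau> (excluded) to
    \<open>m\<close>, which carries all of \<open>N k\<close>.\<close>
  define Z' where "Z' u = (\<Sum>k\<in>K. \<integral>r. indicator {..u} r *\<^sub>R g k r \<partial>N k)" for u
  have "Z m = (\<Sum>k\<in>K. \<integral>u. g k u \<partial>N k)"
    unfolding Z(2)[OF m(1)] by (rule sum.cong[OF refl]) (simp add: iN g(1))
  \<comment> \<open>From here the maximal squared norm is bounded by the small constant times
    itself, hence by half of itself.\<close>
  then have "?S = 2 * (\<Sum>k\<in>K. \<integral>u. g k u \<bullet> Z' u \<partial>N k)"
    unfolding Z'_def using norm_sum_integral_squared[OF K fN sN aN g] by simp
  also have "\<dots> \<le> 2 * (\<Sum>k\<in>K. c * ?S * measure (\<mu> k) {\<tau><..b})"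
  proof (intro mult_left_mono sum_mono)
    fix k assume k: "k \<in> K"
    interpret finite_measure "N k" by (rule fN[OF k])
    have AE: "AE u in N k. u \<in> {\<tau><..m}"
      unfolding N_def using sets[OF k] by (subst AE_density) (auto simp: indicator_def)
    have "(\<integral>u. g k u \<bullet> Z' u \<partial>N k) \<le> (\<integral>u. c * ?S \<partial>N k)"
    proof (rule integral_mono_AE')
      show "AE u in N k. g k u \<bullet> Z' u \<le> c * ?S"
        using AE
      proof eventually_elim
        case (elim u)
        then have "g k u \<bullet> Z' u \<le> c * (norm (Z u))\<^sup>2" using ZN c(2)[OF k, of u] m(1) by (simp add: Z'_def)
        also have "\<dots> \<le> c * ?S" using elim m c(1) by (intro mult_left_mono m(2)) auto
        finally show ?case .
      qed
    qed (use c(1) in auto)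
    also have "\<dots> = c * ?S * measure (N k) UNIV" by (simp add: spN[OF k])
    also have "\<dots> \<le> c * ?S * measure (\<mu> k) {\<tau><..b}"
    proof (rule mult_left_mono)
      have "measure (N k) UNIV = measure (\<mu> k) {\<tau><..m}"
        using eN[OF k, of UNIV] by (simp add: measure_def)
      also have "\<dots> \<le> measure (\<mu> k) {\<tau><..b}"
        using m(1) fin[OF k] sets[OF k] by (intro measure_mono_fmeasurable) (auto simp: fmeasurable_def)
      finally show "measure (N k) UNIV \<le> measure (\<mu> k) {\<tau><..b}" .
    qed (use c(1) in simp)
    finally show "(\<integral>u. g k u \<bullet> Z' u \<partial>N k) \<le> c * ?S * measure (\<mu> k) {\<tau><..b}" .
  qed simp
  also have "\<dots> = (2 * c * (\<Sum>k\<in>K. measure (\<mu> k) {\<tau><..b})) * ?S"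
    by (simp add: sum_distrib_left sum_distrib_right mult_ac)
  also have "\<dots> \<le> 1 / 2 * ?S" by (rule mult_right_mono[OF small]) simp
  finally have "?S \<le> 0" by simp
  then have "(norm (Z t))\<^sup>2 \<le> 0" using m(2)[OF t] by linarith
  then show ?thesis by simp
qed

section \<open>Pathwise uniqueness for the Skorokhod problem\<close>

lemma interval_measure_properties:
  assumes "mono L" "continuous_on UNIV L"
  shows "a \<le> b \<Longrightarrow> emeasure (interval_measure L) {a<..b} = ennreal (L b - L a)"
    and "emeasure (interval_measure L) {a} = 0"
    and "sets (interval_measure L) = sets borel"
proof -
  have m: "\<And>x y. x \<le> y \<Longrightarrow> L x \<le> L y" using assms(1) by (simp add: monoD)
  have c: "continuous (at_right a) L" for a
    using assms(2) by (auto simp: continuous_on_eq_continuous_within intro: continuous_within_subset)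
  show "a \<le> b \<Longrightarrow> emeasure (interval_measure L) {a<..b} = ennreal (L b - L a)"
    by (rule emeasure_interval_measure_Ioc[OF _ m c])
  show "emeasure (interval_measure L) {a} = 0"
    using emeasure_interval_measure_Icc[OF order_refl[of a] m assms(2)] by simp
  show "sets (interval_measure L) = sets borel" by simp
qed

text \<open>The interval is half-open so that pushes over adjacent intervals add up. The indicator
  extends the integrand by 0 to times at which the path is off the boundary and the normal has no
  meaning.\<close>

definition boundary_push :: "(real^'d) set \<Rightarrow> (real \<Rightarrow> real^'d) \<Rightarrow> real \<Rightarrow> real \<Rightarrow> real \<Rightarrow> real^'d" where
  "boundary_push X x a b u = indicator {r \<in> {a<..b}. x r \<in> frontier X} u *\<^sub>R inward_normal X (x u)"

lemma boundary_push:
  fixes X :: "(real^'d) set"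
  assumes X: "open X" "uniformly_regular 4 X" and x: "continuous_on {s..} x" and s: "s \<le> a"
  shows "boundary_push X x a b \<in> borel_measurable borel" "norm (boundary_push X x a b u) \<le> 1"
proof -
  have "closed {r \<in> {a..b}. x r \<in> frontier X}"
    using continuous_closed_preimage[of "{a..b}" x "frontier X"] x s
      continuous_on_subset[of "{s..}" x "{a..b}"]
    by (auto simp: vimage_def Int_def)
  then have "{r \<in> {a..b}. x r \<in> frontier X} \<inter> {a<..b} \<in> sets borel" by auto
  also have "{r \<in> {a..b}. x r \<in> frontier X} \<inter> {a<..b} = {r \<in> {a<..b}. x r \<in> frontier X}" by auto
  finally have A: "{r \<in> {a<..b}. x r \<in> frontier X} \<in> sets borel" .
  have "continuous_on {r \<in> {a<..b}. x r \<in> frontier X} (\<lambda>u. inward_normal X (x u))"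
    by (rule continuous_on_compose2[OF inward_normal_continuous[OF X]])
      (use s in \<open>auto intro: continuous_on_subset[OF x]\<close>)
  then show "boundary_push X x a b \<in> borel_measurable borel"
    unfolding boundary_push_def using borel_measurable_continuous_on_indicator[OF A] by blast
  show "norm (boundary_push X x a b u) \<le> 1"
    using inward_normal_norm[OF X, of "x u"] by (auto simp: boundary_push_def indicator_def)
qed

text \<open>Exposes the local time that \<open>reflected_path\<close> quantifies away: two solutions
  come with two local times, and both have to be named in the comparison.\<close>

definition reflected_path_via ::
    "(real^'d) set \<Rightarrow> (real \<Rightarrow> real^'d \<Rightarrow> real^'d) \<Rightarrow> real \<Rightarrow> real \<Rightarrow>
     (real \<Rightarrow> real^'d) \<Rightarrow> (real \<Rightarrow> real^'d) \<Rightarrow> (real \<Rightarrow> real) \<Rightarrow> bool" where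
  "reflected_path_via X v \<epsilon> s w x L \<longleftrightarrow>
    continuous_on {s..} x \<and> (\<forall>t\<ge>s. x t \<in> closure X) \<and> mono L \<and> continuous_on UNIV L \<and>
      {r. s \<le> r \<and> x r \<notin> frontier X} \<in> null_sets (interval_measure L) \<and>
      (\<forall>t\<ge>s. x t = x s + integral {s..t} (\<lambda>r. v r (x r)) + \<epsilon> *\<^sub>R (w t - w s) +
        (LINT r : {r\<in>{s..t}. x r \<in> frontier X} | interval_measure L. inward_normal X (x r)))"

lemma reflected_path_iff_via: "reflected_path X v \<epsilon> s w x \<longleftrightarrow> (\<exists>L. reflected_path_via X v \<epsilon> s w x L)"
  unfolding reflected_path_def reflected_path_via_def by blast

lemma C1_field_continuous:
  assumes "C1_field X v" shows "continuous_on ({0..} \<times> closure X) (\<lambda>(t, x). v t x)"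
  using assms unfolding C1_field_def continuous_on_eq_continuous_within
  by (meson has_derivative_continuous)

lemma drift_continuous:
  assumes v: "C1_field X v" and s: "0 \<le> s" and x: "continuous_on {s..} x" "\<forall>t\<ge>s. x t \<in> closure X"
  shows "continuous_on {s..} (\<lambda>r. v r (x r))"
proof -
  have "continuous_on {s..} (\<lambda>r. (\<lambda>(t, x). v t x) (r, x r))"
    by (rule continuous_on_compose2[OF C1_field_continuous[OF v]])
      (use s x in \<open>auto intro!: continuous_intros\<close>)
  then show ?thesis by simp
qed

section \<open>Increments of a reflected path and its restart at a later time\<close>

context
  fixes X :: "(real^'d) set" and v :: "real \<Rightarrow> real^'d \<Rightarrow> real^'d"
  assumes X: "open X" "uniformly_regular 4 X" and v: "C1_field X v"
begin

text \<open>The two domains of integration differ at most in the left end point, which has measure 0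
  because \<open>L\<close> is continuous.\<close>

lemma boundary_push_set_integral:
  assumes x: "continuous_on {s..} x" and L: "mono L" "continuous_on UNIV L" and st: "s \<le> a" "a \<le> b"
  shows "(LINT r : {r\<in>{a..b}. x r \<in> frontier X} | interval_measure L. inward_normal X (x r)) =
    (\<integral>u. boundary_push X x a b u \<partial>interval_measure L)"
  unfolding set_lebesgue_integral_def boundary_push_def
proof (rule integral_cong_AE)
  have *: "{r \<in> {a..b}. x r \<in> frontier X} \<in> sets borel"
  proof -
    have "closed {r \<in> {a..b}. x r \<in> frontier X}"
      using continuous_closed_preimage[of "{a..b}" x "frontier X"] x st
        continuous_on_subset[of "{s..}" x "{a..b}"]
      by (auto simp: vimage_def Int_def)
    then show ?thesis by auto
  qed
  have "continuous_on {r \<in> {a..b}. x r \<in> frontier X} (\<lambda>u. inward_normal X (x u))"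
    by (rule continuous_on_compose2[OF inward_normal_continuous[OF X]])
      (use st in \<open>auto intro: continuous_on_subset[OF x]\<close>)
  then show "(\<lambda>u. indicat_real {r \<in> {a..b}. x r \<in> frontier X} u *\<^sub>R inward_normal X (x u))
      \<in> borel_measurable (interval_measure L)"
    using borel_measurable_continuous_on_indicator[OF *]
      measurable_cong_sets[OF interval_measure_properties(3)[OF L] refl] by blast
  show "(\<lambda>u. indicat_real {r \<in> {a<..b}. x r \<in> frontier X} u *\<^sub>R inward_normal X (x u))
      \<in> borel_measurable (interval_measure L)"
    using boundary_push(1)[OF X x st(1), of b] unfolding boundary_push_def by simp
  have "{a} \<in> null_sets (interval_measure L)"
    using interval_measure_properties(2)[OF L] by (auto intro!: null_setsI)
  then have "AE u in interval_measure L. u \<noteq> a" using AE_not_in by fastforce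
  then show "AE u in interval_measure L. indicat_real {r \<in> {a..b}. x r \<in> frontier X} u *\<^sub>R inward_normal X (x u)
    = indicat_real {r \<in> {a<..b}. x r \<in> frontier X} u *\<^sub>R inward_normal X (x u)"
    by eventually_elim (auto simp: indicator_def)
qed

lemma boundary_push_integrable:
  assumes x: "continuous_on {s..} x" and L: "mono L" "continuous_on UNIV L" and st: "s \<le> a" "a \<le> b"
  shows "integrable (interval_measure L) (boundary_push X x a b)"
proof (rule integrableI_bounded_set[where A = "{a<..b}" and B = 1])
  show "emeasure (interval_measure L) {a<..b} < \<infinity>"
    using interval_measure_properties(1)[OF L st(2)] by simp
  show "AE u in interval_measure L. u \<in> {a<..b} \<longrightarrow> norm (boundary_push X x a b u) \<le> 1"
    using boundary_push(2)[OF X x st(1)] by simp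
qed (use boundary_push(1)[OF X x st(1)] in \<open>auto simp: boundary_push_def\<close>)

lemma boundary_push_split:
  assumes x: "continuous_on {s..} x" and L: "mono L" "continuous_on UNIV L" and st: "s \<le> a" "a \<le> b" "b \<le> c"
  shows "(\<integral>u. boundary_push X x a c u \<partial>interval_measure L) =
    (\<integral>u. boundary_push X x a b u \<partial>interval_measure L) + (\<integral>u. boundary_push X x b c u \<partial>interval_measure L)"
proof -
  have "boundary_push X x a c = (\<lambda>u. boundary_push X x a b u + boundary_push X x b c u)"
    using st by (auto simp: boundary_push_def indicator_def fun_eq_iff)
  then show ?thesis
    using boundary_push_integrable[OF x L] st by simp
qed

lemma reflected_path_increment:
  assumes s: "0 \<le> s" and p: "reflected_path_via X v \<epsilon> s w x L" and st: "s \<le> a" "a \<le> b"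
  shows "x b = x a + integral {a..b} (\<lambda>r. v r (x r)) + \<epsilon> *\<^sub>R (w b - w a) +
     (\<integral>u. boundary_push X x a b u \<partial>interval_measure L)"
proof -
  have x: "continuous_on {s..} x" "\<forall>t\<ge>s. x t \<in> closure X" and L: "mono L" "continuous_on UNIV L"
    and eq: "\<And>t. s \<le> t \<Longrightarrow> x t = x s + integral {s..t} (\<lambda>r. v r (x r)) + \<epsilon> *\<^sub>R (w t - w s) +
        (LINT r : {r\<in>{s..t}. x r \<in> frontier X} | interval_measure L. inward_normal X (x r))"
    using p unfolding reflected_path_via_def by blast+
  have eq': "x t = x s + integral {s..t} (\<lambda>r. v r (x r)) + \<epsilon> *\<^sub>R (w t - w s) +
        (\<integral>u. boundary_push X x s t u \<partial>interval_measure L)" if "s \<le> t" for t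
    by (subst eq[OF that]) (subst boundary_push_set_integral[OF x(1) L order_refl that], rule refl)
  have "(\<lambda>r. v r (x r)) integrable_on {s..b}"
    by (rule integrable_continuous_interval)
      (rule continuous_on_subset[OF drift_continuous[OF v s x]], simp)
  then have i: "integral {s..a} (\<lambda>r. v r (x r)) + integral {a..b} (\<lambda>r. v r (x r)) = integral {s..b} (\<lambda>r. v r (x r))"
    using st by (intro Henstock_Kurzweil_Integration.integral_combine) auto
  have combine: "xb = xa + i + \<epsilon> *\<^sub>R (wb - wa) + q"
    if "xb = xs + i2 + \<epsilon> *\<^sub>R (wb - ws) + q2" "xa = xs + i1 + \<epsilon> *\<^sub>R (wa - ws) + q1" "i1 + i = i2" "q2 = q1 + q"
    for xb xa xs i i1 i2 q q1 q2 wa wb ws :: "real^'d"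
    unfolding that(1,2) that(3)[symmetric] that(4) by (simp add: algebra_simps)
  show ?thesis
    by (rule combine[OF eq' eq' i boundary_push_split[OF x(1) L order_refl st]]) (use st in auto)
qed

text \<open>The same \<open>L\<close> serves from time \<open>a\<close> on. This lets a path that is
  already running be compared with one that starts at \<open>a\<close>.\<close>

lemma reflected_path_restrict:
  assumes s: "0 \<le> s" and p: "reflected_path X v \<epsilon> s w x" and a: "s \<le> a"
  shows "reflected_path X v \<epsilon> a w x"
proof -
  obtain L where L: "reflected_path_via X v \<epsilon> s w x L" using p reflected_path_iff_via by blast
  have x: "continuous_on {s..} x" "\<forall>t\<ge>s. x t \<in> closure X" and mL: "mono L" "continuous_on UNIV L"
    and n: "{r. s \<le> r \<and> x r \<notin> frontier X} \<in> null_sets (interval_measure L)"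
    using L unfolding reflected_path_via_def by blast+
  have xa: "continuous_on {a..} x" using x(1) a continuous_on_subset by (metis atLeast_subset_iff)
  have "{r. a \<le> r \<and> x r \<notin> frontier X} = {r. s \<le> r \<and> x r \<notin> frontier X} \<inter> {a..}" using a by auto
  then have n': "{r. a \<le> r \<and> x r \<notin> frontier X} \<in> null_sets (interval_measure L)"
    using null_set_Int2[OF n, of "{a..}"] by (simp add: Int_commute)
  have "reflected_path_via X v \<epsilon> a w x L"
    unfolding reflected_path_via_def
  proof (intro conjI allI impI)
    fix t assume t: "a \<le> t"
    show "x t \<in> closure X" using x(2) a t by simp
    show "x t = x a + integral {a..t} (\<lambda>r. v r (x r)) + \<epsilon> *\<^sub>R (w t - w a) +
      (LINT r : {r\<in>{a..t}. x r \<in> frontier X} | interval_measure L. inward_normal X (x r))"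
      unfolding boundary_push_set_integral[OF xa mL order_refl t]
      by (rule reflected_path_increment[OF s L a t])
  qed (fact xa mL n')+
  then show ?thesis using reflected_path_iff_via by blast
qed

end

text \<open>Brings the gauge integral of the drift into the form of the boundary terms, so that time
  counts as one more driving measure.\<close>

lemma lborel_integral_Ioc:
  fixes f :: "real \<Rightarrow> 'a::euclidean_space"
  assumes "continuous_on {a..b} f"
  shows "(\<integral>u. indicator {a<..b} u *\<^sub>R f u \<partial>lborel) = integral {a..b} f"
proof -
  have f: "set_integrable lborel {a..b} f" by (rule borel_integrable_atLeastAtMost'[OF assms])
  have "(\<integral>u. indicator {a<..b} u *\<^sub>R f u \<partial>lborel) = (LINT u:{a..b}|lborel. f u)"
    unfolding set_lebesgue_integral_def
  proof (rule integral_cong_AE)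
    show "(\<lambda>u. indicat_real {a..b} u *\<^sub>R f u) \<in> borel_measurable lborel"
      using f unfolding set_integrable_def by (rule borel_measurable_integrable)
    have "(\<lambda>u. indicat_real {a<..b} u *\<^sub>R (indicat_real {a..b} u *\<^sub>R f u)) \<in> borel_measurable lborel"
      by (rule borel_measurable_scaleR[OF _ borel_measurable_integrable[OF f[unfolded set_integrable_def]]]) simp
    also have "(\<lambda>u. indicat_real {a<..b} u *\<^sub>R (indicat_real {a..b} u *\<^sub>R f u)) = (\<lambda>u. indicat_real {a<..b} u *\<^sub>R f u)"
      by (auto simp: indicator_def)
    finally show "(\<lambda>u. indicat_real {a<..b} u *\<^sub>R f u) \<in> borel_measurable lborel" .
    have "AE u in lborel. u \<noteq> a" by (rule AE_lborel_singleton)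
    then show "AE u in lborel. indicat_real {a<..b} u *\<^sub>R f u = indicat_real {a..b} u *\<^sub>R f u"
      by eventually_elim (auto simp: indicator_def)
  qed
  then show ?thesis using set_borel_integral_eq_integral(2)[OF f] by simp
qed

lemma continuous_on_tendsto_at_right:
  fixes f :: "real \<Rightarrow> 'a::topological_space"
  assumes "continuous_on {s..} f" "s \<le> a"
  shows "(f \<longlongrightarrow> f a) (at_right a)"
proof -
  have "(f \<longlongrightarrow> f a) (at a within {s..})" using assms by (simp add: continuous_on_def)
  then show ?thesis by (rule tendsto_within_subset) (use assms in auto)
qed

text \<open>If the paths differ, let \<tau> be the infimum of the times at which they do. The
  difference vanishes at \<tau> and, on a short interval after it, satisfies a Stieltjes system with
  constants taken at the common point; so it vanishes there as well, contradicting the choice of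
  \<tau>.\<close>

lemma reflected_path_unique:
  fixes X :: "(real^'d) set"
  assumes X: "open X" "uniformly_regular 4 X" and v: "C1_field X v" and s: "0 \<le> s"
    and p: "reflected_path X v \<epsilon> s w x" and p': "reflected_path X v \<epsilon> s w x'"
    and init: "x s = x' s" and t: "s \<le> t"
  shows "x t = x' t"
proof (rule ccontr)
  assume neq: "x t \<noteq> x' t"
  obtain L where L: "reflected_path_via X v \<epsilon> s w x L" using p reflected_path_iff_via by blast
  obtain L' where L': "reflected_path_via X v \<epsilon> s w x' L'" using p' reflected_path_iff_via by blast
  have x: "continuous_on {s..} x" "\<forall>t\<ge>s. x t \<in> closure X" and mL: "mono L" "continuous_on UNIV L"
    using L unfolding reflected_path_via_def by blast+
  have x': "continuous_on {s..} x'" "\<forall>t\<ge>s. x' t \<in> closure X" and mL': "mono L'" "continuous_on UNIV L'"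
    using L' unfolding reflected_path_via_def by blast+
  define D where "D = {u. s \<le> u \<and> x u \<noteq> x' u}"
  define \<tau> where "\<tau> = Inf D"
  have D: "t \<in> D" "bdd_below D" using neq t by (auto simp: D_def)
  then have s\<tau>: "s \<le> \<tau>" unfolding \<tau>_def by (intro cInf_greatest) (auto simp: D_def)
  have before: "x u = x' u" if "s \<le> u" "u < \<tau>" for u
    using cInf_lower[OF _ D(2), of u] that by (force simp: D_def \<tau>_def)
  have x\<tau>: "x \<tau> = x' \<tau>"
  proof (cases "\<tau> = s")
    case False
    then have cl: "closure {s..<\<tau>} = {s..\<tau>}" using s\<tau> by (simp add: closure_atLeastLessThan)
    have "x \<tau> - x' \<tau> = 0"
      by (rule continuous_constant_on_closure[of "{s..<\<tau>}" "\<lambda>u. x u - x' u"])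
        (use x(1) x'(1) before s\<tau> in \<open>auto simp: cl intro!: continuous_intros elim: continuous_on_subset\<close>)
    then show ?thesis by simp
  qed (use init in simp)
  define p where "p = x \<tau>"
  have pX: "p \<in> closure X" using x(2) s\<tau> by (simp add: p_def)
  obtain \<delta>1 c1 where c1: "\<delta>1 > 0" "c1 \<ge> 0"
    "\<And>a b. a \<in> frontier X \<inter> ball p \<delta>1 \<Longrightarrow> b \<in> closure X \<inter> ball p \<delta>1 \<Longrightarrow>
       inward_normal X a \<bullet> (a - b) \<le> c1 * (norm (a - b))\<^sup>2"
    using exterior_ball_local[OF X pX] by blast
  have \<tau>0: "0 \<le> \<tau>" using s s\<tau> by simp
  obtain \<delta>2 K where K: "\<delta>2 > 0" "K \<ge> 0"
    "\<And>t a b. 0 \<le> t \<Longrightarrow> \<bar>t - \<tau>\<bar> < \<delta>2 \<Longrightarrow> a \<in> closure X \<inter> ball p \<delta>2 \<Longrightarrow> b \<in> closure X \<inter> ball p \<delta>2 \<Longrightarrow>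
       norm (v t a - v t b) \<le> K * norm (a - b)"
    using C1_field_lipschitz_local[OF X v \<tau>0 pX] by blast
  define \<delta> where "\<delta> = min \<delta>1 \<delta>2"
  have \<delta>: "\<delta> > 0" "\<delta> \<le> \<delta>1" "\<delta> \<le> \<delta>2" using c1 K by (auto simp: \<delta>_def)
  define c where "c = K + c1"
  have c: "c \<ge> 0" "K \<le> c" "c1 \<le> c" using c1 K by (auto simp: c_def)
  \<comment> \<open>The total mass of the three driving measures on the interval from \<tau> to
    \<open>u\<close>. It tends to 0 as \<open>u\<close> decreases to \<tau>, because both local
    times are continuous.\<close>
  define V where "V u = (u - \<tau>) + (L u - L \<tau>) + (L' u - L' \<tau>)" for u
  have "(V \<longlongrightarrow> V \<tau>) (at_right \<tau>)"
    unfolding V_def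
    by (intro tendsto_intros continuous_on_tendsto_at_right[of \<tau>] continuous_on_subset[OF mL(2)]
      continuous_on_subset[OF mL'(2)]) auto
  then have "((\<lambda>u. 2 * c * V u) \<longlongrightarrow> 2 * c * V \<tau>) (at_right \<tau>)" by (intro tendsto_intros)
  then have "((\<lambda>u. 2 * c * V u) \<longlongrightarrow> 0) (at_right \<tau>)" by (simp add: V_def)
  then have e1: "\<forall>\<^sub>F u in at_right \<tau>. 2 * c * V u < 1 / 2" by (rule order_tendstoD) simp
  have e2: "\<forall>\<^sub>F u in at_right \<tau>. x u \<in> ball p \<delta>"
    by (rule topological_tendstoD[OF continuous_on_tendsto_at_right[OF x(1) s\<tau>]])
      (use \<delta>(1) in \<open>auto simp: p_def\<close>)
  have e3: "\<forall>\<^sub>F u in at_right \<tau>. x' u \<in> ball p \<delta>"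
    by (rule topological_tendstoD[OF continuous_on_tendsto_at_right[OF x'(1) s\<tau>]])
      (use \<delta>(1) x\<tau> in \<open>auto simp: p_def\<close>)
  have "\<forall>\<^sub>F u in at_right \<tau>. 2 * c * V u < 1 / 2 \<and> x u \<in> ball p \<delta> \<and> x' u \<in> ball p \<delta>"
    using e1 e2 e3 by eventually_elim simp
  then obtain b0 where b0: "b0 > \<tau>" "\<And>u. \<tau> < u \<Longrightarrow> u < b0 \<Longrightarrow>
      2 * c * V u < 1 / 2 \<and> x u \<in> ball p \<delta> \<and> x' u \<in> ball p \<delta>"
    unfolding eventually_at_right_field by blast
  \<comment> \<open>The midpoint lies strictly beyond \<tau>, strictly before \<open>b0\<close>, and
    closer than \<delta> to \<tau>, as the Lipschitz bound requires of the times.\<close>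
  define b where "b = (\<tau> + min b0 (\<tau> + \<delta>)) / 2"
  have b: "\<tau> < b" "b < b0" "b < \<tau> + \<delta>" using b0(1) \<delta>(1) by (auto simp: b_def min_def field_simps)
  have near: "x u \<in> closure X \<inter> ball p \<delta>1" "x' u \<in> closure X \<inter> ball p \<delta>1"
    "x u \<in> closure X \<inter> ball p \<delta>2" "x' u \<in> closure X \<inter> ball p \<delta>2" "x u \<in> ball p \<delta>" "x' u \<in> ball p \<delta>" if "u \<in> {\<tau><..b}" for u
    using b0(2)[of u] that b \<delta> x(2) x'(2) s\<tau> by auto
  \<comment> \<open>Index 0 is time with the difference of the drifts, 1 and 2 are the two local
    times with their normals, the last one with a minus sign because its path is subtracted.\<close>
  define \<mu> where "\<mu> k = (if k = 0 then lborel else if k = 1 then interval_measure L else interval_measure L')" for k :: nat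
  define g where "g k = (if k = 0 then (\<lambda>u. indicator {\<tau><..b} u *\<^sub>R (v u (x u) - v u (x' u)))
     else if k = 1 then boundary_push X x \<tau> b else (\<lambda>u. - boundary_push X x' \<tau> b u))" for k :: nat
  let ?Z = "\<lambda>u. x u - x' u"
  have sub: "continuous_on {\<tau>..r} h" if "continuous_on {s..} h" for r and h :: "real \<Rightarrow> real^'d"
    using continuous_on_subset[OF that] s\<tau> by auto
  note dc = drift_continuous[OF v s x] drift_continuous[OF v s x']
  have Lip: "norm (v u (x u) - v u (x' u)) \<le> K * norm (?Z u)" if "u \<in> {\<tau><..b}" for u
    by (rule K(3)) (use that near[OF that] \<tau>0 b \<delta> in auto)
  \<comment> \<open>The bound on the integrands has 1 for the unit normals and
    \<open>K * (2 * \<delta>)\<close> for the drifts, since both paths stay in a ball of radius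
    \<delta>.\<close>
  have zero: "?Z u = 0" if u: "u \<in> {\<tau>..b}" for u
  proof (rule stieltjes_system_zero[where K = "{0, 1, 2}" and \<mu> = \<mu> and g = g and c = c
        and B = "max 1 (K * (2 * \<delta>))", OF _ _ _ _ _ _ _ _ _ c(1) _ _ u])
    fix k :: nat assume k: "k \<in> {0, 1, 2}"
    show "sets (\<mu> k) = sets borel" by (simp add: \<mu>_def)
    show "emeasure (\<mu> k) {\<tau><..b} < \<infinity>"
      using b interval_measure_properties(1)[OF mL, of \<tau> b] interval_measure_properties(1)[OF mL', of \<tau> b]
      by (simp add: \<mu>_def)
    show "emeasure (\<mu> k) {u} = 0" for u
      using interval_measure_properties(2)[OF mL] interval_measure_properties(2)[OF mL']
      by (simp add: \<mu>_def)
    have "(\<lambda>u. indicator {\<tau><..b} u *\<^sub>R (v u (x u) - v u (x' u))) \<in> borel_measurable borel"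
      by (rule borel_measurable_continuous_on_indicator)
        (use dc s\<tau> in \<open>auto intro!: continuous_intros elim: continuous_on_subset\<close>)
    then show "g k \<in> borel_measurable borel"
      using boundary_push(1)[OF X x(1) s\<tau>] boundary_push(1)[OF X x'(1) s\<tau>] by (simp add: g_def)
    show "norm (g k u) \<le> max 1 (K * (2 * \<delta>))" for u
    proof -
      have "norm (indicator {\<tau><..b} u *\<^sub>R (v u (x u) - v u (x' u))) \<le> max 1 (K * (2 * \<delta>))"
      proof (cases "u \<in> {\<tau><..b}")
        case True
        have "norm (?Z u) = dist (x u) (x' u)" by (simp add: dist_norm)
        also have "\<dots> \<le> dist p (x u) + dist p (x' u)" by (metis dist_commute dist_triangle)
        also have "\<dots> \<le> 2 * \<delta>" using near(5,6)[OF True] by auto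
        finally have "norm (v u (x u) - v u (x' u)) \<le> K * (2 * \<delta>)"
          using Lip[OF True] mult_left_mono[OF _ K(2)] order_trans by blast
        then show ?thesis using True by simp
      qed simp
      then show ?thesis
        using boundary_push(2)[OF X x(1) s\<tau>, of b u] boundary_push(2)[OF X x'(1) s\<tau>, of b u]
        by (auto simp: g_def)
    qed
    show "g k u \<bullet> ?Z u \<le> c * (norm (?Z u))\<^sup>2" if u: "u \<in> {\<tau><..b}" for u
    proof -
      have "g 0 u \<bullet> ?Z u \<le> norm (g 0 u) * norm (?Z u)" by (rule norm_cauchy_schwarz)
      also have "\<dots> \<le> (K * norm (?Z u)) * norm (?Z u)"
        using Lip[OF u] u by (intro mult_right_mono) (auto simp: g_def)
      also have "\<dots> \<le> c * (norm (?Z u))\<^sup>2"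
        using c(2) by (simp add: power2_eq_square mult_right_mono flip: mult.assoc)
      finally have 0: "g 0 u \<bullet> ?Z u \<le> c * (norm (?Z u))\<^sup>2" .
      have le: "c1 * (norm (?Z u))\<^sup>2 \<le> c * (norm (?Z u))\<^sup>2" using c(3) by (intro mult_right_mono) auto
      have 1: "g 1 u \<bullet> ?Z u \<le> c * (norm (?Z u))\<^sup>2"
      proof (cases "x u \<in> frontier X")
        case True
        then show ?thesis using c1(3)[of "x u" "x' u"] near[OF u] u le
          by (auto simp: g_def boundary_push_def)
      qed (use c(1) in \<open>auto simp: g_def boundary_push_def\<close>)
      \<comment> \<open>The minus sign reverses the difference of the paths, so the exterior ball at
        the second path gives a bound of the same sign.\<close>
      have 2: "g 2 u \<bullet> ?Z u \<le> c * (norm (?Z u))\<^sup>2"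
      proof (cases "x' u \<in> frontier X")
        case True
        then show ?thesis using c1(3)[of "x' u" "x u"] near[OF u] u le
          by (auto simp: g_def boundary_push_def norm_minus_commute inner_diff)
      qed (use c(1) in \<open>auto simp: g_def boundary_push_def\<close>)
      show ?thesis using k 0 1 2 by auto
    qed
  next
    show "continuous_on {\<tau>..b} ?Z" by (intro continuous_intros sub x(1) x'(1))
    fix r assume r: "r \<in> {\<tau>..b}"
    have push: "indicator {\<tau><..r} u *\<^sub>R boundary_push X y \<tau> b u = boundary_push X y \<tau> r u" for u and y :: "real \<Rightarrow> real^'d"
      using r by (auto simp: boundary_push_def indicator_def)
    have int: "(\<lambda>u. v u (x u)) integrable_on {\<tau>..r}" "(\<lambda>u. v u (x' u)) integrable_on {\<tau>..r}"
      by (intro integrable_continuous_interval sub dc)+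
    have "(\<integral>u. indicator {\<tau><..r} u *\<^sub>R g 0 u \<partial>lborel) = (\<integral>u. indicator {\<tau><..r} u *\<^sub>R (v u (x u) - v u (x' u)) \<partial>lborel)"
      using r by (intro Bochner_Integration.integral_cong) (auto simp: g_def indicator_def)
    also have "\<dots> = integral {\<tau>..r} (\<lambda>u. v u (x u) - v u (x' u))"
      by (rule lborel_integral_Ioc) (intro continuous_intros sub dc)
    also have "\<dots> = integral {\<tau>..r} (\<lambda>u. v u (x u)) - integral {\<tau>..r} (\<lambda>u. v u (x' u))"
      by (rule Henstock_Kurzweil_Integration.integral_diff[OF int])
    finally have 0: "(\<integral>u. indicator {\<tau><..r} u *\<^sub>R g 0 u \<partial>lborel) =
       integral {\<tau>..r} (\<lambda>u. v u (x u)) - integral {\<tau>..r} (\<lambda>u. v u (x' u))" .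
    have "(\<Sum>k\<in>{0, 1, 2}. \<integral>u. indicator {\<tau><..r} u *\<^sub>R g k u \<partial>\<mu> k) =
      (integral {\<tau>..r} (\<lambda>u. v u (x u)) - integral {\<tau>..r} (\<lambda>u. v u (x' u))) +
      (\<integral>u. boundary_push X x \<tau> r u \<partial>interval_measure L) - (\<integral>u. boundary_push X x' \<tau> r u \<partial>interval_measure L')"
      using 0 by (simp add: \<mu>_def) (simp add: g_def push)
    then show "?Z r = (\<Sum>k\<in>{0, 1, 2}. \<integral>u. indicator {\<tau><..r} u *\<^sub>R g k u \<partial>\<mu> k)"
      using reflected_path_increment[OF X v s L s\<tau>, of r] reflected_path_increment[OF X v s L' s\<tau>, of r] r x\<tau>
      by simp
  next
    have "(\<Sum>k\<in>{0, 1, 2}. measure (\<mu> k) {\<tau><..b}) = V b"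
      using b interval_measure_properties(1)[OF mL, of \<tau> b] interval_measure_properties(1)[OF mL', of \<tau> b]
        monoD[OF mL(1), of \<tau> b] monoD[OF mL'(1), of \<tau> b]
      by (simp add: \<mu>_def V_def measure_def)
    then show "2 * c * (\<Sum>k\<in>{0, 1, 2}. measure (\<mu> k) {\<tau><..b}) \<le> 1 / 2"
      using b0(2)[of b] b by simp
  qed (use b in auto)
  have "b \<le> \<tau>"
    unfolding \<tau>_def
  proof (rule cInf_greatest)
    fix u assume u: "u \<in> D"
    then have "\<tau> \<le> u" unfolding \<tau>_def by (rule cInf_lower[OF _ D(2)])
    then show "b \<le> u" using zero[of u] u by (force simp: D_def)
  qed (use D in auto)
  then show False using b by simp
qed

section \<open>Independence of the noise before and after a time\<close>

text \<open>A generating family of \<open>increment_algebra\<close> that is closed under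
  intersection: independence only has to be checked on it.\<close>

definition increment_cylinders :: "'w measure \<Rightarrow> (real \<Rightarrow> 'w \<Rightarrow> real^'d) \<Rightarrow> real \<Rightarrow> real \<Rightarrow> 'w set set" where
  "increment_cylinders M w s t =
    {{\<omega>\<in>space M. \<forall>u\<in>J. w u \<omega> - w s \<omega> \<in> B u} | J B. finite J \<and> J \<subseteq> {s..t} \<and> (\<forall>u. B u \<in> sets borel)}"

lemma increment_cylindersI:
  assumes "finite J" "J \<subseteq> {s..t}" "\<And>u. B u \<in> sets borel"
  shows "{\<omega>\<in>space M. \<forall>u\<in>J. w u \<omega> - w s \<omega> \<in> B u} \<in> increment_cylinders M w s t"
  unfolding increment_cylinders_def using assms by blast

lemma Int_stable_increment_cylinders: "Int_stable (increment_cylinders M w s t)"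
proof (rule Int_stableI)
  fix a b assume "a \<in> increment_cylinders M w s t" "b \<in> increment_cylinders M w s t"
  then obtain J B J' B' where a: "a = {\<omega>\<in>space M. \<forall>u\<in>J. w u \<omega> - w s \<omega> \<in> B u}"
      "finite J" "J \<subseteq> {s..t}" "\<forall>u. B u \<in> sets borel"
    and b: "b = {\<omega>\<in>space M. \<forall>u\<in>J'. w u \<omega> - w s \<omega> \<in> B' u}"
      "finite J'" "J' \<subseteq> {s..t}" "\<forall>u. B' u \<in> sets borel"
    unfolding increment_cylinders_def by blast
  \<comment> \<open>Times that occur in only one of the two cylinders get the whole space as the
    other condition.\<close>
  let ?C = "\<lambda>u. (if u \<in> J then B u else UNIV) \<inter> (if u \<in> J' then B' u else UNIV)"
  have "a \<inter> b = {\<omega>\<in>space M. \<forall>u\<in>J \<union> J'. w u \<omega> - w s \<omega> \<in> ?C u}"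
    unfolding a(1) b(1) by auto
  also have "\<dots> \<in> increment_cylinders M w s t"
    by (rule increment_cylindersI) (use a b in simp_all)
  finally show "a \<inter> b \<in> increment_cylinders M w s t" .
qed

lemma sets_increment_algebra:
  "sets (increment_algebra M w s t) = sigma_sets (space M)
    {(\<lambda>\<omega>. w u \<omega> - w s \<omega>) -` B \<inter> space M | u B. s \<le> u \<and> u \<le> t \<and> B \<in> sets borel}"
  "space (increment_algebra M w s t) = space M"
  unfolding increment_algebra_def by (rule sets_measure_of space_measure_of; blast)+

lemma increment_algebra_subset_cylinders:
  fixes w :: "real \<Rightarrow> 'w \<Rightarrow> real^'d"
  shows
  "sets (increment_algebra M w s t) \<subseteq> sigma_sets (space M) (increment_cylinders M w s t)"
  unfolding sets_increment_algebra
proof (rule sigma_sets_mono, safe)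
  fix u and B :: "(real^'d) set" assume u: "s \<le> u" "u \<le> t" "B \<in> sets borel"
  have "(\<lambda>\<omega>. w u \<omega> - w s \<omega>) -` B \<inter> space M = {\<omega>\<in>space M. \<forall>u\<in>{u}. w u \<omega> - w s \<omega> \<in> (\<lambda>_. B) u}" by auto
  also have "\<dots> \<in> increment_cylinders M w s t"
    by (rule increment_cylindersI) (use u in auto)
  finally show "(\<lambda>\<omega>. w u \<omega> - w s \<omega>) -` B \<inter> space M \<in> sigma_sets (space M) (increment_cylinders M w s t)"
    by (rule sigma_sets.Basic)
qed

lemma increment_algebra_mono:
  "t \<le> t' \<Longrightarrow> sets (increment_algebra M w s t) \<subseteq> sets (increment_algebra M w s t')"
  unfolding sets_increment_algebra by (rule sigma_sets_mono') (auto intro: order_trans)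

lemma increment_cylinders_events:
  assumes w: "\<And>t. t \<ge> 0 \<Longrightarrow> w t \<in> borel_measurable M" and s: "0 \<le> s"
  shows "increment_cylinders M w s t \<subseteq> sets M"
proof
  fix a assume "a \<in> increment_cylinders M w s t"
  then obtain J B where a: "a = {\<omega>\<in>space M. \<forall>u\<in>J. w u \<omega> - w s \<omega> \<in> B u}"
      "finite J" "J \<subseteq> {s..t}" "\<forall>u. B u \<in> sets borel"
    unfolding increment_cylinders_def by blast
  have [measurable]: "B u \<in> sets borel" for u using a(4) by blast
  have *: "{\<omega>\<in>space M. w u \<omega> - w s \<omega> \<in> B u} \<in> sets M" if "u \<in> J" for u
  proof -
    have [measurable]: "w u \<in> borel_measurable M" "w s \<in> borel_measurable M"
      using w a(3) that s by auto
    show ?thesis by measurable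
  qed
  show "a \<in> sets M" unfolding a(1) by (rule sets.sets_Collect_finite_All[OF * a(2)])
qed

lemma increment_algebra_events:
  assumes w: "\<And>t. t \<ge> 0 \<Longrightarrow> w t \<in> borel_measurable M" and s: "0 \<le> s"
  shows "sets (increment_algebra M w s t) \<subseteq> sets M"
  by (rule order_trans[OF increment_algebra_subset_cylinders
    sets.sigma_sets_subset[OF increment_cylinders_events[OF w s]]])

text \<open>The Wiener process comes with independence of consecutive increments along a monotone
  sequence of times. So all times of both cylinders, together with \<open>s\<close> and
  \<open>r\<close>, are sorted into one grid; the first cylinder depends on the grid increments
  before \<open>r\<close>, the second on those after it.\<close>

lemma increment_cylinders_indep:
  fixes w :: "real \<Rightarrow> 'w \<Rightarrow> real^'d"
  assumes W: "wiener_process M w" and s: "0 \<le> s" "s \<le> r"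
    and a: "a \<in> increment_cylinders M w s r" and b: "b \<in> increment_cylinders M w r t"
  shows "measure M (a \<inter> b) = measure M a * measure M b"
proof -
  interpret prob_space M using W by (simp add: wiener_process_def)
  obtain J B J' B' where a: "a = {\<omega>\<in>space M. \<forall>u\<in>J. w u \<omega> - w s \<omega> \<in> B u}"
      "finite J" "J \<subseteq> {s..r}" "\<forall>u. B u \<in> sets borel"
    and b: "b = {\<omega>\<in>space M. \<forall>u\<in>J'. w u \<omega> - w r \<omega> \<in> B' u}"
      "finite J'" "J' \<subseteq> {r..t}" "\<forall>u. B' u \<in> sets borel"
    using a b unfolding increment_cylinders_def by blast
  define T where "T = {s, r} \<union> J \<union> J'"
  define l where "l = sorted_list_of_set T"
  define n where "n = length l - 1"
  \<comment> \<open>The grid has \<open>n + 1\<close> points. Freezing the index at \<open>n\<close>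
    continues it as a constant, so that \<tau> is monotone on all naturals.\<close>
  define \<tau> where "\<tau> i = l ! min i n" for i
  have T: "finite T" "T \<noteq> {}" using a b by (auto simp: T_def)
  have l: "sorted l" "distinct l" "set l = T" using T by (auto simp: l_def)
  have "l \<noteq> []" using l(3) T(2) by auto
  then have n: "length l = Suc n" unfolding n_def by (cases l) auto
  have mono: "mono \<tau>"
    unfolding \<tau>_def by (rule monoI) (use l(1) n in \<open>auto intro!: sorted_nth_mono\<close>)
  have T\<tau>: "\<exists>i\<le>n. \<tau> i = u" if "u \<in> T" for u
    using that l(3) n by (metis \<tau>_def in_set_conv_nth less_Suc_eq_le min.absorb1)
  define idx where "idx u = (SOME i. i \<le> n \<and> \<tau> i = u)" for u
  have idx: "idx u \<le> n" "\<tau> (idx u) = u" if "u \<in> T" for u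
    using someI_ex[of "\<lambda>i. i \<le> n \<and> \<tau> i = u"] T\<tau>[OF that] by (auto simp: idx_def)
  have less: "idx u \<le> idx u'" if "u \<in> T" "u' \<in> T" "u \<le> u'" for u u'
  proof (cases "u = u'")
    case False
    then have "u < u'" using that by simp
    then have "\<not> \<tau> (idx u') \<le> \<tau> (idx u)" using idx that by simp
    then show ?thesis using monoD[OF mono] by (meson nle_le)
  qed simp
  have sr: "s \<in> T" "r \<in> T" and TJ: "J \<subseteq> T" "J' \<subseteq> T" by (auto simp: T_def)
  have idxs: "idx s \<le> idx u" if "u \<in> T" for u
    using less[OF sr(1) that] that a(3) b(3) s by (force simp: T_def)
  have \<tau>0: "0 \<le> \<tau> 0"
  proof -
    have "\<tau> 0 \<in> T" using l(3) n by (simp add: \<tau>_def nth_mem flip: l(3))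
    then show ?thesis using a(3) b(3) s by (force simp: T_def)
  qed
  define inc where "inc i \<omega> = w (\<tau> (Suc i)) \<omega> - w (\<tau> i) \<omega>" for i \<omega>
  have ind: "indep_vars (\<lambda>_. borel) inc {..<n}"
    using W \<tau>0 mono unfolding wiener_process_def inc_def by blast
  have tel: "w u \<omega> - w u' \<omega> = (\<Sum>k\<in>{idx u'..<idx u}. inc k \<omega>)" if "u \<in> T" "u' \<in> T" "u' \<le> u" for u u' \<omega>
    unfolding inc_def using sum_Suc_diff'[OF less[OF that(2,1,3)], of "\<lambda>k. w (\<tau> k) \<omega>"] idx that by simp
  define m where "m = idx r"
  let ?A = "{..<m}" and ?B = "{m..<n}"
  let ?PA = "PiM ?A (\<lambda>_. borel :: (real^'d) measure)" and ?PB = "PiM ?B (\<lambda>_. borel :: (real^'d) measure)"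
  have iv: "indep_var ?PA (\<lambda>\<omega>. restrict (\<lambda>i. inc i \<omega>) ?A) ?PB (\<lambda>\<omega>. restrict (\<lambda>i. inc i \<omega>) ?B)"
    by (rule indep_var_restrict[OF ind]) (use idx(1)[OF sr(2)] in \<open>auto simp: m_def\<close>)
  \<comment> \<open>Displacements telescope into sums of grid increments, so the cylinders become
    events in two disjoint blocks of coordinates.\<close>
  define A' where "A' = {g \<in> space ?PA. \<forall>u\<in>J. (\<Sum>k\<in>{idx s..<idx u}. g k) \<in> B u}"
  define B'' where "B'' = {g \<in> space ?PB. \<forall>u\<in>J'. (\<Sum>k\<in>{m..<idx u}. g k) \<in> B' u}"
  have iJ: "idx u \<le> m" if "u \<in> J" for u 
    using less[of u r] subsetD[OF a(3) that] subsetD[OF TJ(1) that] sr by (simp add: m_def)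
  have [measurable]: "B u \<in> sets borel" "B' u \<in> sets borel" for u using a(4) b(4) by blast+
  have mA: "A' \<in> sets ?PA"
    unfolding A'_def
  proof (rule sets.sets_Collect_finite_All[OF _ a(2)])
    fix u assume u: "u \<in> J"
    have "(\<lambda>g. \<Sum>k\<in>{idx s..<idx u}. g k) \<in> borel_measurable ?PA"
      by (intro borel_measurable_sum measurable_component_singleton) (use iJ[OF u] in auto)
    then show "{g \<in> space ?PA. (\<Sum>k\<in>{idx s..<idx u}. g k) \<in> B u} \<in> sets ?PA" by measurable
  qed
  have mB: "B'' \<in> sets ?PB"
    unfolding B''_def
  proof (rule sets.sets_Collect_finite_All[OF _ b(2)])
    fix u assume u: "u \<in> J'"
    have "(\<lambda>g. \<Sum>k\<in>{m..<idx u}. g k) \<in> borel_measurable ?PB"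
      by (intro borel_measurable_sum measurable_component_singleton) (use idx(1)[of u] u TJ in auto)
    then show "{g \<in> space ?PB. (\<Sum>k\<in>{m..<idx u}. g k) \<in> B' u} \<in> sets ?PB" by measurable
  qed
  have rA: "(\<Sum>k\<in>{idx s..<idx u}. restrict (\<lambda>i. inc i \<omega>) ?A k) = w u \<omega> - w s \<omega>" if "u \<in> J" for u \<omega>
  proof -
    have "(\<Sum>k\<in>{idx s..<idx u}. restrict (\<lambda>i. inc i \<omega>) ?A k) = (\<Sum>k\<in>{idx s..<idx u}. inc k \<omega>)"
      by (rule sum.cong) (use iJ[OF that] in auto)
    also have "\<dots> = w u \<omega> - w s \<omega>"
      by (rule tel[symmetric]) (use that TJ sr a(3) in auto)
    finally show ?thesis .
  qed
  have rB: "(\<Sum>k\<in>{m..<idx u}. restrict (\<lambda>i. inc i \<omega>) ?B k) = w u \<omega> - w r \<omega>" if "u \<in> J'" for u \<omega>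
  proof -
    have "(\<Sum>k\<in>{m..<idx u}. restrict (\<lambda>i. inc i \<omega>) ?B k) = (\<Sum>k\<in>{idx r..<idx u}. inc k \<omega>)"
      by (rule sum.cong) (use idx(1)[of u] that TJ in \<open>auto simp: m_def\<close>)
    also have "\<dots> = w u \<omega> - w r \<omega>"
      by (rule tel[symmetric]) (use that TJ sr b(3) in auto)
    finally show ?thesis .
  qed
  have sp: "restrict (\<lambda>i. inc i \<omega>) ?A \<in> space ?PA" "restrict (\<lambda>i. inc i \<omega>) ?B \<in> space ?PB" for \<omega>
    by (auto simp: space_PiM)
  have aA: "a = (\<lambda>\<omega>. restrict (\<lambda>i. inc i \<omega>) ?A) -` A' \<inter> space M"
    using sp(1) rA by (auto simp: a(1) A'_def)
  have bB: "b = (\<lambda>\<omega>. restrict (\<lambda>i. inc i \<omega>) ?B) -` B'' \<inter> space M"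
    using sp(2) rB by (auto simp: b(1) B''_def)
  have "a \<inter> b = (\<lambda>\<omega>. (restrict (\<lambda>i. inc i \<omega>) ?A, restrict (\<lambda>i. inc i \<omega>) ?B)) -` (A' \<times> B'') \<inter> space M"
    unfolding aA bB by auto
  then show ?thesis using indep_varD[OF iv mA mB] aA bB by simp
qed

lemma increment_algebra_indep:
  assumes W: "wiener_process M w" and s: "0 \<le> s" "s \<le> r"
  shows "prob_space.indep_set M (sets (increment_algebra M w s r)) (sets (increment_algebra M w r t))"
proof -
  interpret prob_space M using W by (simp add: wiener_process_def)
  have w: "\<And>t. t \<ge> 0 \<Longrightarrow> w t \<in> borel_measurable M" using W by (simp add: wiener_process_def)
  have r: "0 \<le> r" using s by simp
  have "indep_set (increment_cylinders M w s r) (increment_cylinders M w r t)"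
    by (rule indep_setI[OF increment_cylinders_events[OF w s(1)] increment_cylinders_events[OF w r]
      increment_cylinders_indep[OF W s]])
  then have i: "indep_set (sigma_sets (space M) (increment_cylinders M w s r))
      (sigma_sets (space M) (increment_cylinders M w r t))"
    by (rule indep_set_sigma_sets[OF _ Int_stable_increment_cylinders Int_stable_increment_cylinders])
  show ?thesis
  proof (rule indep_setI)
    show "sets (increment_algebra M w s r) \<subseteq> events" by (rule increment_algebra_events[OF w s(1)])
    show "sets (increment_algebra M w r t) \<subseteq> events" by (rule increment_algebra_events[OF w r])
    fix a b assume "a \<in> sets (increment_algebra M w s r)" "b \<in> sets (increment_algebra M w r t)"
    then show "prob (a \<inter> b) = prob a * prob b"
      by (intro indep_setD[OF i] subsetD[OF increment_algebra_subset_cylinders])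
  qed
qed

section \<open>Markov property and transfer operators\<close>

text \<open>What the Markov argument needs from the equation: \<open>F s t\<close> is the noise
  between two times, and pathwise uniqueness survives as \<open>x_flow\<close>, which holds for
  every \<omega> and not just almost surely.\<close>

locale stochastic_flow = prob_space M for M :: "'w measure" +
  fixes S :: "'a::euclidean_space set" and F :: "real \<Rightarrow> real \<Rightarrow> 'w measure"
    and x :: "real \<Rightarrow> 'a \<Rightarrow> real \<Rightarrow> 'w \<Rightarrow> 'a"
  assumes S: "S \<in> sets borel"
    and F_space: "\<And>s t. space (F s t) = space M"
    and F_events: "\<And>s t. 0 \<le> s \<Longrightarrow> sets (F s t) \<subseteq> events"
    and F_mono: "\<And>s t t'. t \<le> t' \<Longrightarrow> sets (F s t) \<subseteq> sets (F s t')"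
    and F_indep: "\<And>s r t. 0 \<le> s \<Longrightarrow> s \<le> r \<Longrightarrow> indep_set (sets (F s r)) (sets (F r t))"
    and x_measurable: "\<And>s t. 0 \<le> s \<Longrightarrow> s \<le> t \<Longrightarrow>
      (\<lambda>(y, \<omega>). x s y t \<omega>) \<in> borel_measurable (restrict_space borel S \<Otimes>\<^sub>M F s t)"
    and x_in: "\<And>s t y \<omega>. 0 \<le> s \<Longrightarrow> s \<le> t \<Longrightarrow> y \<in> S \<Longrightarrow> \<omega> \<in> space M \<Longrightarrow> x s y t \<omega> \<in> S"
    and x_init: "\<And>s y \<omega>. 0 \<le> s \<Longrightarrow> y \<in> S \<Longrightarrow> \<omega> \<in> space M \<Longrightarrow> x s y s \<omega> = y"
    and x_flow: "\<And>s r t y \<omega>. 0 \<le> s \<Longrightarrow> s \<le> r \<Longrightarrow> r \<le> t \<Longrightarrow> y \<in> S \<Longrightarrow> \<omega> \<in> space M \<Longrightarrow>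
      x s y t \<omega> = x r (x s y r \<omega>) t \<omega>"
begin

abbreviation SB :: "'a measure" where "SB \<equiv> restrict_space borel S"

lemma space_SB: "space SB = S" by (simp add: space_restrict_space)

lemma x_measurable_SB:
  assumes "0 \<le> s" "s \<le> t"
  shows "(\<lambda>(y, \<omega>). x s y t \<omega>) \<in> measurable (SB \<Otimes>\<^sub>M F s t) SB"
  by (rule measurable_restrict_space2)
    (use assms x_in x_measurable in \<open>auto simp: space_pair_measure F_space space_SB\<close>)

lemma F_id: "0 \<le> s \<Longrightarrow> (\<lambda>\<omega>. \<omega>) \<in> measurable M (F s t)"
  using F_events[of s t] sets.sets_into_space[of _ M] by (auto simp: measurable_def F_space Int_absorb2 subset_iff)

lemma x_measurable_M:
  assumes "0 \<le> s" "s \<le> t"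
  shows "(\<lambda>(y, \<omega>). x s y t \<omega>) \<in> measurable (SB \<Otimes>\<^sub>M M) SB"
proof -
  have "(\<lambda>p. (fst p, snd p)) \<in> measurable (SB \<Otimes>\<^sub>M M) (SB \<Otimes>\<^sub>M F s t)"
    by (intro measurable_Pair measurable_fst measurable_compose[OF measurable_snd F_id] assms)
  from measurable_compose[OF this x_measurable_SB[OF assms]] show ?thesis by (simp add: case_prod_beta')
qed

lemma x_measurable_at:
  assumes "0 \<le> s" "s \<le> t" "y \<in> S"
  shows "x s y t \<in> measurable (F s t) SB"
  using measurable_compose[OF measurable_Pair1' x_measurable_SB[OF assms(1,2)], of y] assms(3)
  by (simp add: space_SB)

lemma x_measurable_at_M:
  assumes "0 \<le> s" "s \<le> t" "y \<in> S"
  shows "x s y t \<in> measurable M SB"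
  using measurable_compose[OF F_id x_measurable_at] assms by blast

text \<open>Independence of the two algebras is read as independence of two copies of the identity
  map, one into each algebra. The law of the diagonal map is then a product measure, to which Fubini
  applies.\<close>

lemma distr_F_pair:
  assumes "0 \<le> s" "s \<le> r" "r \<le> t"
  shows "distr M (F s r \<Otimes>\<^sub>M F r t) (\<lambda>\<omega>. (\<omega>, \<omega>)) = distr M (F s r) (\<lambda>\<omega>. \<omega>) \<Otimes>\<^sub>M distr M (F r t) (\<lambda>\<omega>. \<omega>)"
proof -
  have r: "0 \<le> r" using assms by simp
  have gen: "sigma_sets (space M) {(\<lambda>\<omega>. \<omega>) -` A \<inter> space M | A. A \<in> sets (F u t)} = sets (F u t)" for u t
  proof -
    have "{(\<lambda>\<omega>. \<omega>) -` A \<inter> space M | A. A \<in> sets (F u t)} = sets (F u t)"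
      using sets.sets_into_space[of _ "F u t"] F_space by (auto 4 3 simp: Int_absorb2)
    then show ?thesis using sets.sigma_sets_eq[of "F u t"] F_space by simp
  qed
  have "indep_var (F s r) (\<lambda>\<omega>. \<omega>) (F r t) (\<lambda>\<omega>. \<omega>)"
    unfolding indep_var_eq gen using F_indep[OF assms(1,2)] F_id[OF assms(1)] F_id[OF r] by blast
  then show ?thesis unfolding indep_var_distribution_eq by simp
qed

text \<open>The transition operator of the process on observables, adjoint to the transfer operator
  on densities.\<close>

definition kernel_op :: "real \<Rightarrow> real \<Rightarrow> ('a \<Rightarrow> real) \<Rightarrow> 'a \<Rightarrow> real" where
  "kernel_op s t g y = (\<integral>\<omega>. g (x s y t \<omega>) \<partial>M)"

lemma kernel_op_measurable:
  assumes "0 \<le> s" "s \<le> t" and g: "g \<in> borel_measurable SB"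
  shows "kernel_op s t g \<in> borel_measurable SB"
proof -
  have "(\<lambda>(y, \<omega>). g (x s y t \<omega>)) \<in> borel_measurable (SB \<Otimes>\<^sub>M M)"
    using measurable_compose[OF x_measurable_M[OF assms(1,2)] g] by (simp add: case_prod_beta')
  then show ?thesis unfolding kernel_op_def by (rule borel_measurable_lebesgue_integral)
qed

lemma kernel_op_bounds:
  assumes "0 \<le> s" "s \<le> t" "y \<in> S" and g: "g \<in> borel_measurable SB"
    and b: "\<And>z. z \<in> S \<Longrightarrow> 0 \<le> g z \<and> g z \<le> B"
  shows "0 \<le> kernel_op s t g y" "kernel_op s t g y \<le> B"
proof -
  have m: "(\<lambda>\<omega>. g (x s y t \<omega>)) \<in> borel_measurable M"
    using measurable_compose[OF x_measurable_at_M[OF assms(1-3)] g] .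
  have *: "0 \<le> g (x s y t \<omega>) \<and> g (x s y t \<omega>) \<le> B" if "\<omega> \<in> space M" for \<omega>
    by (rule b[OF x_in[OF assms(1-3) that]])
  show "0 \<le> kernel_op s t g y" unfolding kernel_op_def by (rule Bochner_Integration.integral_nonneg) (use * in auto)
  have "kernel_op s t g y \<le> (\<integral>\<omega>. B \<partial>M)"
    unfolding kernel_op_def
  proof (rule integral_mono)
    show "integrable M (\<lambda>\<omega>. g (x s y t \<omega>))"
      by (rule integrable_const_bound[of _ B]) (use * m in auto)
  qed (use * in auto)
  then show "kernel_op s t g y \<le> B" by (simp add: prob_space)
qed

text \<open>By the flow property \<omega> enters the position at \<open>t\<close> twice: through the
  position at \<open>r\<close> and through the noise after \<open>r\<close>. These parts are
  independent, so the second occurrence may be replaced by an independent copy and integrated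
  out.\<close>

lemma markov:
  assumes t: "0 \<le> s" "s \<le> r" "r \<le> t" and y: "y \<in> S" and E: "E \<in> sets (F s r)"
    and g: "g \<in> borel_measurable SB" "\<And>z. z \<in> S \<Longrightarrow> \<bar>g z\<bar> \<le> B"
  shows "(\<integral>\<omega>. indicator E \<omega> * g (x s y t \<omega>) \<partial>M) = (\<integral>\<omega>. indicator E \<omega> * kernel_op r t g (x s y r \<omega>) \<partial>M)"
proof -
  have r: "0 \<le> r" using t by simp
  let ?F1 = "F s r" and ?F2 = "F r t"
  let ?M1 = "distr M ?F1 (\<lambda>\<omega>. \<omega>)" and ?M2 = "distr M ?F2 (\<lambda>\<omega>. \<omega>)"
  interpret M1: prob_space ?M1 by (rule prob_space_distr[OF F_id[OF t(1)]])
  interpret M2: prob_space ?M2 by (rule prob_space_distr[OF F_id[OF r]])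
  interpret P: pair_prob_space ?M1 ?M2 ..
  \<comment> \<open>The decoupled integrand; on the diagonal it gives back the original one.\<close>
  define H where "H = (\<lambda>(\<omega>, \<omega>'). indicator E \<omega> * g (x r (x s y r \<omega>) t \<omega>'))"
  have "(\<lambda>p. (x s y r (fst p), snd p)) \<in> measurable (?F1 \<Otimes>\<^sub>M ?F2) (SB \<Otimes>\<^sub>M ?F2)"
    by (intro measurable_Pair measurable_snd measurable_compose[OF measurable_fst x_measurable_at[OF t(1,2) y]])
  from measurable_compose[OF measurable_compose[OF this x_measurable_SB[OF r t(3)]] g(1)]
  have gm: "(\<lambda>p. g (x r (x s y r (fst p)) t (snd p))) \<in> borel_measurable (?F1 \<Otimes>\<^sub>M ?F2)" by simp
  have "(\<lambda>p. indicator E (fst p) :: real) \<in> borel_measurable (?F1 \<Otimes>\<^sub>M ?F2)"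
    by (rule measurable_compose[OF measurable_fst]) (use E in simp)
  with gm have H: "H \<in> borel_measurable (?F1 \<Otimes>\<^sub>M ?F2)"
    unfolding H_def case_prod_beta' by (rule borel_measurable_times[rotated])
  have bound: "norm (H p) \<le> max 0 B" if "p \<in> space (?M1 \<Otimes>\<^sub>M ?M2)" for p
  proof -
    have "x s y r (fst p) \<in> S" "snd p \<in> space M"
      using that x_in[OF t(1,2) y] by (auto simp: space_pair_measure F_space)
    then have "\<bar>g (x r (x s y r (fst p)) t (snd p))\<bar> \<le> B" using g(2) x_in[OF r t(3)] by blast
    then show ?thesis by (auto simp: H_def case_prod_beta' indicator_def)
  qed
  have H': "integrable (?M1 \<Otimes>\<^sub>M ?M2) H"
    by (rule P.P.integrable_const_bound[of _ "max 0 B"]) (use bound H in \<open>auto intro!: AE_I2\<close>)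
  have "(\<integral>\<omega>. indicator E \<omega> * g (x s y t \<omega>) \<partial>M) = (\<integral>\<omega>. H (\<omega>, \<omega>) \<partial>M)"
    by (rule Bochner_Integration.integral_cong) (use x_flow[OF t y] in \<open>auto simp: H_def\<close>)
  also have "\<dots> = (\<integral>p. H p \<partial>distr M (?F1 \<Otimes>\<^sub>M ?F2) (\<lambda>\<omega>. (\<omega>, \<omega>)))"
    by (rule integral_distr[symmetric, OF _ H]) (intro measurable_Pair F_id t r)
  also have "\<dots> = (\<integral>\<omega>. \<integral>\<omega>'. H (\<omega>, \<omega>') \<partial>?M2 \<partial>?M1)"
    unfolding distr_F_pair[OF t] using P.integral_fst'[OF H'] by simp
  also have "\<dots> = (\<integral>\<omega>. \<integral>\<omega>'. H (\<omega>, \<omega>') \<partial>?M2 \<partial>M)"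
  proof (rule integral_distr[OF F_id[OF t(1)]])
    have "(\<lambda>(\<omega>, \<omega>'). H (\<omega>, \<omega>')) \<in> borel_measurable (?F1 \<Otimes>\<^sub>M ?M2)"
      using H by simp
    then show "(\<lambda>\<omega>. \<integral>\<omega>'. H (\<omega>, \<omega>') \<partial>?M2) \<in> borel_measurable ?F1"
      by (rule M2.borel_measurable_lebesgue_integral)
  qed
  also have "\<dots> = (\<integral>\<omega>. indicator E \<omega> * kernel_op r t g (x s y r \<omega>) \<partial>M)"
  proof (rule Bochner_Integration.integral_cong[OF refl])
    fix \<omega> assume w: "\<omega> \<in> space M"
    have "(\<integral>\<omega>'. H (\<omega>, \<omega>') \<partial>?M2) = (\<integral>\<omega>'. H (\<omega>, \<omega>') \<partial>M)"
      by (rule integral_distr[OF F_id[OF r]])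
        (use measurable_compose[OF measurable_Pair1'[of \<omega> ?F1 ?F2] H] w in \<open>simp add: F_space\<close>)
    then show "(\<integral>\<omega>'. H (\<omega>, \<omega>') \<partial>?M2) = indicator E \<omega> * kernel_op r t g (x s y r \<omega>)"
      by (simp add: H_def kernel_op_def)
  qed
  finally show ?thesis .
qed

end

text \<open>The reference measure \<open>N\<close> is kept apart from the state space
  \<open>S\<close>: for the reflected process \<open>N\<close> lives on \<open>X\<close>, while
  paths visit its closure. \<open>N_id\<close> allows functions on \<open>S\<close> to be integrated
  against \<open>N\<close>.\<close>

locale stochastic_flow_density = stochastic_flow M S F x + N: finite_measure N
  for M :: "'w measure" and S :: "'a::euclidean_space set" and F and x :: "real \<Rightarrow> 'a \<Rightarrow> real \<Rightarrow> 'w \<Rightarrow> 'a"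
    and N :: "'a measure" +
  fixes q :: "real \<Rightarrow> real \<Rightarrow> 'a \<Rightarrow> 'a \<Rightarrow> real"
  assumes N_id: "(\<lambda>y. y) \<in> measurable N (restrict_space borel S)"
    and q_measurable: "\<And>s t. 0 \<le> s \<Longrightarrow> s < t \<Longrightarrow> (\<lambda>(y, z). q s t y z) \<in> borel_measurable (N \<Otimes>\<^sub>M N)"
    and q_nonneg: "\<And>s t y z. 0 \<le> s \<Longrightarrow> s < t \<Longrightarrow> y \<in> space N \<Longrightarrow> z \<in> space N \<Longrightarrow> 0 \<le> q s t y z"
    and q_density: "\<And>s t y A. 0 \<le> s \<Longrightarrow> s < t \<Longrightarrow> y \<in> space N \<Longrightarrow> A \<in> sets borel \<Longrightarrow>
      emeasure M {\<omega>\<in>space M. x s y t \<omega> \<in> A} = (\<integral>\<^sup>+z. ennreal (q s t y z) * indicator A z \<partial>N)"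
begin

lemma space_N: "y \<in> space N \<Longrightarrow> y \<in> S"
  using measurable_space[OF N_id] by (simp add: space_SB)

lemma N_measurable: "g \<in> borel_measurable SB \<Longrightarrow> g \<in> borel_measurable N"
  using measurable_compose[OF N_id] by blast

lemma q_at_measurable:
  assumes "0 \<le> s" "s < t" "y \<in> space N"
  shows "q s t y \<in> borel_measurable N"
  using measurable_compose[OF measurable_Pair1' q_measurable[OF assms(1,2)], of y] assms(3) by simp

text \<open>The law of the position at \<open>t\<close> and the measure with density
  \<open>q s t y\<close> agree on Borel subsets of \<open>S\<close>, hence so do the integrals of
  \<open>g\<close>.\<close>

lemma kernel_op_density:
  assumes t: "0 \<le> s" "s < t" and y: "y \<in> space N"
    and g: "g \<in> borel_measurable SB"
  shows "kernel_op s t g y = (\<integral>z. q s t y z * g z \<partial>N)"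
proof -
  have s: "s \<le> t" and yS: "y \<in> S" using t y space_N by auto
  let ?D = "distr M SB (x s y t)"
  let ?E = "distr (density N (\<lambda>z. ennreal (q s t y z))) SB (\<lambda>z. z)"
  have qm: "q s t y \<in> borel_measurable N" by (rule q_at_measurable[OF t y])
  have [measurable]: "(\<lambda>z. z) \<in> measurable N SB" by (rule N_id)
  have DE: "?D = ?E"
  proof (rule measure_eqI)
    fix A assume "A \<in> sets ?D"
    then have A: "A \<in> sets SB" by simp
    then have AB: "A \<in> sets borel" "A \<subseteq> S" using S by (auto simp: sets_restrict_space_iff)
    have "emeasure ?D A = emeasure M {\<omega>\<in>space M. x s y t \<omega> \<in> A}"
      using emeasure_distr[OF x_measurable_at_M[OF t(1) s yS] A] by (simp add: vimage_def Int_def conj_commute)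
    also have "\<dots> = (\<integral>\<^sup>+z. ennreal (q s t y z) * indicator A z \<partial>N)" by (rule q_density[OF t y AB(1)])
    also have "\<dots> = (\<integral>\<^sup>+z. ennreal (q s t y z) * indicator ((\<lambda>z. z) -` A \<inter> space N) z \<partial>N)"
      by (rule nn_integral_cong) (auto simp: indicator_def)
    also have "\<dots> = emeasure ?E A"
      using A qm measurable_sets[OF N_id A] by (simp add: emeasure_distr emeasure_density)
    finally show "emeasure ?D A = emeasure ?E A" .
  qed simp
  have "kernel_op s t g y = (\<integral>z. g z \<partial>?D)"
    unfolding kernel_op_def using integral_distr[OF x_measurable_at_M[OF t(1) s yS] g] by simp
  also have "\<dots> = (\<integral>z. g z \<partial>density N (\<lambda>z. ennreal (q s t y z)))"
    unfolding DE by (rule integral_distr) (use g in simp_all)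
  also have "\<dots> = (\<integral>z. q s t y z * g z \<partial>N)"
    using integral_density[OF N_measurable[OF g] qm] q_nonneg[OF t y] by simp
  finally show ?thesis .
qed

definition transfer :: "real \<Rightarrow> real \<Rightarrow> ('a \<Rightarrow> real) \<Rightarrow> 'a \<Rightarrow> real" where
  "transfer s t f z = (if t = s then f z else (\<integral>y. q s t y z * f y \<partial>N))"

text \<open>Fubini for the product of the density, \<open>f\<close> and \<open>g\<close>. Absolute
  integrability holds because integrating over \<open>z\<close> first leaves the absolute value of
  \<open>f y\<close> times a \<open>kernel_op\<close> value, which is at most \<open>B\<close>. At
  \<open>t = s\<close> both operators are the identity.\<close>

lemma transfer_dual:
  assumes t: "0 \<le> s" "s \<le> t" and f: "integrable N f"
    and g: "g \<in> borel_measurable SB" "\<And>z. z \<in> S \<Longrightarrow> 0 \<le> g z \<and> g z \<le> B"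
  shows "integrable N (\<lambda>z. g z * transfer s t f z)"
    and "(\<integral>z. g z * transfer s t f z \<partial>N) = (\<integral>y. f y * kernel_op s t g y \<partial>N)"
proof -
  have gf: "integrable N (\<lambda>y. g y * f y)"
  proof (rule Bochner_Integration.integrable_bound)
    show "integrable N (\<lambda>y. B * f y)" using f by simp
    show "(\<lambda>y. g y * f y) \<in> borel_measurable N" using N_measurable[OF g(1)] f by (intro borel_measurable_times) auto
    show "AE y in N. norm (g y * f y) \<le> norm (B * f y)"
    proof (rule AE_I2)
      fix y assume "y \<in> space N"
      then have "\<bar>g y\<bar> \<le> \<bar>B\<bar>" using g(2)[OF space_N] by (metis abs_of_nonneg order_trans)
      then show "norm (g y * f y) \<le> norm (B * f y)" by (simp add: abs_mult mult_right_mono)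
    qed
  qed
  have "integrable N (\<lambda>z. g z * transfer s t f z) \<and>
    (\<integral>z. g z * transfer s t f z \<partial>N) = (\<integral>y. f y * kernel_op s t g y \<partial>N)"
  proof (cases "t = s")
    case True
    have "(\<integral>y. f y * kernel_op s s g y \<partial>N) = (\<integral>y. g y * f y \<partial>N)"
    proof (rule Bochner_Integration.integral_cong[OF refl])
      fix y assume "y \<in> space N"
      then have "kernel_op s s g y = (\<integral>\<omega>. g y \<partial>M)"
        unfolding kernel_op_def by (intro Bochner_Integration.integral_cong refl) (simp add: x_init[OF t(1) space_N])
      then show "f y * kernel_op s s g y = g y * f y" by (simp add: prob_space)
    qed
    then show ?thesis using True gf by (simp add: transfer_def)
  next
    case False
    with t have st: "s < t" by simp
    interpret P: pair_sigma_finite N N ..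
    let ?H = "\<lambda>(y, z). q s t y z * f y * g z"
    note [measurable] = q_measurable[OF t(1) st] N_measurable[OF g(1)] borel_measurable_integrable[OF f]
    have H: "?H \<in> borel_measurable (N \<Otimes>\<^sub>M N)" by measurable
    have B: "(\<integral>z. norm (?H (y, z)) \<partial>N) = \<bar>f y\<bar> * kernel_op s t g y" if y: "y \<in> space N" for y
    proof -
      have "(\<integral>z. norm (?H (y, z)) \<partial>N) = (\<integral>z. \<bar>f y\<bar> * (q s t y z * g z) \<partial>N)"
        by (rule Bochner_Integration.integral_cong[OF refl])
          (use q_nonneg[OF t(1) st y] g(2)[OF space_N] in \<open>simp add: abs_mult\<close>)
      then show ?thesis by (simp add: kernel_op_density[OF t(1) st y g(1)])
    qed
    have I: "integrable (N \<Otimes>\<^sub>M N) ?H"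
    proof (rule P.Fubini_integrable[OF H])
      have "integrable N (\<lambda>y. \<bar>f y\<bar> * kernel_op s t g y)"
      proof (rule Bochner_Integration.integrable_bound)
        show "integrable N (\<lambda>y. B * f y)" using f by simp
        show "(\<lambda>y. \<bar>f y\<bar> * kernel_op s t g y) \<in> borel_measurable N"
          using N_measurable[OF kernel_op_measurable[OF t g(1)]] by measurable
        show "AE y in N. norm (\<bar>f y\<bar> * kernel_op s t g y) \<le> norm (B * f y)"
        proof (rule AE_I2)
          fix y assume "y \<in> space N"
          then have "0 \<le> kernel_op s t g y" "kernel_op s t g y \<le> B"
            using kernel_op_bounds[OF t space_N g] by auto
          then have "\<bar>kernel_op s t g y\<bar> \<le> \<bar>B\<bar>" by linarith
          from mult_left_mono[OF this, of "\<bar>f y\<bar>"]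
          show "norm (\<bar>f y\<bar> * kernel_op s t g y) \<le> norm (B * f y)"
            by (simp add: abs_mult mult.commute)
        qed
      qed
      then show "integrable N (\<lambda>y. \<integral>z. norm (?H (y, z)) \<partial>N)"
        by (subst Bochner_Integration.integrable_cong[OF refl B])
      show "AE y in N. integrable N (\<lambda>z. ?H (y, z))"
      proof (rule AE_I2)
        fix y assume y: "y \<in> space N"
        \<comment> \<open>The density has total mass 1, as the density formula for the full space
          shows.\<close>
        have "integrable N (\<lambda>z. q s t y z * 1)"
        proof (rule integrableI_nonneg)
          show "(\<lambda>z. q s t y z * 1) \<in> borel_measurable N" using q_at_measurable[OF t(1) st y] by simp
          have "(\<integral>\<^sup>+z. ennreal (q s t y z * 1) \<partial>N) = emeasure M {\<omega>\<in>space M. x s y t \<omega> \<in> UNIV}"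
            using q_density[OF t(1) st y, of UNIV] by simp
          then show "(\<integral>\<^sup>+z. ennreal (q s t y z * 1) \<partial>N) < \<infinity>" by (simp add: emeasure_space_1)
        qed (use q_nonneg[OF t(1) st y] in auto)
        then have "integrable N (\<lambda>z. (B * f y) * q s t y z)" by simp
        then show "integrable N (\<lambda>z. ?H (y, z))"
        proof (rule Bochner_Integration.integrable_bound)
          show "(\<lambda>z. ?H (y, z)) \<in> borel_measurable N"
            using q_at_measurable[OF t(1) st y] by simp
          show "AE z in N. norm (?H (y, z)) \<le> norm ((B * f y) * q s t y z)"
          proof (rule AE_I2)
            fix z assume "z \<in> space N"
            then have "\<bar>g z\<bar> \<le> \<bar>B\<bar>" using g(2)[OF space_N] by (metis abs_of_nonneg order_trans)
            then have "\<bar>q s t y z * f y\<bar> * \<bar>g z\<bar> \<le> \<bar>q s t y z * f y\<bar> * \<bar>B\<bar>" by (rule mult_left_mono) simp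
            then show "norm (?H (y, z)) \<le> norm ((B * f y) * q s t y z)" by (simp add: abs_mult mult_ac)
          qed
        qed
      qed
    qed
    have gt: "g z * transfer s t f z = (\<integral>y. ?H (y, z) \<partial>N)" for z
      using False by (simp add: transfer_def mult.commute)
    have "(\<integral>y. f y * kernel_op s t g y \<partial>N) = (\<integral>y. \<integral>z. ?H (y, z) \<partial>N \<partial>N)"
      by (rule Bochner_Integration.integral_cong[OF refl])
        (simp add: kernel_op_density[OF t(1) st _ g(1)] mult.assoc mult.left_commute flip: integral_mult_right_zero)
    then show ?thesis
      unfolding gt using P.integrable_snd[OF I] P.Fubini_integral[OF I] by simp
  qed
  then show "integrable N (\<lambda>z. g z * transfer s t f z)"
    "(\<integral>z. g z * transfer s t f z \<partial>N) = (\<integral>y. f y * kernel_op s t g y \<partial>N)" by blast+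
qed

end

section \<open>Staying in the sign sets at finitely and countably many times\<close>

context stochastic_flow
begin

definition staying :: "(real \<Rightarrow> 'a set) \<Rightarrow> real \<Rightarrow> real set \<Rightarrow> 'a \<Rightarrow> 'w set" where
  "staying A s J y = {\<omega>\<in>space M. \<forall>u\<in>J. x s y u \<omega> \<in> A u}"

lemma staying_measurable:
  assumes s: "0 \<le> s" and y: "y \<in> S" and J: "finite J" "J \<subseteq> {s..r}" and A: "\<And>u. u \<in> J \<Longrightarrow> A u \<in> sets borel"
  shows "staying A s J y \<in> sets (F s r)"
  unfolding staying_def F_space[of s r, symmetric]
proof (rule sets.sets_Collect_finite_All[OF _ J(1)])
  fix u assume u: "u \<in> J"
  then have su: "s \<le> u" "u \<le> r" using J by auto
  have "x s y u -` (A u \<inter> S) \<inter> space (F s u) \<in> sets (F s u)"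
    by (rule measurable_sets[OF x_measurable_at[OF s su(1) y]])
      (use A[OF u] S in \<open>simp add: sets_restrict_space_iff\<close>)
  also have "x s y u -` (A u \<inter> S) \<inter> space (F s u) = {\<omega>\<in>space (F s r). x s y u \<omega> \<in> A u}"
    using x_in[OF s su(1) y] by (auto simp: F_space)
  finally show "{\<omega>\<in>space (F s r). x s y u \<omega> \<in> A u} \<in> sets (F s r)" using F_mono[OF su(2)] by blast
qed

end

context stochastic_flow_density
begin

text \<open>The map \<open>h\<close> separates the space of starting points from the state space: it
  is the identity when starting points are drawn from \<open>N\<close>, and otherwise moves points
  outside \<open>S\<close> into \<open>S\<close>.\<close>

lemma staying_pair_measurable:
  assumes s: "0 \<le> s" and J: "countable J" "J \<subseteq> {s..}" and A: "\<And>u. u \<in> J \<Longrightarrow> A u \<in> sets borel"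
    and B: "h \<in> measurable B SB"
  shows "{(y, \<omega>). y \<in> space B \<and> \<omega> \<in> staying A s J (h y)} \<in> sets (B \<Otimes>\<^sub>M M)"
proof -
  have "{p \<in> space (B \<Otimes>\<^sub>M M). \<forall>u\<in>J. x s (h (fst p)) u (snd p) \<in> A u} \<in> sets (B \<Otimes>\<^sub>M M)"
  proof (rule sets.sets_Collect_countable_All'[OF _ J(1)])
    fix u assume u: "u \<in> J"
    then have su: "s \<le> u" using J by auto
    have "(\<lambda>p. (h (fst p), snd p)) \<in> measurable (B \<Otimes>\<^sub>M M) (SB \<Otimes>\<^sub>M M)"
      by (intro measurable_Pair measurable_snd measurable_compose[OF measurable_fst B])
    from measurable_compose[OF this x_measurable_M[OF s su]]
    have m: "(\<lambda>p. x s (h (fst p)) u (snd p)) \<in> measurable (B \<Otimes>\<^sub>M M) SB" by simp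
    have "(\<lambda>p. x s (h (fst p)) u (snd p)) -` (A u \<inter> S) \<inter> space (B \<Otimes>\<^sub>M M) \<in> sets (B \<Otimes>\<^sub>M M)"
      by (rule measurable_sets[OF m]) (use A[OF u] S in \<open>simp add: sets_restrict_space_iff\<close>)
    also have "(\<lambda>p. x s (h (fst p)) u (snd p)) -` (A u \<inter> S) \<inter> space (B \<Otimes>\<^sub>M M) =
        {p \<in> space (B \<Otimes>\<^sub>M M). x s (h (fst p)) u (snd p) \<in> A u}"
      using measurable_space[OF m] by (auto simp: space_SB)
    finally show "{p \<in> space (B \<Otimes>\<^sub>M M). x s (h (fst p)) u (snd p) \<in> A u} \<in> sets (B \<Otimes>\<^sub>M M)" .
  qed
  also have "{p \<in> space (B \<Otimes>\<^sub>M M). \<forall>u\<in>J. x s (h (fst p)) u (snd p) \<in> A u} =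
      {(y, \<omega>). y \<in> space B \<and> \<omega> \<in> staying A s J (h y)}"
    by (auto simp: staying_def space_pair_measure)
  finally show ?thesis .
qed

lemma killed_kernel_measurable:
  fixes g :: "'a \<Rightarrow> real"
  assumes s: "0 \<le> s" and J: "finite J" "J \<subseteq> {s..r}" "s \<le> r" and A: "\<And>u. u \<in> J \<Longrightarrow> A u \<in> sets borel"
    and g: "g \<in> borel_measurable SB"
  shows "(\<lambda>y. \<integral>\<omega>. indicator (staying A s J y) \<omega> * g (x s y r \<omega>) \<partial>M) \<in> borel_measurable N"
proof -
  have "{(y, \<omega>). y \<in> space N \<and> \<omega> \<in> staying A s J y} \<in> sets (N \<Otimes>\<^sub>M M)"
    by (rule staying_pair_measurable[OF s countable_finite[OF J(1)] _ A N_id]) (use J in auto)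
  then have 1: "(\<lambda>p. indicator {(y, \<omega>). y \<in> space N \<and> \<omega> \<in> staying A s J y} p :: real) \<in> borel_measurable (N \<Otimes>\<^sub>M M)"
    by simp
  have "(\<lambda>p. (fst p, snd p)) \<in> measurable (N \<Otimes>\<^sub>M M) (SB \<Otimes>\<^sub>M M)"
    by (intro measurable_Pair measurable_snd measurable_compose[OF measurable_fst N_id])
  from measurable_compose[OF measurable_compose[OF this x_measurable_M[OF s J(3)]] g]
  have 2: "(\<lambda>p. g (x s (fst p) r (snd p))) \<in> borel_measurable (N \<Otimes>\<^sub>M M)" by (simp add: case_prod_beta')
  have "(\<lambda>p. indicator {(y, \<omega>). y \<in> space N \<and> \<omega> \<in> staying A s J y} p * g (x s (fst p) r (snd p)))
      \<in> borel_measurable (N \<Otimes>\<^sub>M M)" by (intro borel_measurable_times 1 2)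
  then have "(\<lambda>(y, \<omega>). indicator {(y, \<omega>). y \<in> space N \<and> \<omega> \<in> staying A s J y} (y, \<omega>) * g (x s y r \<omega>))
      \<in> borel_measurable (N \<Otimes>\<^sub>M M)" by (simp add: case_prod_beta')
  then have "(\<lambda>y. \<integral>\<omega>. indicator {(y, \<omega>). y \<in> space N \<and> \<omega> \<in> staying A s J y} (y, \<omega>) * g (x s y r \<omega>) \<partial>M)
      \<in> borel_measurable N" by (rule borel_measurable_lebesgue_integral)
  then show ?thesis
    by (rule measurable_cong[THEN iffD1, rotated]) (simp add: indicator_def)
qed

text \<open>The induction removes the latest time and is carried by the arbitrary test function
  \<open>g\<close>: what happens at the last time is absorbed into a new nonnegative test function
  at the previous one, with the same bound \<open>B\<close>.\<close>

lemma killed_transfer_ge: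
  assumes s: "0 \<le> s" and f: "integrable N f"
    and A: "\<And>u. s \<le> u \<Longrightarrow> A u \<in> sets borel"
      "\<And>u z. s \<le> u \<Longrightarrow> z \<in> space N \<Longrightarrow> z \<in> A u \<longleftrightarrow> 0 \<le> transfer s u f z"
    and J: "finite J" "J \<subseteq> {s<..}"
    and g: "g \<in> borel_measurable SB" "\<And>z. z \<in> S \<Longrightarrow> 0 \<le> g z \<and> g z \<le> B"
  shows "(\<integral>z. g z * max 0 (transfer s (Max (insert s J)) f z) \<partial>N) \<le>
    (\<integral>y. max 0 (f y) * (\<integral>\<omega>. indicator (staying A s (insert s J) y) \<omega> * g (x s y (Max (insert s J)) \<omega>) \<partial>M) \<partial>N)"
  using J g
proof (induction J arbitrary: g rule: finite_linorder_max_induct)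
  case empty
  have "(\<integral>y. max 0 (f y) * (\<integral>\<omega>. indicator (staying A s {s} y) \<omega> * g (x s y s \<omega>) \<partial>M) \<partial>N) =
     (\<integral>z. g z * max 0 (transfer s s f z) \<partial>N)"
  proof (rule Bochner_Integration.integral_cong[OF refl])
    fix y assume y: "y \<in> space N"
    have "(\<integral>\<omega>. indicator (staying A s {s} y) \<omega> * g (x s y s \<omega>) \<partial>M) = (\<integral>\<omega>. indicator (A s) y * g y \<partial>M)"
      by (rule Bochner_Integration.integral_cong[OF refl])
        (simp add: staying_def x_init[OF s space_N[OF y]] indicator_def)
    also have "\<dots> = indicator (A s) y * g y" by (simp add: prob_space)
    finally show "max 0 (f y) * (\<integral>\<omega>. indicator (staying A s {s} y) \<omega> * g (x s y s \<omega>) \<partial>M)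
       = g y * max 0 (transfer s s f y)"
      using A(2)[OF order_refl y] by (auto simp: transfer_def indicator_def max_def)
  qed
  then show ?case by simp
next
  case (insert b J)
  let ?r = "Max (insert s J)"
  have J: "finite J" "J \<subseteq> {s<..}" "s < b" using insert by auto
  have sr: "s \<le> ?r" and rb: "?r < b" using J insert.hyps(2) by auto
  have b: "Max (insert s (insert b J)) = b" using J insert.hyps(2) by (intro Max_eqI) (auto intro: less_imp_le)
  have r0: "0 \<le> ?r" and rb': "?r \<le> b" and sb: "s \<le> b" using s sr rb by auto
  \<comment> \<open>Cutting \<open>g\<close> off outside the last sign set replaces the positive
    part of the transferred density by the density itself, which duality can handle.\<close>
  define k where "k z = indicator (A b) z * g z" for z
  have k: "k \<in> borel_measurable SB"
    unfolding k_def using A(1)[OF sb] insert.prems(2)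
    by (intro borel_measurable_times measurable_restrict_space1[OF borel_measurable_indicator])
  have B0: "0 \<le> g z" "g z \<le> B" if "z \<in> S" for z using insert.prems(3)[OF that] by auto
  have kb: "0 \<le> k z \<and> k z \<le> B" if "z \<in> S" for z
    using B0[OF that] by (auto simp: k_def indicator_def)
  let ?K = "kernel_op ?r b k"
  have K: "?K \<in> borel_measurable SB" by (rule kernel_op_measurable[OF r0 rb' k])
  have Kb: "0 \<le> ?K z \<and> ?K z \<le> B" if "z \<in> S" for z
    using kernel_op_bounds[OF r0 rb' that k kb] by blast
  have "(\<integral>z. g z * max 0 (transfer s b f z) \<partial>N) = (\<integral>z. k z * transfer s b f z \<partial>N)"
    by (rule Bochner_Integration.integral_cong[OF refl]) (use A(2)[OF sb] in \<open>auto simp: k_def indicator_def\<close>)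
  also have "\<dots> = (\<integral>y. f y * kernel_op s b k y \<partial>N)" by (rule transfer_dual(2)[OF s sb f k kb])
  also have "\<dots> = (\<integral>y. f y * kernel_op s ?r ?K y \<partial>N)"
  proof (rule Bochner_Integration.integral_cong[OF refl])
    fix y assume y: "y \<in> space N"
    have "kernel_op s b k y = (\<integral>\<omega>. indicator (space M) \<omega> * k (x s y b \<omega>) \<partial>M)"
      unfolding kernel_op_def by (rule Bochner_Integration.integral_cong) auto
    also have "\<dots> = (\<integral>\<omega>. indicator (space M) \<omega> * ?K (x s y ?r \<omega>) \<partial>M)"
      by (rule markov[OF s sr rb' space_N[OF y] _ k, of _ B])
        (use kb sets.top[of "F s ?r"] in \<open>auto simp: F_space\<close>)
    also have "\<dots> = kernel_op s ?r ?K y"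
      unfolding kernel_op_def[of s ?r] by (rule Bochner_Integration.integral_cong) auto
    finally show "f y * kernel_op s b k y = f y * kernel_op s ?r ?K y" by simp
  qed
  also have "\<dots> = (\<integral>z. ?K z * transfer s ?r f z \<partial>N)" by (rule transfer_dual(2)[symmetric, OF s sr f K Kb])
  \<comment> \<open>The negative part of the density at the previous time is discarded; this only
    increases the integral, since \<open>?K\<close> is nonnegative.\<close>
  also have "\<dots> \<le> (\<integral>z. ?K z * max 0 (transfer s ?r f z) \<partial>N)"
  proof (rule integral_mono)
    have i: "integrable N (\<lambda>z. ?K z * transfer s ?r f z)" by (rule transfer_dual(1)[OF s sr f K Kb])
    then show "integrable N (\<lambda>z. ?K z * transfer s ?r f z)" .
    have "integrable N (\<lambda>z. max 0 (?K z * transfer s ?r f z))" using i by simp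
    then show "integrable N (\<lambda>z. ?K z * max 0 (transfer s ?r f z))"
    proof (rule Bochner_Integration.integrable_cong[THEN iffD1, OF refl, rotated])
      fix z assume "z \<in> space N"
      from Kb[OF space_N[OF this]]
      show "max 0 (?K z * transfer s ?r f z) = ?K z * max 0 (transfer s ?r f z)"
        by (auto simp: max_def mult_le_0_iff zero_le_mult_iff)
    qed
    show "?K z * transfer s ?r f z \<le> ?K z * max 0 (transfer s ?r f z)" if "z \<in> space N" for z
      using Kb[OF space_N[OF that]] by (intro mult_left_mono) auto
  qed
  also have "\<dots> \<le> (\<integral>y. max 0 (f y) * (\<integral>\<omega>. indicator (staying A s (insert s J) y) \<omega> * ?K (x s y ?r \<omega>) \<partial>M) \<partial>N)"
    by (rule insert.IH[OF J(2) K Kb])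
  also have "\<dots> = (\<integral>y. max 0 (f y) * (\<integral>\<omega>. indicator (staying A s (insert s (insert b J)) y) \<omega> * g (x s y b \<omega>) \<partial>M) \<partial>N)"
  proof (rule Bochner_Integration.integral_cong[OF refl])
    fix y assume y: "y \<in> space N"
    \<comment> \<open>The event of having stayed so far belongs to the noise up to
      \<open>?r\<close>, so the Markov property can be used a second time, now to move the test
      function forward to \<open>b\<close>.\<close>
    have E: "staying A s (insert s J) y \<in> sets (F s ?r)"
      by (rule staying_measurable[OF s space_N[OF y]]) (use J A(1) in \<open>auto intro: less_imp_le\<close>)
    have "(\<integral>\<omega>. indicator (staying A s (insert s J) y) \<omega> * ?K (x s y ?r \<omega>) \<partial>M)
       = (\<integral>\<omega>. indicator (staying A s (insert s J) y) \<omega> * k (x s y b \<omega>) \<partial>M)"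
      by (rule markov[symmetric, OF s sr rb' space_N[OF y] E k, of B]) (use kb in auto)
    also have "\<dots> = (\<integral>\<omega>. indicator (staying A s (insert s (insert b J)) y) \<omega> * g (x s y b \<omega>) \<partial>M)"
      by (rule Bochner_Integration.integral_cong[OF refl]) (auto simp: staying_def k_def indicator_def)
    finally show "max 0 (f y) * (\<integral>\<omega>. indicator (staying A s (insert s J) y) \<omega> * ?K (x s y ?r \<omega>) \<partial>M)
       = max 0 (f y) * (\<integral>\<omega>. indicator (staying A s (insert s (insert b J)) y) \<omega> * g (x s y b \<omega>) \<partial>M)" by simp
  qed
  finally show ?case unfolding b .
qed

text \<open>Testing with the constant 1 shows that the transfer operator conserves mass, so the mean
  remains zero; then the absolute value is twice the positive part minus a function of integral
  zero.\<close>

lemma transfer_norm: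
  assumes t: "0 \<le> s" "s \<le> t" and f: "integrable N f" "(\<integral>y. f y \<partial>N) = 0"
  shows "(\<integral>z. \<bar>transfer s t f z\<bar> \<partial>N) = 2 * (\<integral>z. max 0 (transfer s t f z) \<partial>N)"
proof -
  have 1: "(\<lambda>z. 1) \<in> borel_measurable SB" "\<And>z. z \<in> S \<Longrightarrow> 0 \<le> (1::real) \<and> (1::real) \<le> 1" by auto
  have i: "integrable N (transfer s t f)" and "(\<integral>z. transfer s t f z \<partial>N) = (\<integral>y. f y \<partial>N)"
    using transfer_dual[OF t f(1) 1] by (simp_all add: kernel_op_def prob_space)
  then have 0: "(\<integral>z. transfer s t f z \<partial>N) = 0" using f(2) by simp
  have "(\<integral>z. \<bar>transfer s t f z\<bar> \<partial>N) = (\<integral>z. 2 * max 0 (transfer s t f z) - transfer s t f z \<partial>N)"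
    by (rule Bochner_Integration.integral_cong) auto
  also have "\<dots> = 2 * (\<integral>z. max 0 (transfer s t f z) \<partial>N)" using i 0 by simp
  finally show ?thesis .
qed

text \<open>The killed estimate with \<open>g\<close> equal to 1. The factor 2 comes from passing
  from the positive part to the norm, the factor \<open>C\<close> from bounding the positive part of
  \<open>f\<close>.\<close>

lemma staying_probability_ge:
  assumes t: "0 \<le> s" "s < t" and f: "integrable N f" "(\<integral>y. f y \<partial>N) = 0" "AE y in N. \<bar>f y\<bar> \<le> C" "C > 0"
    and A: "\<And>u. s \<le> u \<Longrightarrow> A u \<in> sets borel"
      "\<And>u z. s \<le> u \<Longrightarrow> z \<in> space N \<Longrightarrow> z \<in> A u \<longleftrightarrow> 0 \<le> transfer s u f z"
    and J: "finite J" "J \<subseteq> {s..t}" "s \<in> J" "t \<in> J"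
  shows "(\<integral>z. \<bar>transfer s t f z\<bar> \<partial>N) \<le> 2 * C * measure (N \<Otimes>\<^sub>M M) {(y, \<omega>). y \<in> space N \<and> \<omega> \<in> staying A s J y}"
proof -
  let ?E = "{(y, \<omega>). y \<in> space N \<and> \<omega> \<in> staying A s J y}"
  \<comment> \<open>The initial time is taken out because the killed estimate puts it back.\<close>
  define J' where "J' = J - {s}"
  have J': "finite J'" "J' \<subseteq> {s<..}" "insert s J' = J" using J by (auto simp: J'_def)
  have AJ: "A u \<in> sets borel" if "u \<in> J" for u using A(1) J(2) that by auto
  have Max: "Max J = t" using J by (intro Max_eqI) auto
  have 1: "(\<lambda>z. 1) \<in> borel_measurable SB" "\<And>z. z \<in> S \<Longrightarrow> 0 \<le> (1::real) \<and> (1::real) \<le> 1" by auto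
  have "(\<integral>z. max 0 (transfer s t f z) \<partial>N) \<le> (\<integral>y. max 0 (f y) * (\<integral>\<omega>. indicator (staying A s J y) \<omega> \<partial>M) \<partial>N)"
    using killed_transfer_ge[OF t(1) f(1) A J'(1,2) 1] unfolding J'(3) Max by simp
  also have "\<dots> \<le> (\<integral>y. C * (\<integral>\<omega>. indicator (staying A s J y) \<omega> \<partial>M) \<partial>N)"
  proof (rule integral_mono_AE')
    have m: "(\<lambda>y. \<integral>\<omega>. indicat_real (staying A s J y) \<omega> \<partial>M) \<in> borel_measurable N"
      using killed_kernel_measurable[where A = A and g = "\<lambda>_. 1", OF t(1) J(1,2) less_imp_le[OF t(2)] AJ borel_measurable_const]
      by (simp only: mult_1_right)
    show "integrable N (\<lambda>y. C * (\<integral>\<omega>. indicator (staying A s J y) \<omega> \<partial>M))"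
      by (intro integrable_mult_right N.integrable_const_bound[of _ 1] m) simp
    show "AE y in N. max 0 (f y) * (\<integral>\<omega>. indicator (staying A s J y) \<omega> \<partial>M)
        \<le> C * (\<integral>\<omega>. indicator (staying A s J y) \<omega> \<partial>M)"
      using f(3) by eventually_elim (use f(4) in \<open>auto intro!: mult_right_mono\<close>)
    show "AE y in N. 0 \<le> C * (\<integral>\<omega>. indicator (staying A s J y) \<omega> \<partial>M)" using f(4) by simp
  qed
  also have "\<dots> = C * measure (N \<Otimes>\<^sub>M M) ?E"
  proof -
    interpret P: pair_sigma_finite N M ..
    interpret P: finite_measure "N \<Otimes>\<^sub>M M" by (intro finite_measure_pair_measure) unfold_locales
    have E: "?E \<in> sets (N \<Otimes>\<^sub>M M)"
      by (rule staying_pair_measurable[OF t(1) countable_finite[OF J(1)] _ _ N_id]) (use J A(1) in auto)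
    have "measure (N \<Otimes>\<^sub>M M) ?E = (\<integral>p. indicator ?E p \<partial>(N \<Otimes>\<^sub>M M))" using E by simp
    also have "\<dots> = (\<integral>y. \<integral>\<omega>. indicator ?E (y, \<omega>) \<partial>M \<partial>N)"
      by (rule P.integral_fst'[symmetric]) (use E in \<open>simp add: P.emeasure_eq_measure\<close>)
    also have "\<dots> = (\<integral>y. \<integral>\<omega>. indicator (staying A s J y) \<omega> \<partial>M \<partial>N)"
      by (intro Bochner_Integration.integral_cong refl) (auto simp: indicator_def)
    finally show ?thesis by simp
  qed
  finally show ?thesis using transfer_norm[OF t(1) less_imp_le[OF t(2)] f(1,2)] by simp
qed

lemma staying_probability_ge_countable:
  assumes t: "0 \<le> s" "s < t" and f: "integrable N f" "(\<integral>y. f y \<partial>N) = 0" "AE y in N. \<bar>f y\<bar> \<le> C" "C > 0"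
    and A: "\<And>u. s \<le> u \<Longrightarrow> A u \<in> sets borel"
      "\<And>u z. s \<le> u \<Longrightarrow> z \<in> space N \<Longrightarrow> z \<in> A u \<longleftrightarrow> 0 \<le> transfer s u f z"
    and J: "countable J" "J \<subseteq> {s..t}" "s \<in> J" "t \<in> J"
  shows "(\<integral>z. \<bar>transfer s t f z\<bar> \<partial>N) \<le> 2 * C * measure (N \<Otimes>\<^sub>M M) {(y, \<omega>). y \<in> space N \<and> \<omega> \<in> staying A s J y}"
proof -
  interpret P: finite_measure "N \<Otimes>\<^sub>M M" by (intro finite_measure_pair_measure) unfold_locales
  let ?E = "\<lambda>J. {(y, \<omega>). y \<in> space N \<and> \<omega> \<in> staying A s J y}"
  \<comment> \<open>Both end points stay in every finite set, so the finite estimate holds at the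
    same \<open>t\<close> for all \<open>n\<close>; the events decrease to the one for
    \<open>J\<close>.\<close>
  define Jn where "Jn n = {s, t} \<union> from_nat_into J ` {..n}" for n :: nat
  have Jn: "finite (Jn n)" "Jn n \<subseteq> {s..t}" "s \<in> Jn n" "t \<in> Jn n" for n
    using J t from_nat_into[of J] by (auto simp: Jn_def)
  have un: "(\<Union>n. Jn n) = J"
  proof -
    have "J \<noteq> {}" using J by auto
    then have "range (from_nat_into J) = J" using J(1) by (rule range_from_nat_into)
    then show ?thesis using J(3,4) unfolding Jn_def by blast
  qed
  have "(\<lambda>n. measure (N \<Otimes>\<^sub>M M) (?E (Jn n))) \<longlonglongrightarrow> measure (N \<Otimes>\<^sub>M M) (\<Inter>n. ?E (Jn n))"
  proof (rule P.finite_Lim_measure_decseq)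
    show "range (\<lambda>n. ?E (Jn n)) \<subseteq> sets (N \<Otimes>\<^sub>M M)"
    proof safe
      fix n
      show "?E (Jn n) \<in> sets (N \<Otimes>\<^sub>M M)"
        by (rule staying_pair_measurable[OF t(1) countable_finite[OF Jn(1)] _ _ N_id]) (use Jn(2)[of n] A(1) in fastforce)+
    qed
    show "decseq (\<lambda>n. ?E (Jn n))"
      unfolding decseq_def staying_def Jn_def by fastforce
  qed
  moreover have "(\<Inter>n. ?E (Jn n)) = ?E J"
    unfolding un[symmetric] by (auto simp: staying_def)
  ultimately have "(\<lambda>n. 2 * C * measure (N \<Otimes>\<^sub>M M) (?E (Jn n))) \<longlonglongrightarrow> 2 * C * measure (N \<Otimes>\<^sub>M M) (?E J)"
    by (auto intro: tendsto_intros)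
  then show ?thesis
    by (rule LIMSEQ_le_const) (use staying_probability_ge[OF t f A Jn] in blast)
qed

end

section \<open>Escape rate\<close>

lemma hausdorff_dist_self: "hausdorff_dist A A = 0"
proof -
  have 1: "(INF b\<in>A. ennreal (dist a b)) \<le> 0" if "a \<in> A" for a
    by (rule INF_lower2[OF that]) simp
  have 2: "(INF a\<in>A. ennreal (dist a b)) \<le> 0" if "b \<in> A" for b
    by (rule INF_lower2[OF that]) simp
  show ?thesis unfolding hausdorff_dist_def using 1 2
    by (auto intro!: antisym SUP_least simp: max_def)
qed

text \<open>If \<open>A\<close> were empty, the infimum over it would be infinite, so the strict
  bound also supplies a point of \<open>A\<close>.\<close>

lemma hausdorff_dist_approach:
  assumes "hausdorff_dist A B < ennreal e" "b \<in> B"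
  shows "\<exists>a\<in>A. dist a b < e"
proof -
  have "(INF a\<in>A. ennreal (dist a b)) \<le> hausdorff_dist A B"
    unfolding hausdorff_dist_def by (rule max.coboundedI2) (rule SUP_upper[OF assms(2)])
  then have "(INF a\<in>A. ennreal (dist a b)) < ennreal e" using assms(1) by simp
  then obtain a where "a \<in> A" "ennreal (dist a b) < ennreal e" unfolding INF_less_iff by blast
  then show ?thesis by (auto simp: ennreal_less_iff)
qed

text \<open>At a nearby time \<open>u\<close> on the good side, \<open>y u\<close> lies in
  \<open>A u\<close>, hence close to \<open>A r\<close>, and by continuity also close to
  \<open>y r\<close>. Closedness of \<open>A r\<close> finishes. The set \<open>T\<close> encodes
  the side, so one proof covers both.\<close>

lemma in_set_if_approached:
  fixes y :: "real \<Rightarrow> 'a::metric_space"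
  assumes cl: "closed (A r)" and y: "continuous_on {s..} y" and r: "s \<le> r"
    and T: "continuous (at 0 within T) (\<lambda>\<sigma>. hausdorff_dist (A r) (A (r + \<sigma>)))"
    and D: "\<And>d. d > 0 \<Longrightarrow> \<exists>u\<in>D. s \<le> u \<and> u \<noteq> r \<and> \<bar>u - r\<bar> < d \<and> u - r \<in> T"
    and yD: "\<And>u. u \<in> D \<Longrightarrow> y u \<in> A u"
  shows "y r \<in> A r"
proof -
  have "y r \<in> closure (A r)"
    unfolding closure_approachable
  proof (intro allI impI)
    fix e :: real assume e: "0 < e"
    have "((\<lambda>\<sigma>. hausdorff_dist (A r) (A (r + \<sigma>))) \<longlongrightarrow> 0) (at 0 within T)"
      using T by (simp add: continuous_within hausdorff_dist_self)
    then have "\<forall>\<^sub>F \<sigma> in at 0 within T. hausdorff_dist (A r) (A (r + \<sigma>)) < ennreal (e / 2)"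
      by (rule order_tendstoD) (use e in simp)
    then obtain d where d: "d > 0"
      "\<And>\<sigma>. \<sigma> \<in> T \<Longrightarrow> \<sigma> \<noteq> 0 \<Longrightarrow> \<bar>\<sigma>\<bar> < d \<Longrightarrow> hausdorff_dist (A r) (A (r + \<sigma>)) < ennreal (e / 2)"
      unfolding eventually_at by (auto simp: dist_real_def)
    obtain d' where d': "d' > 0" "\<And>u. s \<le> u \<Longrightarrow> dist u r < d' \<Longrightarrow> dist (y u) (y r) < e / 2"
      using y[unfolded continuous_on_iff, rule_format, of r "e / 2"] r e by auto
    obtain u where u: "u \<in> D" "s \<le> u" "u \<noteq> r" "\<bar>u - r\<bar> < min d d'" "u - r \<in> T"
      using D[of "min d d'"] d(1) d'(1) by auto
    have "hausdorff_dist (A r) (A u) < ennreal (e / 2)"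
      using d(2)[of "u - r"] u by simp
    then obtain a where a: "a \<in> A r" "dist a (y u) < e / 2"
      using hausdorff_dist_approach yD[OF u(1)] by blast
    have "dist (y u) (y r) < e / 2" using d'(2)[of u] u by (simp add: dist_real_def)
    then have "dist a (y r) < e" using a(2) dist_triangle[of a "y r" "y u"] by linarith
    then show "\<exists>a\<in>A r. dist a (y r) < e" using a(1) by blast
  qed
  then show ?thesis using cl by simp
qed

text \<open>Endpoints are included because one of the one-sided limits is void there.\<close>

definition rational_times :: "real \<Rightarrow> real \<Rightarrow> real set" where
  "rational_times s t = {s, t} \<union> (\<rat> \<inter> {s..t})"

lemma countable_rational_times: "countable (rational_times s t)"
  unfolding rational_times_def by (intro countable_Un countable_Int1 countable_rat) auto

text \<open>A time strictly between \<open>s\<close> and \<open>t\<close> is a limit of rational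
  times of the interval from either side, so it does not matter which side the hypothesis
  provides.\<close>

lemma sufficiently_nice_path:
  fixes y :: "real \<Rightarrow> 'a::metric_space"
  assumes nice: "sufficiently_nice {s..} A" and y: "continuous_on {s..} y"
    and D: "\<And>u. u \<in> rational_times s t \<Longrightarrow> y u \<in> A u" and r: "r \<in> {s..t}"
  shows "y r \<in> A r"
proof (cases "r \<in> {s, t}")
  case True
  then show ?thesis using D by (auto simp: rational_times_def)
next
  case False
  then have sr: "s < r" "r < t" using r by auto
  have cl: "closed (A r)" using nice r by (auto simp: sufficiently_nice_def)
  have mem: "u \<in> rational_times s t" if "u \<in> \<rat>" "s \<le> u" "u \<le> t" for u
    using that by (simp add: rational_times_def)
  from nice r consider
      "continuous (at 0 within {\<sigma>. \<sigma> \<le> 0 \<and> r + \<sigma> \<in> {s..}}) (\<lambda>\<sigma>. hausdorff_dist (A r) (A (r + \<sigma>)))"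
    | "continuous (at 0 within {\<sigma>. \<sigma> \<ge> 0 \<and> r + \<sigma> \<in> {s..}}) (\<lambda>\<sigma>. hausdorff_dist (A r) (A (r + \<sigma>)))"
    unfolding sufficiently_nice_def by auto
  then show ?thesis
  proof cases
    case 1
    show ?thesis
    proof (rule in_set_if_approached[OF cl y _ 1 _ D])
      fix d :: real assume "d > 0"
      then obtain u where "u \<in> \<rat>" "max s (r - d) < u" "u < r"
        using Rats_dense_in_real[of "max s (r - d)" r] sr by auto
      then show "\<exists>u\<in>rational_times s t. s \<le> u \<and> u \<noteq> r \<and> \<bar>u - r\<bar> < d \<and> u - r \<in> {\<sigma>. \<sigma> \<le> 0 \<and> r + \<sigma> \<in> {s..}}"
        using sr by (intro bexI[of _ u] mem) auto
    qed (use sr in auto)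
  next
    case 2
    show ?thesis
    proof (rule in_set_if_approached[OF cl y _ 2 _ D])
      fix d :: real assume "d > 0"
      then obtain u where "u \<in> \<rat>" "r < u" "u < min t (r + d)"
        using Rats_dense_in_real[of r "min t (r + d)"] sr by auto
      then show "\<exists>u\<in>rational_times s t. s \<le> u \<and> u \<noteq> r \<and> \<bar>u - r\<bar> < d \<and> u - r \<in> {\<sigma>. \<sigma> \<ge> 0 \<and> r + \<sigma> \<in> {s..}}"
        using sr by (intro bexI[of _ u] mem) auto
    qed (use sr in auto)
  qed
qed

text \<open>After division by \<open>t - s\<close> the constant contributes
  \<open>ln c / (t - s)\<close>, which is eventually at most any \<open>e > 0\<close>. Where
  \<open>I t\<close> vanishes the left side is minus infinity.\<close>

lemma Limsup_ext_ln_mono: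
  fixes I P :: "real \<Rightarrow> real"
  assumes c: "c > 0" and I: "\<And>t. t > s \<Longrightarrow> 0 \<le> I t" and IP: "\<And>t. t > s \<Longrightarrow> I t \<le> c * P t"
  shows "Limsup at_top (\<lambda>t. ereal (1 / (t - s)) * ext_ln (I t)) \<le>
    Limsup at_top (\<lambda>t. ereal (1 / (t - s)) * ext_ln (P t))"
proof (rule ereal_le_epsilon2)
  fix e :: real assume e: "0 < e"
  \<comment> \<open>The threshold \<open>s + \<bar>ln c\<bar> / e\<close> is the time after which
    the contribution of the constant is below \<open>e\<close>.\<close>
  have "\<forall>\<^sub>F t in at_top. ereal (1 / (t - s)) * ext_ln (I t) \<le> ereal (1 / (t - s)) * ext_ln (P t) + ereal e"
    using eventually_gt_at_top[of "s + \<bar>ln c\<bar> / e"] eventually_gt_at_top[of s]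
  proof eventually_elim
    case (elim t)
    show ?case
    proof (cases "I t = 0")
      case True
      then show ?thesis using elim by (simp add: ext_ln_def)
    next
      case False
      then have Ipos: "I t > 0" using I[of t] elim by simp
      then have "c * P t > 0" using IP[of t] elim by simp
      then have P: "P t > 0" using c by (simp add: zero_less_mult_iff)
      have "ln (I t) \<le> ln (c * P t)" using Ipos IP[of t] elim by (intro ln_mono) auto
      also have "\<dots> = ln c + ln (P t)" using c P by (simp add: ln_mult)
      finally have "ln (I t) / (t - s) \<le> (ln c + ln (P t)) / (t - s)"
        using elim by (intro divide_right_mono) auto
      also have "\<dots> = ln c / (t - s) + ln (P t) / (t - s)" by (rule add_divide_distrib)
      also have "ln c / (t - s) \<le> e"
      proof -
        have "\<bar>ln c\<bar> / e < t - s" using elim(1) by linarith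
        then have "\<bar>ln c\<bar> < (t - s) * e" using e by (simp add: pos_divide_less_eq)
        then have "ln c \<le> e * (t - s)" using abs_ge_self[of "ln c"] by (simp only: mult.commute)
        then show ?thesis using elim(2) by (simp add: pos_divide_le_eq)
      qed
      finally have "ln (I t) / (t - s) \<le> ln (P t) / (t - s) + e" by simp
      then show ?thesis using Ipos P by (simp add: ext_ln_def)
    qed
  qed
  then have "Limsup at_top (\<lambda>t. ereal (1 / (t - s)) * ext_ln (I t)) \<le>
      Limsup at_top (\<lambda>t. ereal (1 / (t - s)) * ext_ln (P t) + ereal e)" by (rule Limsup_mono)
  also have "\<dots> = Limsup at_top (\<lambda>t. ereal (1 / (t - s)) * ext_ln (P t)) + ereal e"
    by (rule Limsup_add_ereal_right) auto
  finally show "Limsup at_top (\<lambda>t. ereal (1 / (t - s)) * ext_ln (I t)) \<le>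
      Limsup at_top (\<lambda>t. ereal (1 / (t - s)) * ext_ln (P t)) + ereal e" .
qed

section \<open>The reflected diffusion as a flow, and the normalization of the initial law\<close>

lemma nn_integral_lebesgue_on:
  fixes X :: "'a::euclidean_space set"
  assumes "open X"
  shows "(\<integral>\<^sup>+z. f z \<partial>lebesgue_on X) = (\<integral>\<^sup>+z. f z * indicator X z \<partial>lborel)"
  using assms by (simp add: nn_integral_restrict_space nn_integral_completion)

lemma borel_measurable_lebesgue_on_id: "(\<lambda>y. y) \<in> borel_measurable (lebesgue_on X)"
  by (rule measurable_restrict_space1[OF measurable_completion]) simp

lemma id_measurable_lebesgue_on:
  "(\<lambda>y. y) \<in> measurable (lebesgue_on X) (restrict_space borel (closure X))"
  by (rule measurable_restrict_space2[OF _ borel_measurable_lebesgue_on_id])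
    (auto simp: space_restrict_space intro: subsetD[OF closure_subset])

text \<open>The flow property is where uniqueness enters: the path started at \<open>s\<close> and
  the path restarted at \<open>r\<close> from its current position both solve the Skorokhod problem
  from time \<open>r\<close>, with the same noise and the same initial point.\<close>

lemma reflected_sde_flow:
  fixes X :: "(real^'d) set"
  assumes X: "open X" "uniformly_regular 4 X" "bounded X" and v: "C1_field X v"
    and W: "wiener_process M w" and x: "reflected_sde_solution X v \<epsilon> M w x"
    and q: "transition_density X M x q"
  shows "stochastic_flow_density M (closure X) (increment_algebra M w) x (lebesgue_on X) q"
proof -
  have w: "\<And>t. t \<ge> 0 \<Longrightarrow> w t \<in> borel_measurable M" and ps: "prob_space M"
    using W by (simp_all add: wiener_process_def)
  have path: "x s y s \<omega> = y" "reflected_path X v \<epsilon> s (\<lambda>t. w t \<omega>) (\<lambda>t. x s y t \<omega>)"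
    if "0 \<le> s" "y \<in> closure X" "\<omega> \<in> space M" for s y \<omega>
    using x that unfolding reflected_sde_solution_def by blast+
  have x_in: "x s y t \<omega> \<in> closure X" if "0 \<le> s" "s \<le> t" "y \<in> closure X" "\<omega> \<in> space M" for s t y \<omega>
    using path(2)[OF that(1,3,4)] that(2) unfolding reflected_path_def by blast
  interpret prob_space M by (rule ps)
  show ?thesis
  proof (intro stochastic_flow_density.intro stochastic_flow.intro stochastic_flow_axioms.intro
      stochastic_flow_density_axioms.intro ps)
    show "closure X \<in> sets borel" by simp
    show "space (increment_algebra M w s t) = space M" for s t by (rule sets_increment_algebra(2))
    show "sets (increment_algebra M w s t) \<subseteq> events" if "0 \<le> s" for s t
      by (rule increment_algebra_events[OF w that])
    show "sets (increment_algebra M w s t) \<subseteq> sets (increment_algebra M w s t')" if "t \<le> t'" for s t t'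
      by (rule increment_algebra_mono[OF that])
    show "indep_set (sets (increment_algebra M w s r)) (sets (increment_algebra M w r t))"
      if "0 \<le> s" "s \<le> r" for s r t by (rule increment_algebra_indep[OF W that])
    show "(\<lambda>(y, \<omega>). x s y t \<omega>) \<in> borel_measurable (restrict_space borel (closure X) \<Otimes>\<^sub>M increment_algebra M w s t)"
      if "0 \<le> s" "s \<le> t" for s t using x that unfolding reflected_sde_solution_def by blast
    show "x s y t \<omega> = x r (x s y r \<omega>) t \<omega>"
      if t: "0 \<le> s" "s \<le> r" "r \<le> t" and y: "y \<in> closure X" and \<omega>: "\<omega> \<in> space M" for s r t y \<omega>
    proof -
      have r: "0 \<le> r" using t by simp
      have z: "x s y r \<omega> \<in> closure X" by (rule x_in[OF t(1,2) y \<omega>])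
      show ?thesis
        by (rule reflected_path_unique[OF X(1,2) v r
            reflected_path_restrict[OF X(1,2) v t(1) path(2)[OF t(1) y \<omega>] t(2)] path(2)[OF r z \<omega>] _ t(3)])
          (simp add: path(1)[OF r z \<omega>])
    qed
    show "finite_measure (lebesgue_on X)"
      by (intro finite_measure_lebesgue_on lmeasurable_open X)
    show "(\<lambda>y. y) \<in> measurable (lebesgue_on X) (restrict_space borel (closure X))"
      by (rule id_measurable_lebesgue_on)
    fix s t :: real assume t: "0 \<le> s" "s < t"
    have qm: "(\<lambda>(y, z). q s t y z) \<in>
        borel_measurable (restrict_space borel (closure X) \<Otimes>\<^sub>M restrict_space borel (closure X))"
      using q t unfolding transition_density_def by blast
    have "(\<lambda>p. (fst p, snd p)) \<in> measurable (lebesgue_on X \<Otimes>\<^sub>M lebesgue_on X)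
        (restrict_space borel (closure X) \<Otimes>\<^sub>M restrict_space borel (closure X))"
      by (intro measurable_Pair measurable_compose[OF measurable_fst id_measurable_lebesgue_on]
        measurable_compose[OF measurable_snd id_measurable_lebesgue_on])
    from measurable_compose[OF this qm]
    show "(\<lambda>(y, z). q s t y z) \<in> borel_measurable (lebesgue_on X \<Otimes>\<^sub>M lebesgue_on X)"
      by (simp add: case_prod_beta')
    fix y assume "y \<in> space (lebesgue_on X)"
    then have y: "y \<in> closure X" using closure_subset by (auto simp: space_restrict_space)
    show "0 \<le> q s t y z" if "z \<in> space (lebesgue_on X)" for z
    proof -
      have "z \<in> closure X" using that closure_subset by (auto simp: space_restrict_space)
      then show ?thesis using q t y unfolding transition_density_def by blast
    qed
    fix A :: "(real^'d) set" assume A: "A \<in> sets borel"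
    have "emeasure M {\<omega>\<in>space M. x s y t \<omega> \<in> A} = (\<integral>\<^sup>+z \<in> A \<inter> X. ennreal (q s t y z) \<partial>lborel)"
      using q t y A unfolding transition_density_def by blast
    also have "\<dots> = (\<integral>\<^sup>+z. ennreal (q s t y z) * indicator A z \<partial>lebesgue_on X)"
      unfolding nn_integral_lebesgue_on[OF X(1)]
      by (rule nn_integral_cong) (simp add: indicator_def)
    finally show "emeasure M {\<omega>\<in>space M. x s y t \<omega> \<in> A} = (\<integral>\<^sup>+z. ennreal (q s t y z) * indicator A z \<partial>lebesgue_on X)" .
  qed (use path(1) x_in in auto)
qed

text \<open>The transfer operators use Lebesgue measure on \<open>X\<close> with its completed
  algebra, the escape rate the normalized measure on Borel sets. On product-measurable events over
  \<open>X\<close> the two differ by the volume of \<open>X\<close>, which is finite and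
  positive.\<close>

lemma measure_uniform_pair:
  fixes X :: "'a::euclidean_space set"
  assumes M: "prob_space M" and X: "open X" "bounded X" "X \<noteq> {}"
    and E: "E \<in> sets (borel \<Otimes>\<^sub>M M)" "E \<subseteq> X \<times> space M"
  shows "measure (lebesgue_on X \<Otimes>\<^sub>M M) E = measure lborel X * measure (uniform_measure lborel X \<Otimes>\<^sub>M M) E"
proof -
  interpret prob_space M by fact
  have fin: "emeasure lborel X < \<infinity>" by (rule emeasure_bounded_finite[OF X(2)])
  have pos: "emeasure lborel X \<noteq> 0"
    using X open_not_negligible[of X] by (auto simp: negligible_iff_emeasure0)
  have EU: "E \<in> sets (uniform_measure lborel X \<Otimes>\<^sub>M M)"
    using E(1) by (simp cong: sets_pair_measure_cong)
  have EN: "E \<in> sets (lebesgue_on X \<Otimes>\<^sub>M M)"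
  proof -
    have "(\<lambda>p. (fst p, snd p)) \<in> measurable (lebesgue_on X \<Otimes>\<^sub>M M) (borel \<Otimes>\<^sub>M M)"
      by (intro measurable_Pair measurable_snd measurable_compose[OF measurable_fst
        borel_measurable_lebesgue_on_id])
    from measurable_sets[OF this E(1)] have "E \<inter> space (lebesgue_on X \<Otimes>\<^sub>M M) \<in> sets (lebesgue_on X \<Otimes>\<^sub>M M)"
      by (simp add: vimage_def)
    moreover have "E \<inter> space (lebesgue_on X \<Otimes>\<^sub>M M) = E"
      using E(2) by (auto simp: space_pair_measure space_restrict_space)
    ultimately show ?thesis by simp
  qed
  define g where "g y = emeasure M (Pair y -` E)" for y
  have gm: "g \<in> borel_measurable lborel"
    unfolding g_def using measurable_emeasure_Pair[of E lborel] E(1) by (simp cong: sets_pair_measure_cong)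
  have "emeasure (lebesgue_on X \<Otimes>\<^sub>M M) E = (\<integral>\<^sup>+y. g y * indicator X y \<partial>lborel)"
    unfolding emeasure_pair_measure_alt[OF EN] g_def nn_integral_lebesgue_on[OF X(1)] ..
  moreover have "emeasure (uniform_measure lborel X \<Otimes>\<^sub>M M) E = (\<integral>\<^sup>+y. g y * indicator X y \<partial>lborel) / emeasure lborel X"
    unfolding emeasure_pair_measure_alt[OF EU] g_def[symmetric]
    by (rule nn_integral_uniform_measure) (use gm X in auto)
  ultimately have "emeasure (lebesgue_on X \<Otimes>\<^sub>M M) E = emeasure lborel X * emeasure (uniform_measure lborel X \<Otimes>\<^sub>M M) E"
    using fin pos ennreal_mult_divide_eq[of "emeasure lborel X" "\<integral>\<^sup>+y. g y * indicator X y \<partial>lborel"]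
    by (simp add: ennreal_times_divide mult.commute)
  then show ?thesis by (simp add: measure_def enn2real_mult)
qed

text \<open>By linearity the sign moves into the initial density, so one argument, applied to \<eta>
  times \<open>f\<close>, covers both families.\<close>

lemma sign_set_eq:
  "sign_set X q s f \<eta> r = {z \<in> closure X. 0 \<le> transfer_op X q s r (\<lambda>y. \<eta> * f y) z}"
proof -
  have "transfer_op X q s r (\<lambda>y. \<eta> * f y) z = \<eta> * transfer_op X q s r f z" for z
    by (simp add: transfer_op_def mult.left_commute)
  then show ?thesis by (simp add: sign_set_def)
qed

theorem theorem19:
  fixes X :: "(real^'d) set"
    and v :: "real \<Rightarrow> real^'d \<Rightarrow> real^'d"
    and \<epsilon> s \<eta> :: real
    and M :: "'w measure"
    and w :: "real \<Rightarrow> 'w \<Rightarrow> real^'d"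
    and x :: "real \<Rightarrow> real^'d \<Rightarrow> real \<Rightarrow> 'w \<Rightarrow> real^'d"
    and q :: "real \<Rightarrow> real \<Rightarrow> real^'d \<Rightarrow> real^'d \<Rightarrow> real"
    and f :: "real^'d \<Rightarrow> real"
  assumes "open X" and "connected X" and "X \<noteq> {}" and "bounded X"
    and "uniformly_regular 4 X"
    and "C1_field X v" and "divergence_free X v" and "tangential X v"
    and "\<epsilon> > 0"
    and "wiener_process M w"
    and "reflected_sde_solution X v \<epsilon> M w x"
    and "transition_density X M x q"
    and "s \<ge> 0"
    and "integrable (lebesgue_on X) f"
    and "\<exists>C. AE y in lebesgue_on X. \<bar>f y\<bar> \<le> C"
    and "(LINT y | lebesgue_on X. f y) = 0"
    and "\<eta> = 1 \<or> \<eta> = -1"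
    and "sufficiently_nice {s..} (sign_set X q s f \<eta>)"
  shows "escape_rate X M x s (sign_set X q s f \<eta>) \<le> - lyapunov_exponent X q s f"
proof -
  let ?N = "lebesgue_on X"
  interpret stochastic_flow_density M "closure X" "increment_algebra M w" x ?N q
    by (rule reflected_sde_flow) fact+
  have transfer: "transfer s t g = transfer_op X q s t g" for t g
    by (simp add: fun_eq_iff transfer_def transfer_op_def)
  define A where "A = sign_set X q s f \<eta>"
  define f' where "f' = (\<lambda>y. \<eta> * f y)"
  obtain C0 where C0: "AE y in ?N. \<bar>f y\<bar> \<le> C0" using assms(15) by blast
  \<comment> \<open>The maximum with 1 makes the bound positive, as the constant inside the
    logarithm has to be.\<close>
  define C where "C = max C0 1"
  have \<eta>: "\<bar>\<eta>\<bar> = 1" using assms(17) by auto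
  have f': "integrable ?N f'" "(\<integral>y. f' y \<partial>?N) = 0" "AE y in ?N. \<bar>f' y\<bar> \<le> C" and C: "C > 0"
    using assms(14,16) \<eta> C0 by (auto simp: f'_def C_def abs_mult)
  have A: "A r = {z \<in> closure X. 0 \<le> transfer s r f' z}" for r
    unfolding A_def sign_set_eq transfer f'_def ..
  have A_closed: "closed (A r)" if "s \<le> r" for r
    using assms(18) that unfolding A_def sufficiently_nice_def by simp
  have A_borel: "A r \<in> sets borel" if "s \<le> r" for r
    by (rule borel_closed[OF A_closed[OF that]])
  have A_iff: "z \<in> A r \<longleftrightarrow> 0 \<le> transfer s r f' z" if "s \<le> r" "z \<in> space ?N" for r z
    using space_N[OF that(2)] by (simp add: A)
  obtain y0 where y0: "y0 \<in> closure X" using \<open>X \<noteq> {}\<close> closure_subset by blast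
  \<comment> \<open>The uniform law lives on the Borel space of the whole of space, while the flow
    starts only in the closure of \<open>X\<close>. Stray starting points are sent to
    \<open>y0\<close>; intersecting with \<open>X\<close> removes them again.\<close>
  define h where "h y = (if y \<in> closure X then y else y0)" for y
  have h: "h \<in> measurable borel (restrict_space borel (closure X))"
    unfolding h_def by (rule measurable_restrict_space2) (use y0 in \<open>auto intro!: measurable_If_set\<close>)
  let ?U = "uniform_measure lborel X"
  let ?P = "\<lambda>t. measure (?U \<Otimes>\<^sub>M M) {(y, \<omega>). y \<in> X \<and> \<omega> \<in> space M \<and> (\<forall>r\<in>{s..t}. x s y r \<omega> \<in> A r)}"
  let ?I = "\<lambda>t. LINT z | ?N. \<bar>transfer_op X q s t f z\<bar>"
  have I_le: "?I t \<le> (2 * C * measure lborel X) * ?P t" if t: "s < t" for t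
  proof -
    let ?J = "rational_times s t"
    let ?E = "{(y, \<omega>). y \<in> space ?N \<and> \<omega> \<in> staying A s ?J y}"
    have J: "?J \<subseteq> {s..t}" "s \<in> ?J" "t \<in> ?J" using t by (auto simp: rational_times_def)
    \<comment> \<open>The staying event over all times equals the one over countably many times;
      this gives its measurability together with the estimate.\<close>
    have E: "?E = {(y, \<omega>). y \<in> X \<and> \<omega> \<in> space M \<and> (\<forall>r\<in>{s..t}. x s y r \<omega> \<in> A r)}"
    proof -
      have "(\<forall>r\<in>?J. x s y r \<omega> \<in> A r) \<longleftrightarrow> (\<forall>r\<in>{s..t}. x s y r \<omega> \<in> A r)"
        if "y \<in> X" "\<omega> \<in> space M" for y \<omega>
      proof
        have "y \<in> closure X" using that(1) closure_subset by blast
        then have y: "continuous_on {s..} (\<lambda>t. x s y t \<omega>)"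
          using assms(11,13) that(2) unfolding reflected_sde_solution_def reflected_path_def by blast
        assume "\<forall>r\<in>?J. x s y r \<omega> \<in> A r"
        then show "\<forall>r\<in>{s..t}. x s y r \<omega> \<in> A r"
          using sufficiently_nice_path[OF assms(18)[folded A_def] y] by blast
      qed (use J in blast)
      then show ?thesis by (auto simp: staying_def space_restrict_space)
    qed
    have "?E = {(y, \<omega>). y \<in> space borel \<and> \<omega> \<in> staying A s ?J (h y)} \<inter> X \<times> space M"
      using closure_subset[of X] by (auto simp: staying_def h_def space_restrict_space)
    moreover have "\<dots> \<in> sets (borel \<Otimes>\<^sub>M M)"
      using \<open>open X\<close> J(1) A_borel
      by (intro sets.Int staying_pair_measurable[OF assms(13) countable_rational_times _ _ h] pair_measureI) auto
    ultimately have Em: "?E \<in> sets (borel \<Otimes>\<^sub>M M)" by simp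
    have "?I t = (\<integral>z. \<bar>transfer s t f' z\<bar> \<partial>?N)"
    proof (rule Bochner_Integration.integral_cong[OF refl])
      fix z
      have "transfer s t f' z = \<eta> * transfer_op X q s t f z"
        unfolding transfer by (simp add: transfer_op_def f'_def mult.left_commute)
      then show "\<bar>transfer_op X q s t f z\<bar> = \<bar>transfer s t f' z\<bar>" using \<eta> by (simp add: abs_mult)
    qed
    also have "\<dots> \<le> 2 * C * measure (?N \<Otimes>\<^sub>M M) ?E"
      by (rule staying_probability_ge_countable[OF assms(13) t f' C A_borel A_iff countable_rational_times J])
    also have "measure (?N \<Otimes>\<^sub>M M) ?E = measure lborel X * measure (?U \<Otimes>\<^sub>M M) ?E"
      by (rule measure_uniform_pair[OF prob_space_axioms assms(1,4,3) Em])
        (auto simp: staying_def space_restrict_space)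
    finally show ?thesis unfolding E by (simp add: mult.assoc)
  qed
  \<comment> \<open>A nonempty open set has positive volume, so the constant in front of the
    probability is positive and vanishes in the rate.\<close>
  have "measure lborel X > 0"
  proof -
    have "emeasure lborel X \<noteq> 0"
      using assms(1,3) open_not_negligible[of X] by (auto simp: negligible_iff_emeasure0)
    then show ?thesis
      using emeasure_bounded_finite[OF \<open>bounded X\<close>]
      by (simp add: measure_def enn2real_positive_iff zero_less_iff_neq_zero)
  qed
  then have "lyapunov_exponent X q s f \<le> Limsup at_top (\<lambda>t. ereal (1 / (t - s)) * ext_ln (?P t))"
    unfolding lyapunov_exponent_def using C
    by (intro Limsup_ext_ln_mono[OF _ _ I_le]) (auto intro!: Bochner_Integration.integral_nonneg)
  then show ?thesis unfolding escape_rate_def A_def by simp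
qed

end
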